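(* Let $B=\operatorname{diag}(b_1^{-1},b_2^{-1})$ with $b_1,b_2\in\mathbb{C}\setminus\{0\}$ and $a:=b_1b_2^{-1}\notin\mathbb{R}$, let $Q=\begin{pmatrix}0&Q_{12}\\ Q_{21}&0\end{pmatrix}\in L^2([0,1];\mathbb{C}^{2\times2})$, and let $h_0,h_1\in\mathbb{C}$ with $h_0h_1\neq0$. Then the system of root functions of the problem $$-iBy'+Q(x)y=\lambda y,\qquad y_1(0)-h_0y_2(0)=0,\qquad y_1(1)-h_1y_2(0)=0,$$ is complete and minimal in $L^2([0,1];\mathbb{C}^2)$.
   Context: Here $y=\operatorname{col}(y_1,y_2)$, $x\in[0,1]$. The problem is identified with the operator $L$ in $L^2([0,1];\mathbb{C}^2)$ acting by $Ly=-iBy'+Q(x)y$ on the set of $y\in W^1_2([0,1];\mathbb{C}^2)$ satisfying the two boundary conditions. Root functions are eigenfunctions and associated functions; the system of root functions is the union, over all eigenvalues $\lambda$, of bases of the root subspaces $\operatorname{span}\{\ker(L-\lambda)^k: k\in\mathbb{N}\}$. A system is complete if its closed linear span is the whole space, and minimal if no element belongs to the closed linear span of the others. *)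

theory Defs
  imports "HOL-Analysis.Analysis"
begin

subsection \<open>The Hilbert space \<open>L\<^sup>2([0,1]; \<complex>\<^sup>2)\<close>\<close>

abbreviation unit_lebesgue :: "real measure"
  where "unit_lebesgue \<equiv> lebesgue_on {0..1}"

definition square_integrable :: "(real \<Rightarrow> 'a::euclidean_space) \<Rightarrow> bool"
  where "square_integrable f \<longleftrightarrow>
    f \<in> borel_measurable unit_lebesgue \<and> integrable unit_lebesgue (\<lambda>x. (norm (f x))\<^sup>2)"

lemma square_integrable_zero: "square_integrable (\<lambda>x. 0)"
  by (simp add: square_integrable_def)

lemma square_integrable_inner:
  assumes "square_integrable f" "square_integrable g"
  shows "integrable unit_lebesgue (\<lambda>x. f x \<bullet> g x)"
proof (rule Bochner_Integration.integrable_bound)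
  show "integrable unit_lebesgue (\<lambda>x. (norm (f x))\<^sup>2 + (norm (g x))\<^sup>2)"
    using assms by (auto simp: square_integrable_def)
  show "(\<lambda>x. f x \<bullet> g x) \<in> borel_measurable unit_lebesgue"
    using assms by (auto simp: square_integrable_def intro: borel_measurable_inner)
  have "norm (f x \<bullet> g x) \<le> norm ((norm (f x))\<^sup>2 + (norm (g x))\<^sup>2)" for x
  proof -
    have "\<bar>f x \<bullet> g x\<bar> \<le> norm (f x) * norm (g x)"
      by (rule Cauchy_Schwarz_ineq2)
    moreover have "2 * (norm (f x) * norm (g x)) \<le> (norm (f x))\<^sup>2 + (norm (g x))\<^sup>2"
      using sum_squares_bound[of "norm (f x)" "norm (g x)"] by (simp add: algebra_simps)
    moreover have "0 \<le> norm (f x) * norm (g x)" by simp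
    ultimately show ?thesis by simp
  qed
  then show "AE x in unit_lebesgue. norm (f x \<bullet> g x) \<le> norm ((norm (f x))\<^sup>2 + (norm (g x))\<^sup>2)"
    by simp
qed

lemma square_integrable_add:
  assumes "square_integrable f" "square_integrable g"
  shows "square_integrable (\<lambda>x. f x + g x)"
proof -
  have "integrable unit_lebesgue (\<lambda>x. f x \<bullet> f x + 2 * (f x \<bullet> g x) + g x \<bullet> g x)"
    using assms by (intro Bochner_Integration.integrable_add integrable_mult_right square_integrable_inner)
  also have "(\<lambda>x. f x \<bullet> f x + 2 * (f x \<bullet> g x) + g x \<bullet> g x) = (\<lambda>x. (norm (f x + g x))\<^sup>2)"
    by (auto simp: power2_norm_eq_inner inner_simps inner_commute)
  finally show ?thesis
    using assms by (auto simp: square_integrable_def)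
qed

lemma square_integrable_scaleR:
  assumes "square_integrable f"
  shows "square_integrable (\<lambda>x. r *\<^sub>R f x)"
  using assms by (auto simp: square_integrable_def power_mult_distrib)

lemma norm_vector_scalar_mult: "norm (c *s v) = cmod c * norm (v :: complex^'n)"
  by (simp add: norm_vec_def vector_scalar_mult_def norm_mult L2_set_right_distrib)

lemma square_integrable_scaleC:
  fixes f :: "real \<Rightarrow> complex^'n"
  assumes "square_integrable f"
  shows "square_integrable (\<lambda>x. c *s f x)"
proof -
  have "bounded_linear (\<lambda>v :: complex^'n. c *s v)"
    by (intro bounded_linear_intro[where K = "cmod c"])
      (auto simp: vec_eq_iff algebra_simps norm_vector_scalar_mult)
  then have "(\<lambda>v :: complex^'n. c *s v) \<in> borel_measurable borel"
    by (intro borel_measurable_continuous_onI linear_continuous_on)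
  then show ?thesis
    using assms
    by (auto simp: square_integrable_def norm_vector_scalar_mult power_mult_distrib
        intro: measurable_compose[where g = "\<lambda>v. c *s v"])
qed

definition L2_eq :: "(real \<Rightarrow> complex^2) \<Rightarrow> (real \<Rightarrow> complex^2) \<Rightarrow> bool"
  where "L2_eq f g \<longleftrightarrow>
    square_integrable f \<and> square_integrable g \<and> (AE x in unit_lebesgue. f x = g x)"

quotient_type L2 = "real \<Rightarrow> complex^2" / partial: L2_eq
proof (rule part_equivpI)
  show "\<exists>f. L2_eq f f"
    by (rule exI[of _ "\<lambda>x. 0"]) (simp add: L2_eq_def square_integrable_zero)
  show "symp L2_eq"
    by (auto simp: symp_def L2_eq_def)
  show "transp L2_eq"
    by (auto simp: transp_def L2_eq_def)
qed

instantiation L2 :: real_vector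
begin

lift_definition zero_L2 :: L2 is "\<lambda>x. 0"
  by (simp add: L2_eq_def square_integrable_zero)

lift_definition plus_L2 :: "L2 \<Rightarrow> L2 \<Rightarrow> L2" is "\<lambda>f g x. f x + g x"
  by (auto simp: L2_eq_def square_integrable_add)

lift_definition scaleR_L2 :: "real \<Rightarrow> L2 \<Rightarrow> L2" is "\<lambda>r f x. r *\<^sub>R f x"
  by (auto simp: L2_eq_def square_integrable_scaleR)

definition uminus_L2 :: "L2 \<Rightarrow> L2"
  where "uminus_L2 y = (-1) *\<^sub>R y"

definition minus_L2 :: "L2 \<Rightarrow> L2 \<Rightarrow> L2"
  where "minus_L2 y z = y + (-1) *\<^sub>R z"

instance
proof
  fix x y z :: L2 and a b :: real
  show "x + y + z = x + (y + z)"
    by transfer (simp add: L2_eq_def square_integrable_add add.assoc)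
  show "x + y = y + x"
    by transfer (simp add: L2_eq_def square_integrable_add add.commute)
  show "0 + x = x"
    by transfer (simp add: L2_eq_def)
  show "- x + x = 0"
    unfolding uminus_L2_def
    by transfer (simp add: L2_eq_def square_integrable_zero)
  show "x - y = x + - y"
    by (simp add: uminus_L2_def minus_L2_def)
  show "a *\<^sub>R (x + y) = a *\<^sub>R x + a *\<^sub>R y"
    by transfer (simp add: L2_eq_def square_integrable_add square_integrable_scaleR scaleR_add_right)
  show "(a + b) *\<^sub>R x = a *\<^sub>R x + b *\<^sub>R x"
    by transfer (simp add: L2_eq_def square_integrable_add square_integrable_scaleR scaleR_add_left)
  show "a *\<^sub>R b *\<^sub>R x = (a * b) *\<^sub>R x"
    by transfer (simp add: L2_eq_def square_integrable_scaleR)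
  show "1 *\<^sub>R x = x"
    by transfer (simp add: L2_eq_def)
qed

end

text \<open>
  The real inner product below is the real part of the Hermitian one, so it induces the usual
  \<open>L\<^sup>2\<close> norm \<open>(\<integral> \<bar>y\<^sub>1\<bar>\<^sup>2 + \<bar>y\<^sub>2\<bar>\<^sup>2)\<^sup>1\<^sup>/\<^sup>2\<close>.
\<close>

instantiation L2 :: real_inner
begin

lift_definition inner_L2 :: "L2 \<Rightarrow> L2 \<Rightarrow> real" is "\<lambda>f g. \<integral>x. f x \<bullet> g x \<partial>unit_lebesgue"
proof -
  fix f f' g g' :: "real \<Rightarrow> complex^2"
  assume "L2_eq f f'" "L2_eq g g'"
  then have 1: "(\<lambda>x. f x \<bullet> g x) \<in> borel_measurable unit_lebesgue"
    "(\<lambda>x. f' x \<bullet> g' x) \<in> borel_measurable unit_lebesgue"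
    and 2: "AE x in unit_lebesgue. f x = f' x" "AE x in unit_lebesgue. g x = g' x"
    by (auto simp: L2_eq_def square_integrable_def intro: borel_measurable_inner)
  from 2 have "AE x in unit_lebesgue. f x \<bullet> g x = f' x \<bullet> g' x"
    by eventually_elim simp
  with 1 show "(\<integral>x. f x \<bullet> g x \<partial>unit_lebesgue) = (\<integral>x. f' x \<bullet> g' x \<partial>unit_lebesgue)"
    by (intro integral_cong_AE)
qed

definition norm_L2 :: "L2 \<Rightarrow> real"
  where "norm_L2 y = sqrt (y \<bullet> y)"

definition sgn_L2 :: "L2 \<Rightarrow> L2"
  where "sgn_L2 y = y /\<^sub>R norm y"

definition dist_L2 :: "L2 \<Rightarrow> L2 \<Rightarrow> real"
  where "dist_L2 y z = norm (y - z)"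

definition uniformity_L2 :: "(L2 \<times> L2) filter"
  where "uniformity_L2 = (INF e\<in>{0 <..}. principal {(y, z). dist y z < e})"

definition open_L2 :: "L2 set \<Rightarrow> bool"
  where "open_L2 U \<longleftrightarrow> (\<forall>y\<in>U. eventually (\<lambda>(y', z). y' = y \<longrightarrow> z \<in> U) uniformity)"

instance
proof
  fix x y z :: L2 and r :: real and U :: "L2 set"
  show "x \<bullet> y = y \<bullet> x"
    by transfer (simp add: inner_commute)
  show "(x + y) \<bullet> z = x \<bullet> z + y \<bullet> z"
    by transfer (simp add: L2_eq_def inner_add_left square_integrable_inner)
  show "(r *\<^sub>R x) \<bullet> y = r * (x \<bullet> y)"
    by transfer simp
  show "0 \<le> x \<bullet> x"
    by transfer simp
  show "x \<bullet> x = 0 \<longleftrightarrow> x = 0"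
  proof transfer
    fix f :: "real \<Rightarrow> complex^2"
    assume "L2_eq f f"
    then have f: "square_integrable f" by (simp add: L2_eq_def)
    have "(\<integral>x. f x \<bullet> f x \<partial>unit_lebesgue) = 0 \<longleftrightarrow> (AE x in unit_lebesgue. f x \<bullet> f x = 0)"
      by (intro integral_nonneg_eq_0_iff_AE square_integrable_inner f) simp
    also have "\<dots> \<longleftrightarrow> L2_eq f (\<lambda>x. 0)"
      using f by (simp add: L2_eq_def square_integrable_zero)
    finally show "((\<integral>x. f x \<bullet> f x \<partial>unit_lebesgue) = 0) = L2_eq f (\<lambda>x. 0)" .
  qed
  show "norm x = sqrt (x \<bullet> x)" by (rule norm_L2_def)
  show "sgn x = x /\<^sub>R norm x" by (rule sgn_L2_def)
  show "dist x y = norm (x - y)" by (rule dist_L2_def)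
  show "(uniformity :: (L2 \<times> L2) filter) = (INF e\<in>{0 <..}. principal {(y, z). dist y z < e})"
    by (rule uniformity_L2_def)
  show "open U = (\<forall>y\<in>U. eventually (\<lambda>(y', z). y' = y \<longrightarrow> z \<in> U) uniformity)"
    by (rule open_L2_def)
qed

end

lift_definition scaleC_L2 :: "complex \<Rightarrow> L2 \<Rightarrow> L2" (infixr \<open>*\<^sub>C\<close> 75) is "\<lambda>c f x. c *s f x"
  by (auto simp: L2_eq_def square_integrable_scaleC)

interpretation cL2: vector_space scaleC_L2
proof
  fix a b :: complex and x y :: L2
  show "a *\<^sub>C (x + y) = a *\<^sub>C x + a *\<^sub>C y"
    by transfer (simp add: L2_eq_def square_integrable_add square_integrable_scaleC
        vector_add_ldistrib)
  show "(a + b) *\<^sub>C x = a *\<^sub>C x + b *\<^sub>C x"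
    by transfer (simp add: L2_eq_def square_integrable_add square_integrable_scaleC
        vector_sadd_rdistrib)
  show "a *\<^sub>C b *\<^sub>C x = (a * b) *\<^sub>C x"
    by transfer (simp add: L2_eq_def square_integrable_scaleC vector_smult_assoc)
  show "1 *\<^sub>C x = x"
    by transfer (simp add: L2_eq_def)
qed


subsection \<open>The operator\<close>

text \<open>
  \<open>W12_deriv y y'\<close>: \<open>y\<close> is (on \<open>[0,1]\<close>) the absolutely continuous representative of an element of
  \<open>W\<^sup>1\<^sub>2([0,1]; \<complex>\<^sup>2)\<close> and \<open>y' \<in> L\<^sup>2\<close> is its derivative.
\<close>

definition W12_deriv :: "(real \<Rightarrow> complex^2) \<Rightarrow> (real \<Rightarrow> complex^2) \<Rightarrow> bool"
  where "W12_deriv y y' \<longleftrightarrow> square_integrable y' \<and>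
    (\<forall>x\<in>{0..1}. y x = y 0 + (\<integral>t. y' t \<partial>lebesgue_on {0..x}))"

text \<open>
  The operator is represented by its graph. The boundary conditions are imposed on the absolutely
  continuous representative. \<open>abs_L2\<close> is only applied to square integrable functions here, provided
  \<open>Q\<close> is square integrable.
\<close>

definition dirac_operator ::
    "complex^2^2 \<Rightarrow> (real \<Rightarrow> complex^2^2) \<Rightarrow> complex \<Rightarrow> complex \<Rightarrow> (L2 \<times> L2) set"
  where "dirac_operator B Q h0 h1 =
    {(abs_L2 y, abs_L2 (\<lambda>x. - (\<i> *s (B *v y' x)) + Q x *v y x)) | y y'.
       W12_deriv y y' \<and> y 0 $ 1 - h0 * y 0 $ 2 = 0 \<and> y 1 $ 1 - h1 * y 0 $ 2 = 0}"


subsection \<open>Root functions of an operator given by its graph\<close>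

definition shifted :: "(L2 \<times> L2) set \<Rightarrow> complex \<Rightarrow> (L2 \<times> L2) set"
  where "shifted L \<mu> = {(y, f - \<mu> *\<^sub>C y) | y f. (y, f) \<in> L}"

definition kernel :: "(L2 \<times> L2) set \<Rightarrow> L2 set"
  where "kernel L = {y. (y, 0) \<in> L}"

definition eigenvalues :: "(L2 \<times> L2) set \<Rightarrow> complex set"
  where "eigenvalues L = {\<mu>. \<exists>y. y \<noteq> 0 \<and> (y, \<mu> *\<^sub>C y) \<in> L}"

text \<open>
  Powers of relations are powers of (partially defined) operators with their natural domains.
\<close>

definition root_subspace :: "(L2 \<times> L2) set \<Rightarrow> complex \<Rightarrow> L2 set"
  where "root_subspace L \<mu> = cL2.span (\<Union>k. kernel (shifted L \<mu> ^^ k))"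

definition root_function_system :: "(L2 \<times> L2) set \<Rightarrow> L2 set \<Rightarrow> bool"
  where "root_function_system L S \<longleftrightarrow>
    (\<exists>b. (\<forall>\<mu>\<in>eigenvalues L. cL2.independent (b \<mu>) \<and> cL2.span (b \<mu>) = root_subspace L \<mu>) \<and>
         S = (\<Union>\<mu>\<in>eigenvalues L. b \<mu>))"

definition complete_system :: "L2 set \<Rightarrow> bool"
  where "complete_system S \<longleftrightarrow> closure (cL2.span S) = UNIV"

definition minimal_system :: "L2 set \<Rightarrow> bool"
  where "minimal_system S \<longleftrightarrow> (\<forall>y\<in>S. y \<notin> closure (cL2.span (S - {y})))"

end

theory Submission
  imports Defs "HOL-Complex_Analysis.Complex_Analysis"
begin

text \<open>
  Let \<open>\<phi>(\<cdot>, \<lambda>)\<close> solve the equation with \<open>\<phi>(0) = (h\<^sub>0, 1)\<close> and let \<open>\<Delta>(\<lambda>) = \<phi>\<^sub>1(1, \<lambda>) - h\<^sub>1\<close>. If \<open>g\<close> is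
  orthogonal to all root functions, then \<open>F(\<lambda>) = \<integral> \<phi>(\<cdot>, \<lambda>) g\<close> vanishes at the zeros of \<open>\<Delta>\<close> with their
  multiplicities, because the \<open>\<lambda>\<close>-derivatives of \<open>\<phi>\<close> at such a zero are root functions; hence
  \<open>F / \<Delta>\<close> is entire, and it is of exponential type. Since \<open>b\<^sub>1 / b\<^sub>2\<close> is not real, the growth rates
  \<open>Re (i b\<^sub>1 \<lambda>)\<close> and \<open>Re (i b\<^sub>2 \<lambda>)\<close> can be prescribed independently along a ray. On three rays cutting
  the plane into sectors of opening less than \<open>\<pi>\<close> the quotient is bounded, on two of them it tends to
  \<open>0\<close>, so \<open>F = 0\<close> by Phragmen-Lindeloef. By Green's formula \<open>F\<close> is a combination of the end values of
  the solution \<open>z\<close> of the adjoint problem with source \<open>g\<close>; now \<open>F = 0\<close> makes the two end values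
  proportional, \<open>z\<close> itself decays along three such rays, and so \<open>z = 0\<close> and \<open>g = 0\<close>.

  For minimality, let \<open>y\<close> solve the equation with source \<open>x\<close> and \<open>y(0) = 0\<close>. If \<open>\<mu>\<close> is a zero of \<open>\<Delta>\<close>
  of order \<open>m\<close>, the first \<open>m\<close> Taylor coefficients of \<open>y\<^sub>1(1)\<close> at \<open>\<mu>\<close> are bounded functionals of \<open>x\<close> which
  separate the points of the root subspace of \<open>\<mu>\<close> and vanish on all the other root subspaces.
\<close>

subsection \<open>Integration on the unit interval\<close>

text \<open>The coefficients are merely square integrable, so every asymptotic statement rests on
  one gain: the factor 1 / sqrt |\<delta>| from integrating |q| against an exponential weight of
  rate \<delta>. On a ray this bounds the supremum of a solution by a constant plus half of itself.
  The boundary constants enter through the size of \<Delta>: where both rates are negative, \<phi>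
  decays at 1 and \<Delta> tends to -h1; where the first rate is positive and the larger one,
  \<Delta> behaves like h0 exp (i b1 \<lambda>), and this growth also bounds F. Hence both constants
  must be nonzero for F / \<Delta> to be controlled there. That F / \<Delta> is of exponential type
  needs a lower bound for \<Delta>, which has zeros; these are reflected in a large circle, and
  Harnack's inequality is applied to the zero-free function that results. Finally, F = 0 does not
  give g = 0 at once, since F sees only one combination of the end values of z. This is why a second
  argument with three rays follows, on rays where at least one rate is negative.\<close>

lemma integrable_unit_lebesgue_iff:
  fixes f :: "real \<Rightarrow> 'a::euclidean_space"
  shows "integrable unit_lebesgue f \<longleftrightarrow> f absolutely_integrable_on {0..1}"
  by (simp add: set_integrable_def integrable_restrict_space)

lemma integral_unit_lebesgue_eq:
  fixes f :: "real \<Rightarrow> 'a::euclidean_space"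
  assumes "f absolutely_integrable_on {0..1}"
  shows "integral\<^sup>L unit_lebesgue f = integral {0..1} f"
  using assms by (intro lebesgue_integral_eq_integral) (auto simp: integrable_unit_lebesgue_iff)

lemma square_integrable_imp_absolutely_integrable:
  fixes f :: "real \<Rightarrow> 'a::euclidean_space"
  assumes "square_integrable f"
  shows "f absolutely_integrable_on {0..1}"
    and "(\<lambda>x. (norm (f x))\<^sup>2) absolutely_integrable_on {0..1}"
proof -
  show sq: "(\<lambda>x. (norm (f x))\<^sup>2) absolutely_integrable_on {0..1}"
    using assms by (simp add: square_integrable_def flip: integrable_unit_lebesgue_iff)
  show "f absolutely_integrable_on {0..1}"
  proof (rule measurable_bounded_by_integrable_imp_absolutely_integrable)
    show "f \<in> borel_measurable unit_lebesgue" using assms by (simp add: square_integrable_def)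
    show "(\<lambda>x. 1 + (norm (f x))\<^sup>2) integrable_on {0..1}"
      using sq absolutely_integrable_imp_integrable
      by (intro integrable_add integrable_const_ivl) (auto simp: absolutely_integrable_on_def)
    show "norm (f x) \<le> 1 + (norm (f x))\<^sup>2" for x
      using self_le_power[of "norm (f x)" 2] zero_le_power2[of "norm (f x)"]
      by (cases "norm (f x) \<le> 1") (linarith, simp)
  qed simp
qed

lemma absolutely_integrable_mult_continuous:
  fixes p y :: "real \<Rightarrow> complex"
  assumes "p absolutely_integrable_on {a..b}" "continuous_on {a..b} y"
  shows "(\<lambda>t. p t * y t) absolutely_integrable_on {a..b}"
  using assms
  by (intro absolutely_integrable_bounded_measurable_product[where h = "\<lambda>a b. b * a"])
     (auto intro!: bilinear_conv_bounded_bilinear[THEN iffD2]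
        bounded_bilinear.flip[OF bounded_bilinear_mult]
        continuous_imp_measurable_on_sets_lebesgue compact_imp_bounded compact_continuous_image)

lemma square_integrable_mult_continuous:
  fixes q y :: "real \<Rightarrow> complex"
  assumes q: "square_integrable q" and y: "continuous_on {0..1} y"
  shows "square_integrable (\<lambda>t. q t * y t)"
proof -
  have m: "q \<in> borel_measurable unit_lebesgue" "y \<in> borel_measurable unit_lebesgue"
    using q y by (auto simp: square_integrable_def intro: continuous_imp_measurable_on_sets_lebesgue)
  have "bounded (y ` {0..1})"
    using y by (intro compact_imp_bounded compact_continuous_image) auto
  then obtain C where C: "\<And>x. x \<in> {0..1} \<Longrightarrow> norm (y x) \<le> C"
    unfolding bounded_iff by (metis imageI)
  have "integrable unit_lebesgue (\<lambda>x. C\<^sup>2 * (norm (q x))\<^sup>2)"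
    using q by (auto simp: square_integrable_def)
  then have "integrable unit_lebesgue (\<lambda>x. (norm (q x * y x))\<^sup>2)"
  proof (rule Bochner_Integration.integrable_bound)
    show "(\<lambda>x. (norm (q x * y x))\<^sup>2) \<in> borel_measurable unit_lebesgue"
      using m by measurable
    have "(norm (y x))\<^sup>2 \<le> C\<^sup>2" if "x \<in> {0..1}" for x using C[OF that] by (intro power_mono) auto
    then show "AE x in unit_lebesgue. norm ((norm (q x * y x))\<^sup>2) \<le> norm (C\<^sup>2 * (norm (q x))\<^sup>2)"
      by (intro AE_I2) (simp add: norm_mult power_mult_distrib mult.commute[of "C\<^sup>2"] mult_left_mono)
  qed
  then show ?thesis using m by (auto simp: square_integrable_def)
qed

lemma square_integrable_continuous:
  fixes y :: "real \<Rightarrow> complex"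
  assumes y: "continuous_on {0..1} y"
  shows "square_integrable y"
proof -
  have "square_integrable (\<lambda>x. 1::complex)"
    unfolding square_integrable_def integrable_unit_lebesgue_iff
    by (auto intro!: absolutely_integrable_continuous_real)
  from square_integrable_mult_continuous[OF this y] show ?thesis by simp
qed

lemma square_integrable_cmult:
  fixes f :: "real \<Rightarrow> complex"
  assumes "square_integrable f"
  shows "square_integrable (\<lambda>x. c * f x)"
  using square_integrable_mult_continuous[OF assms, of "\<lambda>x. c"] by (simp add: mult.commute)

lemma integral_exp_scaled:
  assumes "(\<delta>::real) \<noteq> 0" "a \<le> b"
  shows "((\<lambda>t. exp (\<delta> * (t - c))) has_integral (exp (\<delta> * (b - c)) - exp (\<delta> * (a - c))) / \<delta>) {a..b}"
proof -
  have "((\<lambda>t. exp (\<delta> * (t - c))) has_integral exp (\<delta> * (b - c)) / \<delta> - exp (\<delta> * (a - c)) / \<delta>) {a..b}"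
    using assms
    by (intro fundamental_theorem_of_calculus)
      (auto intro!: derivative_eq_intros simp flip: has_real_derivative_iff_has_vector_derivative)
  then show ?thesis by (simp add: diff_divide_distrib)
qed

text \<open>AM-GM: \<open>2 w \<bar>q\<bar> \<le> \<delta>\<^sup>1\<^sup>/\<^sup>2 w\<^sup>2 + \<delta>\<^sup>-\<^sup>1\<^sup>/\<^sup>2 \<bar>q\<bar>\<^sup>2\<close> for the exponential weight \<open>w\<close>.\<close>

lemma integral_exp_norm_le:
  fixes q :: "real \<Rightarrow> complex"
  assumes q: "square_integrable q" and \<delta>: "\<bar>\<delta>\<bar> > 0"
    and ab: "0 \<le> a" "a \<le> b" "b \<le> 1" and c: "\<delta> > 0 \<Longrightarrow> c = b" "\<delta> < 0 \<Longrightarrow> c = a"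
  shows "integral {a..b} (\<lambda>t. exp (\<delta> * (t - c)) * norm (q t))
    \<le> (1 + integral {0..1} (\<lambda>t. (norm (q t))\<^sup>2)) / sqrt \<bar>\<delta>\<bar>"
proof -
  have sub: "{a..b} \<subseteq> {0..1}" using ab by auto
  let ?N = "integral {0..1} (\<lambda>t. (norm (q t))\<^sup>2)"
  let ?k = "sqrt \<bar>\<delta>\<bar>"
  have k: "?k > 0" "?k * ?k = \<bar>\<delta>\<bar>" using \<delta> by auto
  have ai: "q absolutely_integrable_on {a..b}" "(\<lambda>x. (norm (q x))\<^sup>2) absolutely_integrable_on {a..b}"
    using square_integrable_imp_absolutely_integrable[OF q] sub absolutely_integrable_on_subinterval
    by blast+
  have qi: "(\<lambda>x. (norm (q x))\<^sup>2) integrable_on {a..b}" "(\<lambda>x. (norm (q x))\<^sup>2) integrable_on {0..1}"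
    using ai(2) square_integrable_imp_absolutely_integrable(2)[OF q]
    by (auto simp: absolutely_integrable_on_def)
  have N: "integral {a..b} (\<lambda>t. (norm (q t))\<^sup>2) \<le> ?N"
    by (rule integral_subset_le[OF sub qi]) auto
  have N0: "?N \<ge> 0" by (rule integral_nonneg[OF qi(2)]) auto
  \<comment> \<open>\<open>c\<close> is the end of the interval at which the weight is largest, so
    the weight is at most 1 and its square has integral at most 1 / (2 |\<delta>|).\<close>
  define J where "J = (exp (2 * \<delta> * (b - c)) - exp (2 * \<delta> * (a - c))) / (2 * \<delta>)"
  have J: "((\<lambda>t. exp (2 * \<delta> * (t - c))) has_integral J) {a..b}"
    unfolding J_def using integral_exp_scaled[of "2 * \<delta>" a b c] \<delta> ab by simp
  have Jle: "J \<le> 1 / (2 * \<bar>\<delta>\<bar>)"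
  proof (cases "\<delta> > 0")
    case True
    then show ?thesis using c(1) by (simp add: J_def divide_right_mono)
  next
    case False
    then have "\<delta> < 0" using \<delta> by simp
    then have "J = (1 - exp (2 * \<delta> * (b - a))) / (2 * \<bar>\<delta>\<bar>)"
      using c(2) by (simp add: J_def field_simps)
    then show ?thesis by (simp add: divide_right_mono)
  qed
  have i1: "(\<lambda>t. exp (\<delta> * (t - c)) * norm (q t)) integrable_on {a..b}"
  proof -
    have "(\<lambda>t. exp (\<delta> * (t - c)) * norm (q t)) absolutely_integrable_on {a..b}"
      using absolutely_integrable_norm[OF ai(1)]
      by (intro absolutely_integrable_bounded_measurable_product_real)
        (auto intro!: continuous_imp_measurable_on_sets_lebesgue compact_imp_bounded
          compact_continuous_image continuous_intros simp: o_def)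
    then show ?thesis by (simp add: absolutely_integrable_on_def)
  qed
  have "integral {a..b} (\<lambda>t. exp (\<delta> * (t - c)) * norm (q t))
    \<le> integral {a..b} (\<lambda>t. ?k / 2 * exp (2 * \<delta> * (t - c)) + 1 / (2 * ?k) * (norm (q t))\<^sup>2)"
  proof (rule integral_le[OF i1])
    show "(\<lambda>t. ?k / 2 * exp (2 * \<delta> * (t - c)) + 1 / (2 * ?k) * (norm (q t))\<^sup>2) integrable_on {a..b}"
      by (intro integrable_add integrable_on_mult_right has_integral_integrable[OF J] qi(1))
    show "exp (\<delta> * (t - c)) * norm (q t)
        \<le> ?k / 2 * exp (2 * \<delta> * (t - c)) + 1 / (2 * ?k) * (norm (q t))\<^sup>2" for t
    proof -
      have "0 \<le> (?k * exp (\<delta> * (t - c)) - norm (q t))\<^sup>2 / (2 * ?k)" using k by simp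
      also have "\<dots> = (?k * ?k * (exp (\<delta> * (t - c)))\<^sup>2 - 2 * ?k * exp (\<delta> * (t - c)) * norm (q t) + (norm (q t))\<^sup>2) / (2 * ?k)"
        by (simp add: power2_eq_square algebra_simps)
      also have "\<dots> = ?k / 2 * (exp (\<delta> * (t - c)))\<^sup>2 - exp (\<delta> * (t - c)) * norm (q t) + 1 / (2 * ?k) * (norm (q t))\<^sup>2"
        using k(1) by (simp add: add_divide_distrib diff_divide_distrib del: real_sqrt_mult_self)
      also have "(exp (\<delta> * (t - c)))\<^sup>2 = exp (2 * \<delta> * (t - c))"
        using exp_of_nat_mult[of 2 "\<delta> * (t - c)"] by (simp add: mult.assoc)
      finally show ?thesis by simp
    qed
  qed
  also have "\<dots> = ?k / 2 * J + 1 / (2 * ?k) * integral {a..b} (\<lambda>t. (norm (q t))\<^sup>2)"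
  proof -
    have "integral {a..b} (\<lambda>t. ?k / 2 * exp (2 * \<delta> * (t - c))) = ?k / 2 * J"
      by (rule integral_unique, rule has_integral_mult_right[OF J])
    moreover have "integral {a..b} (\<lambda>t. 1 / (2 * ?k) * (norm (q t))\<^sup>2)
        = 1 / (2 * ?k) * integral {a..b} (\<lambda>t. (norm (q t))\<^sup>2)"
      by (rule integral_mult_right)
    ultimately show ?thesis
      using Henstock_Kurzweil_Integration.integral_add[OF integrable_on_mult_right[OF has_integral_integrable[OF J], of "?k / 2"]
          integrable_on_mult_right[OF qi(1), of "1 / (2 * ?k)"]] by simp
  qed
  also have "\<dots> \<le> ?k / 2 * (1 / (2 * (?k * ?k))) + 1 / (2 * ?k) * ?N"
    using Jle N k by (intro add_mono mult_left_mono) auto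
  also have "?k / 2 * (1 / (2 * (?k * ?k))) = 1 / (4 * ?k)"
    using k(1) by (simp add: divide_simps del: real_sqrt_mult_self)
  also have "1 / (4 * ?k) + 1 / (2 * ?k) * ?N \<le> (1 + ?N) / ?k"
    using k(1) N0 by (simp add: field_simps del: real_sqrt_mult_self)
  finally show ?thesis .
qed

section \<open>Product rule and vanishing criterion for indefinite integrals\<close>

text \<open>Cutting [0,x] into pieces shorter than d and telescoping turns the local bound into the
  bound e (V x - V 0), for every e > 0. This gives identities between indefinite integrals without
  differentiating almost everywhere.\<close>

lemma eq_if_locally_dominated:
  fixes D :: "real \<Rightarrow> complex" and V :: "real \<Rightarrow> real"
  assumes loc: "\<And>e. e > 0 \<Longrightarrow> \<exists>d>0. \<forall>x y. 0 \<le> x \<longrightarrow> x \<le> y \<longrightarrow> y \<le> 1 \<longrightarrow> y - x < d \<longrightarrow>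
      norm (D y - D x) \<le> e * (V y - V x)"
    and x: "0 \<le> x" "x \<le> 1"
  shows "D x = D 0"
proof -
  have "norm (D x - D 0) \<le> e * (V x - V 0)" if e: "e > 0" for e
  proof -
    obtain d where d: "d > 0" "\<And>x y. 0 \<le> x \<Longrightarrow> x \<le> y \<Longrightarrow> y \<le> 1 \<Longrightarrow> y - x < d \<Longrightarrow> norm (D y - D x) \<le> e * (V y - V x)"
      using loc[OF e] by blast
    obtain n where n: "inverse (real (Suc n)) < d" using reals_Archimedean[OF d(1)] by blast
    define p where "p k = x * real k / real (Suc n)" for k
    have "norm (D (p k) - D 0) \<le> e * (V (p k) - V 0)" if "k \<le> Suc n" for k
      using that
    proof (induction k)
      case 0 then show ?case by (simp add: p_def)
    next
      case (Suc k)
      have step: "p (Suc k) - p k = x * inverse (real (Suc n))"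
        unfolding p_def of_nat_Suc[of k] by (simp add: divide_inverse algebra_simps del: of_nat_Suc)
      have "x * inverse (real (Suc n)) \<le> 1 * inverse (real (Suc n))"
        using x by (intro mult_right_mono) auto
      then have lt: "p (Suc k) - p k < d" using n step by linarith
      have le: "p k \<le> p (Suc k)" using step x by (metis diff_ge_0_iff_ge inverse_nonnegative_iff_nonnegative mult_nonneg_nonneg of_nat_0_le_iff)
      have "x * real (Suc k) \<le> 1 * real (Suc n)" using x Suc.prems by (intro mult_mono) auto
      then have p1: "p (Suc k) \<le> 1" unfolding p_def by (simp add: field_simps)
      have p0: "p k \<ge> 0" using x by (simp add: p_def)
      have "norm (D (p (Suc k)) - D 0) \<le> norm (D (p (Suc k)) - D (p k)) + norm (D (p k) - D 0)"
        using norm_triangle_ineq[of "D (p (Suc k)) - D (p k)" "D (p k) - D 0"] by simp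
      also have "\<dots> \<le> e * (V (p (Suc k)) - V (p k)) + e * (V (p k) - V 0)"
        by (intro add_mono d(2) p0 le p1 lt Suc.IH) (use Suc.prems in simp)
      finally show ?case by (simp add: algebra_simps)
    qed
    moreover have "p (Suc n) = x"
      unfolding p_def by (rule nonzero_mult_div_cancel_right) (simp del: of_nat_Suc)
    ultimately show ?thesis by (metis order_refl)
  qed
  note * = this
  have "norm (D x - D 0) \<le> 0 + e" if e: "e > 0" for e
  proof -
    \<comment> \<open>The summand 1 keeps the divisor positive when V x = V 0.\<close>
    let ?v = "\<bar>V x - V 0\<bar> + 1"
    have "norm (D x - D 0) \<le> e / ?v * (V x - V 0)" by (rule *) (use e in auto)
    also have "\<dots> \<le> e / ?v * ?v" using e by (intro mult_left_mono) auto
    finally show ?thesis by simp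
  qed
  then have "norm (D x - D 0) \<le> 0" by (rule field_le_epsilon)
  then show ?thesis by simp
qed

lemma integral_diff_eq:
  fixes f :: "real \<Rightarrow> 'a::euclidean_space"
  assumes "f absolutely_integrable_on {0..1}" "0 \<le> x" "x \<le> y" "y \<le> 1"
  shows "integral {0..y} f - integral {0..x} f = integral {x..y} f"
proof -
  have "f integrable_on {0..y}"
    using assms absolutely_integrable_on_subinterval[where f = f and S = "{0..1}" and a = 0 and b = y]
    by (auto simp: absolutely_integrable_on_def)
  then show ?thesis
    using Henstock_Kurzweil_Integration.integral_combine[where a = 0 and c = x and b = y and f = f] assms by (simp add: algebra_simps)
qed

text \<open>With D the difference of the two sides, the increment of D over [x,y] is the integral of
  p(t) (R y - R t) + (P x - P t) r(t). On short intervals the brackets are small by uniform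
  continuity, so the increment is dominated by that of the indefinite integral of |p| + |r|.\<close>

lemma absolutely_continuous_product:
  fixes p r P R :: "real \<Rightarrow> complex"
  assumes p: "p absolutely_integrable_on {0..1}" and r: "r absolutely_integrable_on {0..1}"
    and P: "\<And>x. x \<in> {0..1} \<Longrightarrow> P x = P 0 + integral {0..x} p"
    and R: "\<And>x. x \<in> {0..1} \<Longrightarrow> R x = R 0 + integral {0..x} r"
    and x: "x \<in> {0..1}"
  shows "P x * R x = P 0 * R 0 + integral {0..x} (\<lambda>t. p t * R t + P t * r t)"
proof -
  have cont: "continuous_on {0..1} P" "continuous_on {0..1} R"
  proof -
    have "p integrable_on {0..1}" "r integrable_on {0..1}"
      using p r by (simp_all only: absolutely_integrable_on_def)
    have "continuous_on {0..1} (\<lambda>x. P 0 + integral {0..x} p)"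
      by (intro continuous_on_add continuous_on_const indefinite_integral_continuous_1) fact
    then show "continuous_on {0..1} P" by (subst continuous_on_cong[OF refl P])
    have "continuous_on {0..1} (\<lambda>x. R 0 + integral {0..x} r)"
      by (intro continuous_on_add continuous_on_const indefinite_integral_continuous_1) fact
    then show "continuous_on {0..1} R" by (subst continuous_on_cong[OF refl R])
  qed
  have pR: "(\<lambda>t. p t * R t) absolutely_integrable_on {0..1}"
    and Pr: "(\<lambda>t. P t * r t) absolutely_integrable_on {0..1}"
    using absolutely_integrable_mult_continuous[OF p cont(2)]
      absolutely_integrable_mult_continuous[OF r cont(1)] by (simp_all only: mult.commute)
  then have i: "(\<lambda>t. p t * R t + P t * r t) absolutely_integrable_on {0..1}"
    by (rule set_integral_add(1))
  have v: "(\<lambda>t. norm (p t) + norm (r t)) absolutely_integrable_on {0..1}"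
    using set_integral_add(1)[OF absolutely_integrable_norm[OF p] absolutely_integrable_norm[OF r]]
    by (simp only: o_def)
  define D where "D x = P x * R x - integral {0..x} (\<lambda>t. p t * R t + P t * r t)" for x
  define V where "V x = integral {0..x} (\<lambda>t. norm (p t) + norm (r t))" for x
  have "D x = D 0"
  proof (rule eq_if_locally_dominated[where V = V])
    fix e :: real assume e: "e > 0"
    have "uniformly_continuous_on {0..1} P" "uniformly_continuous_on {0..1} R"
      using cont by (auto intro!: compact_uniformly_continuous)
    then obtain d1 d2 where d: "d1 > 0" "d2 > 0"
      "\<And>x y. x \<in> {0..1} \<Longrightarrow> y \<in> {0..1} \<Longrightarrow> dist y x < d1 \<Longrightarrow> dist (P y) (P x) < e"
      "\<And>x y. x \<in> {0..1} \<Longrightarrow> y \<in> {0..1} \<Longrightarrow> dist y x < d2 \<Longrightarrow> dist (R y) (R x) < e"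
      unfolding uniformly_continuous_on_def using e by metis
    have "norm (D y - D x) \<le> e * (V y - V x)"
      if xy: "0 \<le> x" "x \<le> y" "y \<le> 1" "y - x < min d1 d2" for x y
    proof -
      note sub = absolutely_integrable_on_subinterval[where S = "{0..1}" and a = x and b = y]
      have sub': "{x..y} \<subseteq> {0..1}" using xy by auto
      have ii: "p integrable_on {x..y}" "r integrable_on {x..y}" "(\<lambda>t. p t * R t) integrable_on {x..y}"
        "(\<lambda>t. P t * r t) integrable_on {x..y}" "(\<lambda>t. norm (p t) + norm (r t)) integrable_on {x..y}"
        using sub[OF p sub'] sub[OF r sub'] sub[OF pR sub'] sub[OF Pr sub'] sub[OF v sub']
        by (auto simp: absolutely_integrable_on_def)
      have inc: "P y - P x = integral {x..y} p" "R y - R x = integral {x..y} r"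
        using P[of x] P[of y] R[of x] R[of y] integral_diff_eq[OF p xy(1-3)] integral_diff_eq[OF r xy(1-3)] xy
        by auto
      have "P y * R y - P x * R x = integral {x..y} p * R y + P x * integral {x..y} r"
        by (simp add: algebra_simps flip: inc)
      also have "\<dots> = integral {x..y} (\<lambda>t. p t * R y + P x * r t)"
        using ii by (subst integral_add) (auto intro: integrable_on_mult_left integrable_on_mult_right)
      finally have "P y * R y - P x * R x - integral {x..y} (\<lambda>t. p t * R t + P t * r t)
        = integral {x..y} (\<lambda>t. p t * R y + P x * r t) - integral {x..y} (\<lambda>t. p t * R t + P t * r t)"
        by (simp only:)
      also have "P y * R y - P x * R x - integral {x..y} (\<lambda>t. p t * R t + P t * r t) = D y - D x"
        unfolding integral_diff_eq[OF i xy(1-3), symmetric] D_def by simp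
      finally have "D y - D x = integral {x..y} (\<lambda>t. p t * R y + P x * r t) - integral {x..y} (\<lambda>t. p t * R t + P t * r t)" .
      also have "\<dots> = integral {x..y} (\<lambda>t. (p t * R y + P x * r t) - (p t * R t + P t * r t))"
        using ii by (intro integral_diff [symmetric] integrable_add integrable_on_mult_left integrable_on_mult_right)
      also have "norm \<dots> \<le> integral {x..y} (\<lambda>t. e * (norm (p t) + norm (r t)))"
      proof (rule integral_norm_bound_integral)
        show "(\<lambda>t. (p t * R y + P x * r t) - (p t * R t + P t * r t)) integrable_on {x..y}"
          using ii by (intro integrable_diff integrable_add integrable_on_mult_left integrable_on_mult_right)
        show "(\<lambda>t. e * (norm (p t) + norm (r t))) integrable_on {x..y}"
          by (intro integrable_on_mult_right ii)
        fix t assume t: "t \<in> {x..y}"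
        have "dist y t < d2" "dist x t < d1" "t \<in> {0..1}" "x \<in> {0..1}" "y \<in> {0..1}"
          using t xy by (auto simp: dist_real_def)
        then have "dist (R y) (R t) < e" "dist (P x) (P t) < e"
          using d(3,4) by blast+
        then have le: "norm (R y - R t) \<le> e" "norm (P x - P t) \<le> e"
          by (simp_all only: dist_norm less_imp_le)
        have "(p t * R y + P x * r t) - (p t * R t + P t * r t) = p t * (R y - R t) + (P x - P t) * r t"
          by (simp add: algebra_simps)
        also have "norm \<dots> \<le> norm (p t) * norm (R y - R t) + norm (P x - P t) * norm (r t)"
          unfolding norm_mult[symmetric] by (rule norm_triangle_ineq)
        also have "\<dots> \<le> norm (p t) * e + e * norm (r t)"
          by (intro add_mono mult_left_mono mult_right_mono le) auto
        finally show "norm ((p t * R y + P x * r t) - (p t * R t + P t * r t)) \<le> e * (norm (p t) + norm (r t))"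
          by (simp add: algebra_simps)
      qed
      also have "\<dots> = e * (V y - V x)"
        unfolding V_def using integral_diff_eq[OF v xy(1-3)] by simp
      finally show ?thesis .
    qed
    then show "\<exists>d>0. \<forall>x y. 0 \<le> x \<longrightarrow> x \<le> y \<longrightarrow> y \<le> 1 \<longrightarrow> y - x < d \<longrightarrow> norm (D y - D x) \<le> e * (V y - V x)"
      using d(1,2) by (intro exI[of _ "min d1 d2"]) (simp only: min_less_iff_conj, blast)
  qed (use x in simp_all)
  then have "P x * R x - integral {0..x} (\<lambda>t. p t * R t + P t * r t) = P 0 * R 0"
    unfolding D_def by simp
  then show ?thesis by (simp only: diff_eq_eq)
qed

text \<open>Since f integrates to 0 over every subinterval, the deviations that Henstock's lemma
  controls are exactly the terms of the Riemann sums of |f|. Hence |f| has integral 0.\<close>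

lemma AE_eq_0_if_integrals_0:
  fixes f :: "real \<Rightarrow> complex"
  assumes f: "f absolutely_integrable_on {0..1}"
    and 0: "\<And>x. x \<in> {0..1} \<Longrightarrow> integral {0..x} f = 0"
  shows "AE x in unit_lebesgue. f x = 0"
proof -
  have z: "integral {x..y} f = 0" if "0 \<le> x" "x \<le> y" "y \<le> 1" for x y
    using integral_diff_eq[OF f that] 0[of x] 0[of y] that by simp
  have fi: "f integrable_on cbox 0 1" using f by (simp add: absolutely_integrable_on_def)
  have "((\<lambda>x. norm (f x)) has_integral 0) (cbox 0 1)"
    unfolding has_integral
  proof (intro allI impI)
    fix e :: real assume e: "e > 0"
    obtain \<gamma> where \<gamma>: "gauge \<gamma>" "\<And>p. p tagged_partial_division_of cbox 0 1 \<Longrightarrow> \<gamma> fine p \<Longrightarrow>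
        (\<Sum>(x,k)\<in>p. norm (measure lborel k *\<^sub>R f x - integral k f)) < e"
      by (rule Henstock_lemma[OF fi e]) (rule that; assumption)
    have "norm ((\<Sum>(x,k)\<in>p. measure lborel k *\<^sub>R norm (f x)) - 0) < e"
      if p: "p tagged_division_of cbox 0 1" "\<gamma> fine p" for p
    proof -
      have "(\<Sum>(x,k)\<in>p. measure lborel k *\<^sub>R norm (f x)) = (\<Sum>(x,k)\<in>p. norm (measure lborel k *\<^sub>R f x - integral k f))"
      proof (rule sum.cong[OF refl], clarify)
        fix x k assume xk: "(x, k) \<in> p"
        obtain a b where k: "k = cbox a b" using tagged_division_ofD(4)[OF p(1) xk] by blast
        have "k \<subseteq> cbox 0 1" "x \<in> k" using tagged_division_ofD(2,3)[OF p(1) xk] by auto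
        then have "{a..b} \<subseteq> {0..1}" "{a..b} \<noteq> {}" unfolding k cbox_interval by blast+
        then have "0 \<le> a" "a \<le> b" "b \<le> 1" by simp_all
        then have "integral k f = 0" unfolding k cbox_interval by (rule z)
        then show "measure lborel k *\<^sub>R norm (f x) = norm (measure lborel k *\<^sub>R f x - integral k f)"
          by simp
      qed
      also have "\<dots> < e"
      proof (rule \<gamma>(2)[OF _ p(2)])
        show "p tagged_partial_division_of cbox 0 1"
          using p(1) unfolding tagged_division_of_def by (rule conjunct1)
      qed
      finally have "(\<Sum>(x,k)\<in>p. measure lborel k *\<^sub>R norm (f x)) < e" .
      moreover have "(\<Sum>(x,k)\<in>p. measure lborel k *\<^sub>R norm (f x)) \<ge> 0"
        by (rule sum_nonneg) auto
      ultimately show ?thesis by simp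
    qed
    then show "\<exists>\<gamma>. gauge \<gamma> \<and> (\<forall>\<D>. \<D> tagged_division_of cbox 0 1 \<and> \<gamma> fine \<D> \<longrightarrow>
        norm ((\<Sum>(x,k)\<in>\<D>. measure lborel k *\<^sub>R norm (f x)) - 0) < e)"
      using \<gamma>(1) by blast
  qed
  then have "integral {0..1} (\<lambda>x. norm (f x)) = 0" unfolding cbox_interval by (rule integral_unique)
  moreover have ni: "(\<lambda>x. norm (f x)) absolutely_integrable_on {0..1}"
    using absolutely_integrable_norm[OF f] by (simp only: o_def)
  ultimately have I: "integral\<^sup>L unit_lebesgue (\<lambda>x. norm (f x)) = 0"
    using integral_unit_lebesgue_eq[OF ni] by simp
  have int: "integrable unit_lebesgue (\<lambda>x. norm (f x))"
    using ni by (simp only: integrable_unit_lebesgue_iff)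
  have "AE x in unit_lebesgue. norm (f x) = 0"
    using integral_nonneg_eq_0_iff_AE[OF int] I by simp
  then show ?thesis by simp
qed

subsection \<open>Entire functions of exponential type\<close>

lemma powr_dominates_linear:
  fixes a c p M :: real
  assumes "c > 0" "p > 1" "M > 0" "A > 0"
  shows "\<exists>R0. \<forall>R\<ge>R0. A * exp (a * R) * exp (- (c * R powr p)) \<le> M"
proof -
  \<comment> \<open>Beyond \<open>X powr (1 / (p - 1))\<close> the quantity c R^(p-1) exceeds a +
    |ln (M / A)|, which beats the exponential and the constant A together. The lower bound 1 keeps
    the base of the power positive.\<close>
  define X where "X = max 1 ((a + \<bar>ln (M / A)\<bar>) / c)"
  have "eventually (\<lambda>R. R \<ge> X powr (1 / (p - 1))) at_top"
    by (rule eventually_ge_at_top)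
  then have "eventually (\<lambda>R. R powr (p - 1) \<ge> (a + \<bar>ln (M / A)\<bar>) / c) at_top"
  proof eventually_elim
    case (elim R)
    have "(X powr (1 / (p - 1))) powr (p - 1) \<le> R powr (p - 1)"
      using elim assms by (intro powr_mono2) auto
    then show ?case using assms by (simp add: powr_powr X_def)
  qed
  moreover have "eventually (\<lambda>R::real. R \<ge> 1) at_top"
    by (rule eventually_ge_at_top)
  ultimately have "eventually (\<lambda>R. A * exp (a * R) * exp (- (c * R powr p)) \<le> M) at_top"
  proof eventually_elim
    case (elim R)
    have "a + \<bar>ln (M / A)\<bar> \<le> c * R powr (p - 1)"
      using elim assms by (simp add: field_simps)
    then have "(a + \<bar>ln (M / A)\<bar>) * R \<le> c * R powr (p - 1) * R"
      using elim by (intro mult_right_mono) auto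
    also have "\<dots> = c * R powr p"
      using elim by (simp add: powr_diff)
    finally have "a * R - c * R powr p \<le> - (\<bar>ln (M / A)\<bar> * R)"
      by (simp add: algebra_simps)
    also have "\<dots> \<le> - \<bar>ln (M / A)\<bar>"
      using elim mult_left_mono[of 1 R "\<bar>ln (M / A)\<bar>"] by simp
    also have "\<dots> \<le> ln (M / A)" by simp
    finally have "exp (a * R - c * R powr p) \<le> exp (ln (M / A))" by simp
    also have "\<dots> = M / A" using assms by simp
    finally have "A * exp (a * R - c * R powr p) \<le> M"
      using assms by (simp add: field_simps)
    then show ?case by (simp add: exp_diff exp_minus field_simps)
  qed
  then show ?thesis by (simp add: eventually_at_top_linorder)
qed

text \<open>The opening is less than pi, so some power p > 1 still maps the rotated wedge into a
  sector strictly inside the right half-plane. Damping f by exp (-\<eta> (e z)^p) then beats the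
  exponential type on large arcs and does not increase f on the two rays. The maximum principle on
  the truncated wedge gives the bound, and \<eta> tends to 0.\<close>

lemma phragmen_lindelof_wedge_unit:
  fixes f :: "complex \<Rightarrow> complex" and u v :: complex
  assumes hol: "f holomorphic_on UNIV"
    and A: "A > 0" and M: "M > 0"
    and growth: "\<And>z. norm (f z) \<le> A * exp (A * norm z)"
    and nu: "norm u = 1" and nv: "norm v = 1" and uv: "Im (cnj u * v) \<noteq> 0"
    and fu: "\<And>t::real. t \<ge> 0 \<Longrightarrow> norm (f (t * u)) \<le> M"
    and fv: "\<And>t::real. t \<ge> 0 \<Longrightarrow> norm (f (t * v)) \<le> M"
    and st: "s0 \<ge> (0::real)" "t0 \<ge> (0::real)"
  shows "norm (f (s0 * u + t0 * v)) \<le> M"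
proof -
  \<comment> \<open>Cramer's rule: \<sigma> and \<tau> are the real coordinates of z in the basis u,
    v, and the wedge is where both are nonnegative.\<close>
  define \<sigma> where "\<sigma> z = Im (cnj v * z) / Im (cnj v * u)" for z
  define \<tau> where "\<tau> z = Im (cnj u * z) / Im (cnj u * v)" for z
  have uv': "Im (cnj v * u) = - Im (cnj u * v)" by (simp add: algebra_simps)
  have "Re (\<sigma> z * u + \<tau> z * v) * Im (cnj u * v) = Re z * Im (cnj u * v)"
    and "Im (\<sigma> z * u + \<tau> z * v) * Im (cnj u * v) = Im z * Im (cnj u * v)" for z
  proof -
    have 1: "\<sigma> z * Im (cnj u * v) = - Im (cnj v * z)" "\<tau> z * Im (cnj u * v) = Im (cnj u * z)"
      using uv by (simp_all add: \<sigma>_def \<tau>_def uv' del: times_complex.sel)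
    have "Re (\<sigma> z * u + \<tau> z * v) * Im (cnj u * v)
        = (\<sigma> z * Im (cnj u * v)) * Re u + (\<tau> z * Im (cnj u * v)) * Re v"
      by (simp add: algebra_simps)
    then show "Re (\<sigma> z * u + \<tau> z * v) * Im (cnj u * v) = Re z * Im (cnj u * v)"
      unfolding 1 by (simp add: algebra_simps)
    have "Im (\<sigma> z * u + \<tau> z * v) * Im (cnj u * v)
        = (\<sigma> z * Im (cnj u * v)) * Im u + (\<tau> z * Im (cnj u * v)) * Im v"
      by (simp add: algebra_simps)
    then show "Im (\<sigma> z * u + \<tau> z * v) * Im (cnj u * v) = Im z * Im (cnj u * v)"
      unfolding 1 by (simp add: algebra_simps)
  qed
  then have coords: "z = \<sigma> z * u + \<tau> z * v" for z
    using uv by (metis complex_eqI mult_right_cancel)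
  have \<sigma>\<tau>: "\<sigma> (complex_of_real s * u + complex_of_real t * v) = s"
      "\<tau> (complex_of_real s * u + complex_of_real t * v) = t" for s t :: real
    using uv by (auto simp: \<sigma>_def \<tau>_def field_simps)
  \<comment> \<open>As u and v have modulus 1, u + v spans the bisector of the wedge, and
    multiplication by its conjugate turns the bisector onto the positive real axis.\<close>
  define e where "e = cnj (u + v)"
  define \<kappa> where "\<kappa> = 1 + Re (cnj u * v)"
  have "(Re (cnj u * v))\<^sup>2 + (Im (cnj u * v))\<^sup>2 = 1"
    by (metis cmod_power2 complex_mod_cnj norm_mult nu nv mult_1 power_one)
  moreover have "(Im (cnj u * v))\<^sup>2 > 0" using uv by simp
  ultimately have "(Re (cnj u * v))\<^sup>2 < 1" by linarith
  then have \<kappa>: "\<kappa> > 0" unfolding \<kappa>_def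
    by (metis abs_square_less_1 abs_less_iff add.commute less_diff_eq diff_0 minus_less_iff minus_diff_eq diff_minus_eq_add)
  have uu: "u * cnj u = 1" "v * cnj v = 1"
    using nu nv by (simp_all add: complex_norm_square [symmetric])
  have Ree: "Re (e * z) = (\<sigma> z + \<tau> z) * \<kappa>" for z
  proof -
    have "e * z = e * (\<sigma> z * u + \<tau> z * v)" using coords[of z] by simp
    also have "\<dots> = \<sigma> z * (u * cnj u) + \<sigma> z * (cnj v * u) + \<tau> z * (cnj u * v) + \<tau> z * (v * cnj v)"
      by (simp add: e_def algebra_simps)
    also have "Re \<dots> = (\<sigma> z + \<tau> z) * \<kappa>"
      unfolding uu by (simp add: \<kappa>_def algebra_simps)
    finally show ?thesis .
  qed
  have nz: "norm z \<le> \<sigma> z + \<tau> z" if "\<sigma> z \<ge> 0" "\<tau> z \<ge> 0" for z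
  proof -
    have "norm z = norm (\<sigma> z * u + \<tau> z * v)" using coords[of z] by simp
    also have "\<dots> \<le> norm (\<sigma> z * u) + norm (\<tau> z * v)" by (rule norm_triangle_ineq)
    finally show ?thesis using that nu nv by (simp add: norm_mult)
  qed
  have e0: "e \<noteq> 0"
  proof
    assume "e = 0" then have "u + v = 0" by (metis complex_cnj_cnj complex_cnj_zero e_def)
    then have "u = - v" by (simp add: eq_neg_iff_add_eq_0)
    then show False using uv by (simp add: algebra_simps)
  qed
  \<comment> \<open>The cosine of half the opening: on the edge z = u the quotient Re (e z) / |e z|
    has exactly this value.\<close>
  define k where "k = \<kappa> / norm e"
  have k0: "k > 0" using \<kappa> e0 by (simp add: k_def)
  have cosk: "Re (e * z) \<ge> k * norm (e * z)" if "\<sigma> z \<ge> 0" "\<tau> z \<ge> 0" for z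
  proof -
    have "k * norm (e * z) = \<kappa> * norm z" using e0 by (simp add: k_def norm_mult)
    also have "\<dots> \<le> \<kappa> * (\<sigma> z + \<tau> z)" using nz[OF that] \<kappa> by (intro mult_left_mono) auto
    finally show ?thesis unfolding Ree by (simp add: mult.commute)
  qed
  have k1: "k \<le> 1"
  proof -
    have "k * norm (e * u) \<le> Re (e * u)"
      using cosk[of u] \<sigma>\<tau>[of 1 0] by simp
    also have "\<dots> \<le> 1 * norm (e * u)" unfolding mult_1 by (rule complex_Re_le_cmod)
    finally show ?thesis using e0 nu by (simp add: norm_mult)
  qed
  define \<theta> where "\<theta> = arccos k"
  have \<theta>: "0 \<le> \<theta>" "\<theta> < pi / 2"
    using k0 k1 arccos_less_arccos[of 0 k] arccos_lbound[of k] by (auto simp: \<theta>_def)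
  \<comment> \<open>The midpoint of 1 and (pi / 2) / \<theta>, which gives p > 1 and p \<theta> < pi
    / 2. For \<theta> = 0 any p > 1 serves.\<close>
  define p where "p = (if \<theta> = 0 then 2 else (1 + (pi / 2) / \<theta>) / 2)"
  have p: "p > 1" "p * \<theta> < pi / 2"
    using \<theta> by (auto simp: p_def field_simps)
  define c where "c = cos (p * \<theta>)"
  have "p * \<theta> \<ge> 0" using p \<theta> by simp
  then have c: "c > 0" unfolding c_def using p by (intro cos_gt_zero_pi) auto
  have Repow: "Re ((e * z) powr p) \<ge> c * norm (e * z) powr p" and Rep: "z \<noteq> 0 \<Longrightarrow> Re (e * z) > 0"
    if "\<sigma> z \<ge> 0" "\<tau> z \<ge> 0" for z
  proof -
    note pos = that
    have *: "Re ((e * z) powr p) \<ge> c * norm (e * z) powr p \<and> Re (e * z) > 0" if z0: "z \<noteq> 0"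
    proof -
      have ez: "e * z \<noteq> 0" using e0 z0 by simp
      have n: "norm (e * z) > 0" using ez by simp
      have "cos (Arg (e * z)) = Re (e * z) / norm (e * z)"
        using ez by (rule cos_Arg)
      also have "\<dots> \<ge> k" using cosk[OF pos] n by (simp add: field_simps)
      finally have "cos \<theta> \<le> cos \<bar>Arg (e * z)\<bar>" using k0 k1 by (simp add: \<theta>_def)
      then have Arg: "\<bar>Arg (e * z)\<bar> \<le> \<theta>"
        using \<theta> Arg_bounded[of "e * z"] by (subst (asm) cos_mono_le_eq) auto
      have "(e * z) powr p = exp (p * Ln (e * z))" using ez by (simp add: powr_def)
      then have "Re ((e * z) powr p) = exp (p * ln (norm (e * z))) * cos (p * Arg (e * z))"
        using ez by (simp add: Re_exp Arg_eq_Im_Ln)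
      also have "exp (p * ln (norm (e * z))) = norm (e * z) powr p"
        using n by (simp add: powr_def)
      finally have eq: "Re ((e * z) powr p) = norm (e * z) powr p * cos \<bar>p * Arg (e * z)\<bar>"
        by simp
      have le: "\<bar>p * Arg (e * z)\<bar> \<le> p * \<theta>" using Arg p by (simp add: abs_mult)
      have "c \<le> cos \<bar>p * Arg (e * z)\<bar>" unfolding c_def
        by (rule cos_monotone_0_pi_le) (use le p in auto)
      then have "Re ((e * z) powr p) \<ge> c * norm (e * z) powr p"
        unfolding eq by (metis mult.commute mult_left_mono powr_ge_zero)
      moreover have "Re (e * z) > 0" using cosk[OF pos] n k0
        by (meson less_le_trans mult_pos_pos)
      ultimately show ?thesis by blast
    qed
    show "Re ((e * z) powr p) \<ge> c * norm (e * z) powr p"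
      using * by (cases "z = 0") auto
    show "z \<noteq> 0 \<Longrightarrow> Re (e * z) > 0" using * by auto
  qed
  define z0 where "z0 = s0 * u + t0 * v"
  have z0: "\<sigma> z0 = s0" "\<tau> z0 = t0" by (simp_all add: z0_def \<sigma>\<tau>)
  have main: "norm (f z0 * exp (- (\<eta> * (e * z0) powr p))) \<le> M" if \<eta>: "\<eta> > 0" and pos: "s0 > 0" "t0 > 0" for \<eta> :: real
  proof -
    define g where "g z = f z * exp (- (\<eta> * (e * z) powr p))" for z
    define c' where "c' = \<eta> * c * norm e powr p"
    have c': "c' > 0" using \<eta> c e0 by (simp add: c'_def)
    have gle: "norm (g z) \<le> norm (f z) * exp (- (c' * norm z powr p))" if "\<sigma> z \<ge> 0" "\<tau> z \<ge> 0" for z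
    proof -
      have "norm (exp (- (\<eta> * (e * z) powr p))) = exp (- (\<eta> * Re ((e * z) powr p)))" by simp
      also have "\<dots> \<le> exp (- (\<eta> * (c * norm (e * z) powr p)))"
        using Repow[OF that] \<eta> by simp
      also have "\<dots> = exp (- (c' * norm z powr p))"
        by (simp add: c'_def norm_mult powr_mult mult_ac)
      finally show ?thesis by (simp add: g_def norm_mult mult_left_mono)
    qed
    have gle': "norm (g z) \<le> norm (f z)" if "\<sigma> z \<ge> 0" "\<tau> z \<ge> 0" for z
    proof -
      have "norm (f z) * exp (- (c' * norm z powr p)) \<le> norm (f z) * 1"
        using c' by (intro mult_left_mono) auto
      then show ?thesis using gle[OF that] by linarith
    qed
    obtain R0 where R0: "\<And>R. R \<ge> R0 \<Longrightarrow> A * exp (A * R) * exp (- (c' * R powr p)) \<le> M"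
      using powr_dominates_linear[OF c' p(1) M A] by blast
    \<comment> \<open>Large enough for the damping to win on the arc and for z0 to lie inside
      it.\<close>
    define R where "R = max R0 (norm z0 + 1)"
    define S where "S = {z. 0 < \<sigma> z} \<inter> {z. 0 < \<tau> z} \<inter> ball 0 R"
    define C where "C = {z. 0 \<le> \<sigma> z} \<inter> {z. 0 \<le> \<tau> z} \<inter> cball 0 R"
    have c1: "continuous_on UNIV \<sigma>" "continuous_on UNIV \<tau>"
      unfolding \<sigma>_def \<tau>_def using uv unfolding uv'
      by (intro continuous_on_divide continuous_on_Im continuous_on_mult continuous_on_const
          continuous_on_id; simp only: neg_equal_0_iff_equal not_False_eq_True ball_UNIV; simp)+
    have opS: "open S" unfolding S_def
      by (intro open_Int open_Collect_less c1 continuous_on_const open_ball)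
    have clC: "closed C" unfolding C_def
      by (intro closed_Int closed_Collect_le c1 continuous_on_const closed_cball)
    have SC: "S \<subseteq> C" by (auto simp: S_def C_def)
    then have clS: "closure S \<subseteq> C" using clC by (simp add: closure_minimal)
    have fr: "frontier S \<subseteq> C - S"
      using clS opS by (auto simp: frontier_def interior_open)
    have holg: "g holomorphic_on S"
    proof -
      have "f holomorphic_on S" using hol holomorphic_on_subset by blast
      moreover have "e * z \<notin> \<real>\<^sub>\<le>\<^sub>0" if "z \<in> S" for z
      proof -
        have "\<sigma> z > 0" "\<tau> z > 0" using that by (auto simp: S_def)
        then have "Re (e * z) > 0" unfolding Ree using \<kappa> by (intro mult_pos_pos) auto
        then show ?thesis by (auto simp: complex_nonpos_Reals_iff)
      qed
      ultimately show ?thesis unfolding g_def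
        by (intro holomorphic_intros) auto
    qed
    \<comment> \<open>The vertex 0 and the edges lie on the frontier, where the maximum principle
      asks only for continuity. The power is continuous wherever Re (e z) is nonnegative, the vertex
      included.\<close>
    have contg: "continuous_on C g"
    proof -
      have "Re (e * z) \<ge> 0" if "z \<in> C" for z
        unfolding Ree using that \<kappa> by (auto simp: C_def)
      then have "continuous_on C (\<lambda>z. (e * z) powr p)"
        using p by (intro continuous_on_powr_complex continuous_on_mult continuous_on_const continuous_on_id) auto
      moreover have "continuous_on C f"
        using hol holomorphic_on_imp_continuous_on continuous_on_subset by blast
      ultimately show ?thesis unfolding g_def
        by (intro continuous_on_mult continuous_on_exp continuous_on_minus continuous_on_const)
    qed
    have "norm (g z0) \<le> M"
    proof (rule maximum_modulus_frontier[of g S M z0])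
      show "g holomorphic_on interior S" using holg opS by (simp add: interior_open)
      show "continuous_on (closure S) g" using contg clS continuous_on_subset by blast
      show "bounded S" unfolding S_def by (simp add: bounded_Int)
      show "z0 \<in> S" using pos by (simp add: S_def z0 R_def)
      show "norm (g z) \<le> M" if "z \<in> frontier S" for z
      proof -
        have zC: "z \<in> C" "z \<notin> S" using fr that by auto
        then have pos: "\<sigma> z \<ge> 0" "\<tau> z \<ge> 0" "norm z \<le> R" by (auto simp: C_def)
        consider "\<sigma> z = 0" | "\<tau> z = 0" | "norm z = R"
          using zC by (force simp: C_def S_def)
        then show ?thesis
        proof cases
          case 1
          then have "z = \<tau> z * v" using coords[of z] by simp
          then have "norm (f z) \<le> M" using fv[OF pos(2)] by metis
          then show ?thesis using gle'[OF pos(1,2)] by linarith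
        next
          case 2
          then have "z = \<sigma> z * u" using coords[of z] by simp
          then have "norm (f z) \<le> M" using fu[OF pos(1)] by metis
          then show ?thesis using gle'[OF pos(1,2)] by linarith
        next
          case 3
          have "norm (g z) \<le> norm (f z) * exp (- (c' * norm z powr p))" by (rule gle[OF pos(1,2)])
          also have "\<dots> \<le> A * exp (A * norm z) * exp (- (c' * norm z powr p))"
            by (intro mult_right_mono growth) auto
          also have "\<dots> \<le> M" using R0[of R] 3 by (simp add: R_def)
          finally show ?thesis .
        qed
      qed
    qed
    then show ?thesis by (simp add: g_def)
  qed
  show ?thesis
  proof (cases "s0 = 0 \<or> t0 = 0")
    case True then show ?thesis using fu[OF st(1)] fv[OF st(2)] by auto
  next
    case False
    then have pos: "s0 > 0" "t0 > 0" using st by auto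
    have "((\<lambda>\<eta>::real. norm (f z0 * exp (- (\<eta> * (e * z0) powr p)))) \<longlongrightarrow> norm (f z0 * exp (- (of_real 0 * (e * z0) powr p)))) (at_right 0)"
      by (intro tendsto_intros)
    then have "((\<lambda>\<eta>::real. norm (f z0 * exp (- (\<eta> * (e * z0) powr p)))) \<longlongrightarrow> norm (f z0)) (at_right 0)"
      by simp
    moreover have "eventually (\<lambda>\<eta>::real. norm (f z0 * exp (- (\<eta> * (e * z0) powr p))) \<le> M) (at_right 0)"
      using main[OF _ pos] by (auto simp: eventually_at_right_less eventually_at_filter)
    ultimately have "norm (f z0) \<le> M"
      using tendsto_upperbound by fastforce
    then show ?thesis by (simp add: z0_def)
  qed
qed

lemma phragmen_lindelof_wedge:
  fixes f :: "complex \<Rightarrow> complex" and u v :: complex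
  assumes hol: "f holomorphic_on UNIV"
    and growth: "\<And>z. norm (f z) \<le> A * exp (A * norm z)"
    and uv: "Im (cnj u * v) \<noteq> 0"
    and fu: "\<And>t::real. t \<ge> 0 \<Longrightarrow> norm (f (t * u)) \<le> M"
    and fv: "\<And>t::real. t \<ge> 0 \<Longrightarrow> norm (f (t * v)) \<le> M"
    and st: "s \<ge> (0::real)" "t \<ge> (0::real)"
  shows "norm (f (s * u + t * v)) \<le> M"
proof (rule field_le_epsilon)
  fix \<epsilon> :: real assume \<epsilon>: "\<epsilon> > 0"
  have "norm (f 0) \<le> M" using fu[of 0] by simp
  then have "M \<ge> 0" using norm_ge_zero order_trans by blast
  \<comment> \<open>The version for unit vectors asks for a strictly positive bound, so it is
    applied with M + \<epsilon> instead of M.\<close>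
  then have M: "M + \<epsilon> > 0" using \<epsilon> by simp
  have u0: "u \<noteq> 0" "v \<noteq> 0" using uv by auto
  have growth': "norm (f z) \<le> max A 1 * exp (max A 1 * norm z)" for z
  proof -
    have "A * exp (A * norm z) \<le> max A 1 * exp (max A 1 * norm z)"
      by (intro mult_mono) (auto intro: mult_right_mono)
    then show ?thesis using growth[of z] by linarith
  qed
  have eq: "(s * norm u) * (u / norm u) + (t * norm v) * (v / norm v) = s * u + t * v"
    using u0 by simp
  have "cnj (u / norm u) * (v / norm v) = inverse (norm u * norm v) *\<^sub>R (cnj u * v)"
    by (simp add: scaleR_conv_of_real field_simps)
  then have "Im (cnj (u / norm u) * (v / norm v)) = inverse (norm u * norm v) * Im (cnj u * v)"
    by (simp only: scaleR_complex.sel)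
  then have "Im (cnj (u / norm u) * (v / norm v)) \<noteq> 0"
    using uv u0 by (simp del: times_complex.sel)
  moreover have "norm (f (r * (u / norm u))) \<le> M + \<epsilon>" "norm (f (r * (v / norm v))) \<le> M + \<epsilon>"
    if "r \<ge> 0" for r :: real
    using fu[of "r / norm u"] fv[of "r / norm v"] that \<epsilon> by (auto simp: field_simps intro: add_increasing2)
  ultimately have "norm (f ((s * norm u) * (u / norm u) + (t * norm v) * (v / norm v))) \<le> M + \<epsilon>"
    using phragmen_lindelof_wedge_unit[OF hol _ M growth', of "u / norm u" "v / norm v" "s * norm u" "t * norm v"]
      st u0 by (simp add: norm_divide)
  then show "norm (f (s * u + t * v)) \<le> M + \<epsilon>" unfolding eq .
qed

section \<open>Lower bounds off the zeros and growth of quotients\<close>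

text \<open>Harnack's inequality for the positive harmonic function ln (M / |g|), derived from the
  Schwarz lemma by a Cayley transform. On the half disc the Harnack constant is (1 + 1/2) / (1 -
  1/2) = 3, which is the cube in the statement.\<close>

lemma norm_zero_free_ge:
  fixes g :: "complex \<Rightarrow> complex"
  assumes hol: "g holomorphic_on ball 0 R" and R: "R > 0"
    and nz: "\<And>z. z \<in> ball 0 R \<Longrightarrow> g z \<noteq> 0"
    and bd: "\<And>z. z \<in> ball 0 R \<Longrightarrow> norm (g z) < M"
    and z: "norm z \<le> R / 2"
  shows "norm (g 0) ^ 3 \<le> M ^ 2 * norm (g z)"
proof -
  have M: "M > 0" using bd[of 0] R by (smt (verit) centre_in_ball norm_ge_zero)
  obtain l where l: "l holomorphic_on ball 0 R" "\<And>z. z \<in> ball 0 R \<Longrightarrow> g z = exp (l z)"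
    using contractible_imp_holomorphic_log[OF hol _ nz] convex_imp_contractible[OF convex_ball] by blast
  define p where "p z = of_real (ln M) - l z" for z
  have rep: "Re (p z) > 0" and normg: "norm (g z) = M * exp (- Re (p z))" if "z \<in> ball 0 R" for z
  proof -
    have "exp (Re (l z)) < exp (ln M)" using bd[OF that] l(2)[OF that] M by simp
    then show "Re (p z) > 0" by (simp add: p_def)
    show "norm (g z) = M * exp (- Re (p z))"
      using l(2)[OF that] M by (simp add: p_def exp_diff)
  qed
  define p0 where "p0 = Re (p 0)"
  have p0: "p0 > 0" unfolding p0_def using rep R by simp
  \<comment> \<open>Removing the imaginary part at 0 makes the value at 0 the real number
    \<open>p0\<close>, so that the Cayley transform w fixes 0.\<close>
  define h where "h z = p z - \<i> * Im (p 0)" for z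
  have h0: "h 0 = p0" by (simp add: h_def p0_def complex_eq_iff)
  have Reh: "Re (h z) = Re (p z)" for z by (simp add: h_def)
  define w where "w z = (h (R * z) - p0) / (h (R * z) + p0)" for z :: complex
  have inb: "of_real R * z \<in> ball 0 R" if "norm z < 1" for z :: complex
    using that R by (simp add: norm_mult)
  have "norm (w (z / R)) \<le> norm (z / R)"
  proof (rule Schwarz_Lemma(1)[of w "z / R"])
    have "h holomorphic_on ball 0 R" unfolding h_def p_def by (intro holomorphic_intros l)
    then have "(h \<circ> (\<lambda>z. R * z)) holomorphic_on ball 0 1"
    proof (rule holomorphic_on_compose_gen[rotated])
      show "(*) (complex_of_real R) ` ball 0 1 \<subseteq> ball 0 R" using inb by auto
    qed (intro holomorphic_intros)
    then have 1: "(\<lambda>z. h (R * z)) holomorphic_on ball 0 1" by (simp add: o_def)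
    have "h (of_real R * z) + p0 \<noteq> 0" if "z \<in> ball 0 1" for z
    proof -
      have "Re (h (of_real R * z) + p0) > 0" using rep[OF inb, of z] that p0 by (simp add: Reh)
      then show ?thesis by (metis less_irrefl zero_complex.sel(1))
    qed
    then show "w holomorphic_on ball 0 1" unfolding w_def
      by (intro holomorphic_intros 1) auto
    show "w 0 = 0" by (simp add: w_def h0)
    show "norm (w z) < 1" if "norm z < 1" for z
    proof -
      have re: "Re (h (of_real R * z)) > 0" using rep[OF inb[OF that]] by (simp add: Reh)
      let ?h = "h (of_real R * z)"
      have "(norm (?h - p0))\<^sup>2 < (norm (?h + p0))\<^sup>2"
        using mult_pos_pos[OF re p0] unfolding cmod_power2 by (simp add: power2_eq_square algebra_simps)
      then have "norm (?h - p0) < norm (?h + p0)"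
        using power_less_imp_less_base norm_ge_zero by blast
      then show ?thesis by (simp add: w_def norm_divide divide_less_eq_1)
    qed
    show "norm (z / of_real R) < 1" using z R by (simp add: norm_divide field_simps)
  qed
  also have "\<dots> \<le> 1 / 2" using z R by (simp add: norm_divide field_simps)
  finally have *: "norm ((h z - p0) / (h z + p0)) \<le> 1 / 2" using R by (simp add: w_def)
  have zb: "z \<in> ball 0 R" using z R by simp
  have "Re (h z + p0) > 0" using rep[OF zb] p0 by (simp add: Reh)
  then have "h z + p0 \<noteq> 0" by (metis less_irrefl zero_complex.sel(1))
  then have "norm (h z + p0) > 0" by simp
  then have "2 * norm (h z - p0) \<le> norm (h z + p0)" using * by (simp add: norm_divide pos_divide_le_eq)
  \<comment> \<open>Squaring and discarding the imaginary part leaves 2 (Re (p z) - p0) \<le> Re (p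
    z) + p0, that is Re (p z) \<le> 3 p0.\<close>
  then have "(2 * norm (h z - p0))\<^sup>2 \<le> (norm (h z + p0))\<^sup>2" by (intro power_mono) auto
  then have "4 * (norm (h z - p0))\<^sup>2 \<le> (norm (h z + p0))\<^sup>2" by (simp only: power_mult_distrib) simp
  moreover have drop_sq: "4 * (a + c) \<le> b + c \<Longrightarrow> c \<ge> 0 \<Longrightarrow> 4 * a \<le> b" for a b c :: real
    by simp
  ultimately have "4 * ((Re (p z) - p0)\<^sup>2 + (Im (h z))\<^sup>2) \<le> (Re (p z) + p0)\<^sup>2 + (Im (h z))\<^sup>2"
    unfolding cmod_power2 by (simp add: Reh)
  then have "4 * (Re (p z) - p0)\<^sup>2 \<le> (Re (p z) + p0)\<^sup>2"
    by (rule drop_sq) simp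
  then have "(2 * (Re (p z) - p0))\<^sup>2 \<le> (Re (p z) + p0)\<^sup>2"
    by (simp only: power_mult_distrib) simp
  then have "2 * (Re (p z) - p0) \<le> Re (p z) + p0"
    by (rule power2_le_imp_le) (use rep[OF zb] p0 in linarith)
  then have le: "- (3 * p0) \<le> - Re (p z)" by simp
  have "norm (g 0) ^ 3 = M ^ 3 * exp (- p0) ^ 3"
    using R by (simp only: normg centre_in_ball p0_def power_mult_distrib)
  also have "exp (- p0) ^ 3 = exp (- (3 * p0))" 
    using exp_of_nat_mult[of 3 "- p0"] by simp
  also have "M ^ 3 * exp (- (3 * p0)) \<le> M ^ 3 * exp (- Re (p z))"
    using le M by (intro mult_left_mono) auto
  also have "\<dots> = M ^ 2 * norm (g z)"
    unfolding normg[OF zb] by (simp only: power2_eq_square power3_eq_cube mult.assoc)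
  finally show ?thesis .
qed

text \<open>The local factor and f / (z - w)^n agree on the punctured disc, so they glue to an
  entire function. The exponent 0 covers a point w that is not a zero.\<close>

lemma entire_factor_zero:
  fixes f :: "complex \<Rightarrow> complex"
  assumes hol: "f holomorphic_on UNIV" and nz: "f a \<noteq> 0"
  obtains m g where "g holomorphic_on UNIV" "g w \<noteq> 0" "\<And>z. f z = (z - w) ^ m * g z"
proof (cases "f w = 0")
  case False
  then show ?thesis using that[of f 0] hol by simp
next
  case True
  have nc: "\<not> f constant_on UNIV" using True nz by (metis UNIV_I constant_on_def)
  obtain g r n where n: "0 < n" and r: "0 < r" and "ball w r \<subseteq> UNIV"
    and g: "g holomorphic_on ball w r"
    and fg: "\<And>z. z \<in> ball w r \<Longrightarrow> f z = (z - w) ^ n * g z"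
    and g0: "\<And>z. z \<in> ball w r \<Longrightarrow> g z \<noteq> 0"
    using holomorphic_factor_zero_nonconstant[OF hol open_UNIV connected_UNIV UNIV_I True nc] by metis
  define G where "G z = (if z \<in> ball w r then g z else f z / (z - w) ^ n)" for z
  have G: "f z = (z - w) ^ n * G z" for z
    using fg[of z] r by (cases "z = w") (auto simp: G_def)
  have "G holomorphic_on UNIV"
  proof -
    have 1: "G holomorphic_on ball w r"
      by (rule holomorphic_transform[OF g]) (simp add: G_def)
    have "(\<lambda>z. f z / (z - w) ^ n) holomorphic_on (- {w})"
      by (intro holomorphic_intros holomorphic_on_subset[OF hol]) auto
    then have 2: "G holomorphic_on (- {w})"
      by (rule holomorphic_transform) (use fg in \<open>auto simp: G_def\<close>)
    have "G holomorphic_on (ball w r \<union> - {w})"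
      by (rule holomorphic_on_Un[OF 1 2]) auto
    moreover have "ball w r \<union> - {w} = UNIV" using r by auto
    ultimately show ?thesis by simp
  qed
  moreover have "G w \<noteq> 0" using g0[of w] r by (simp add: G_def)
  ultimately show ?thesis using that G by blast
qed

lemma entire_factor_zeros:
  fixes f :: "complex \<Rightarrow> complex"
  assumes hol: "f holomorphic_on UNIV" and nz: "f a \<noteq> 0" and "finite Z"
  shows "\<exists>m g. g holomorphic_on UNIV \<and> (\<forall>w\<in>Z. g w \<noteq> 0) \<and> (\<forall>z. f z = (\<Prod>w\<in>Z. (z - w) ^ m w) * g z)"
  using \<open>finite Z\<close>
proof (induction Z)
  case empty
  show ?case by (rule exI[of _ undefined], rule exI[of _ f]) (use hol in simp)
next
  case (insert w Z)
  then obtain m g where g: "g holomorphic_on UNIV" "\<And>w. w \<in> Z \<Longrightarrow> g w \<noteq> 0"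
    "\<And>z. f z = (\<Prod>w\<in>Z. (z - w) ^ m w) * g z" by blast
  have "g a \<noteq> 0" using nz g(3)[of a] by auto
  then obtain n h where h: "h holomorphic_on UNIV" "h w \<noteq> 0" "\<And>z. g z = (z - w) ^ n * h z"
    using entire_factor_zero[OF g(1)] by metis
  have "(\<Prod>x\<in>Z. (z - x) ^ (m(w := n)) x) = (\<Prod>x\<in>Z. (z - x) ^ m x)" for z
    by (rule prod.cong) (use insert.hyps in auto)
  then have "f z = (\<Prod>x\<in>insert w Z. (z - x) ^ (m(w := n)) x) * h z" for z
    using insert.hyps by (simp add: g(3) h(3) mult_ac)
  moreover have "h x \<noteq> 0" if "x \<in> insert w Z" for x
    using h(2) g(2)[of x] h(3)[of x] that by auto
  ultimately show ?case using h(1) by blast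
qed

text \<open>
  The zeros of \<open>D\<close> in the disc are replaced by their reflections in the circle, which changes
  neither \<open>D\<close> nor \<open>D * G\<close> in modulus on the circle and leaves a zero-free function.
\<close>

lemma norm_quotient_le:
  fixes D G :: "complex \<Rightarrow> complex"
  assumes D: "D holomorphic_on UNIV" and G: "G holomorphic_on UNIV" and D0: "D 0 \<noteq> 0"
    and R: "R > 0"
    and M1: "\<And>z. norm z = R \<Longrightarrow> norm (D z) \<le> M1"
    and M2: "\<And>z. norm z = R \<Longrightarrow> norm (D z * G z) \<le> M2"
    and z: "norm z \<le> R / 2"
  shows "norm (G z) * norm (D 0) ^ 3 \<le> M2 * (M1 + 1) ^ 2"
proof -
  define Z where "Z = {z \<in> cball 0 R. D z = 0}"
  \<comment> \<open>Infinitely many zeros in the compact disc would accumulate, and D would vanish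
    identically.\<close>
  have "finite Z"
  proof (rule ccontr)
    assume inf: "infinite Z"
    then obtain x where "x islimpt Z"
      using compact_eq_Bolzano_Weierstrass[of "cball (0::complex) R"] compact_cball[of "0::complex" R]
      by (auto simp: Z_def)
    then have "D 0 = 0"
      by (rule analytic_continuation[OF D open_UNIV connected_UNIV subset_UNIV UNIV_I])
        (simp_all add: Z_def)
    then show False using D0 by simp
  qed
  then obtain m E where E: "E holomorphic_on UNIV" "\<And>w. w \<in> Z \<Longrightarrow> E w \<noteq> 0"
    and DE: "\<And>z. D z = (\<Prod>w\<in>Z. (z - w) ^ m w) * E z"
    using entire_factor_zeros[OF D D0] by metis
  \<comment> \<open>On |z| = R one has R^2 = z cnj z, so (R^2 - cnj w z) / R has there the modulus
    of z - w. Unlike z - w it has no zero in the open disc.\<close>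
  define P where "P z = (\<Prod>w\<in>Z. ((R\<^sup>2 - cnj w * z) / R) ^ m w)" for z :: complex
  define D' where "D' z = P z * E z" for z
  have P: "P holomorphic_on A" for A unfolding P_def using R by (intro holomorphic_intros) auto
  have D': "D' holomorphic_on A" for A unfolding D'_def
    by (intro holomorphic_intros P holomorphic_on_subset[OF E(1)]) auto
  have circ: "norm ((R\<^sup>2 - cnj w * z) / R) = norm (z - w)" if "norm z = R" for z w :: complex
  proof -
    have "complex_of_real (R\<^sup>2) = z * cnj z" using that complex_norm_square[of z] by simp
    then have "R\<^sup>2 - cnj w * z = z * cnj (z - w)" by (simp add: algebra_simps)
    then show ?thesis using that R by (simp add: norm_divide norm_mult flip: complex_cnj_diff)
  qed
  have "norm (P z) = norm (\<Prod>w\<in>Z. (z - w) ^ m w)" if "norm z = R" for z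
    by (simp only: P_def prod_norm[symmetric] norm_power circ[OF that])
  then have nD': "norm (D' z) = norm (D z)" if "norm z = R" for z
    using that by (simp add: D'_def DE norm_mult)
  have max: "norm (f z) \<le> M" if "f holomorphic_on UNIV" "\<And>z. norm z = R \<Longrightarrow> norm (f z) \<le> M" "z \<in> ball 0 R"
    for f :: "complex \<Rightarrow> complex" and M z
  proof (rule maximum_modulus_frontier[of f "ball 0 R" M z])
    show "f holomorphic_on interior (ball 0 R)" using that(1) holomorphic_on_subset by blast
    show "continuous_on (closure (ball 0 R)) f"
      using that(1) holomorphic_on_imp_continuous_on continuous_on_subset by blast
    show "norm (f x) \<le> M" if "x \<in> frontier (ball 0 R)" for x
      using that R \<open>\<And>z. norm z = R \<Longrightarrow> norm (f z) \<le> M\<close> by (simp add: frontier_ball)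
  qed (use that in auto)
  have b1: "norm (D' z) \<le> M1" if "z \<in> ball 0 R" for z
    using max[OF D', of M1 z] nD' M1 that by simp
  have b2: "norm (D' z * G z) \<le> M2" if "z \<in> ball 0 R" for z
  proof (rule max[OF _ _ that])
    show "(\<lambda>z. D' z * G z) holomorphic_on UNIV" by (intro holomorphic_on_mult D' G)
    show "norm (D' x * G x) \<le> M2" if "norm x = R" for x
      using M2[OF that] by (simp add: norm_mult nD'[OF that])
  qed
  have zb: "z \<in> ball 0 R" using z R by simp
  \<comment> \<open>At 0 the reflected factor has modulus R, and the original one |w| \<le> R, so
    the reflection does not decrease the value at 0.\<close>
  have D0le: "norm (D 0) \<le> norm (D' 0)"
  proof -
    have "norm (\<Prod>w\<in>Z. (0 - w) ^ m w) \<le> norm (P 0)"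
      unfolding P_def prod_norm[symmetric]
    proof (rule prod_mono, safe)
      fix w assume "w \<in> Z"
      then have "norm w \<le> R" by (auto simp: Z_def)
      then show "norm ((0 - w) ^ m w) \<le> norm (((complex_of_real (R\<^sup>2) - cnj w * 0) / R) ^ m w)"
        using R unfolding norm_power by (intro power_mono) (auto simp: norm_divide power2_eq_square)
    qed auto
    then show ?thesis by (simp add: D'_def DE norm_mult mult_right_mono)
  qed
  have nz: "D' z \<noteq> 0" if "z \<in> ball 0 R" for z
  proof -
    have "E z \<noteq> 0"
      using E(2)[of z] DE[of z] that by (cases "z \<in> Z") (auto simp: Z_def)
    moreover have "complex_of_real (R\<^sup>2) - cnj w * z \<noteq> 0" if "w \<in> Z" for w
    proof
      assume "complex_of_real (R\<^sup>2) - cnj w * z = 0"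
      then have "cnj w * z = complex_of_real (R\<^sup>2)" by (simp only: eq_iff_diff_eq_0[symmetric])
      then have "norm (cnj w * z) = R\<^sup>2" by (simp only: norm_of_real abs_power2)
      moreover have "norm (cnj w * z) \<le> R * norm z"
        using that by (auto simp: norm_mult Z_def intro: mult_right_mono)
      moreover have "R * norm z < R * R" using \<open>z \<in> ball 0 R\<close> R by simp
      ultimately show False unfolding power2_eq_square by linarith
    qed
    ultimately show ?thesis using \<open>finite Z\<close> R by (simp add: D'_def P_def)
  qed
  \<comment> \<open>M1 + 1 replaces M1 because the estimate for zero-free functions wants a strict
    bound.\<close>
  have "norm (D' 0) ^ 3 \<le> (M1 + 1) ^ 2 * norm (D' z)"
    by (rule norm_zero_free_ge[OF D' R nz _ z]) (use b1 in force)+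
  then have "norm (D 0) ^ 3 \<le> (M1 + 1) ^ 2 * norm (D' z)"
    using power_mono[OF D0le, of 3] by (meson norm_ge_zero order_trans)
  then have "norm (G z) * norm (D 0) ^ 3 \<le> norm (G z) * ((M1 + 1) ^ 2 * norm (D' z))"
    by (intro mult_left_mono) auto
  also have "\<dots> = (M1 + 1) ^ 2 * norm (D' z * G z)" by (simp add: norm_mult)
  also have "\<dots> \<le> (M1 + 1) ^ 2 * M2" by (intro mult_left_mono b2 zb) auto
  finally show ?thesis by (simp add: mult.commute)
qed

text \<open>The vectors u, v, -u - v have sum 0, so their rays cut the plane into three wedges of
  opening less than pi. The function is bounded in each of them, hence constant by Liouville, and
  the limit along u identifies the constant.\<close>

lemma entire_eq_0_if_tends_to_0_on_rays:
  fixes f :: "complex \<Rightarrow> complex" and u v :: complex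
  assumes hol: "f holomorphic_on UNIV"
    and growth: "\<And>z. norm (f z) \<le> A * exp (A * norm z)"
    and uv: "Im (cnj u * v) \<noteq> 0"
    and bd: "\<And>d. d \<in> {u, v, - u - v} \<Longrightarrow> \<exists>M. eventually (\<lambda>r::real. norm (f (of_real r * d)) \<le> M) at_top"
    and lim: "((\<lambda>r::real. f (of_real r * u)) \<longlongrightarrow> 0) at_top"
  shows "f z = 0"
proof -
  have "\<exists>M. \<forall>t::real. t \<ge> 0 \<longrightarrow> norm (f (of_real t * d)) \<le> M" if d: "d \<in> {u, v, - u - v}" for d
  proof -
    obtain M R where M: "\<And>r::real. r \<ge> R \<Longrightarrow> norm (f (of_real r * d)) \<le> M"
      using bd[OF d] by (auto simp: eventually_at_top_linorder)
    have "continuous_on UNIV f" by (rule holomorphic_on_imp_continuous_on[OF hol])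
    then have "continuous_on {0..R} (\<lambda>t::real. f (of_real t * d))"
      by (rule continuous_on_compose2) (auto intro!: continuous_intros)
    then have "bounded ((\<lambda>t::real. f (of_real t * d)) ` {0..R})"
      by (intro compact_imp_bounded compact_continuous_image) auto
    then obtain N where N: "\<And>t::real. t \<in> {0..R} \<Longrightarrow> norm (f (of_real t * d)) \<le> N"
      unfolding bounded_iff by (metis imageI)
    have "norm (f (of_real t * d)) \<le> max M N" if "t \<ge> 0" for t :: real
      using M[of t] N[of t] that by (cases "t \<ge> R") auto
    then show ?thesis by blast
  qed
  then obtain m where m: "\<And>d (t::real). d \<in> {u, v, - u - v} \<Longrightarrow> t \<ge> 0 \<Longrightarrow> norm (f (of_real t * d)) \<le> m d"
    by metis
  define M where "M = max (m u) (max (m v) (m (- u - v)))"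
  have ray: "norm (f (of_real t * d)) \<le> M" if "d \<in> {u, v, - u - v}" "t \<ge> 0" for d and t :: real
    using m[OF that] that(1) by (auto simp: M_def)
  have uv': "Im (cnj (- u - v) * v) \<noteq> 0" "Im (cnj (- u - v) * u) \<noteq> 0"
    using uv by (auto simp: algebra_simps)
  have "norm (f z) \<le> M" for z
  proof -
    define s where "s = Im (cnj v * z) / Im (cnj v * u)"
    define t where "t = Im (cnj u * z) / Im (cnj u * v)"
    have e: "Im (cnj v * u) = - Im (cnj u * v)" by (simp add: algebra_simps)
    have st: "s * Im (cnj u * v) = - Im (cnj v * z)" "t * Im (cnj u * v) = Im (cnj u * z)"
      using uv by (simp_all add: s_def t_def e del: times_complex.sel)
    have "Re (s * u + t * v) * Im (cnj u * v)
        = (s * Im (cnj u * v)) * Re u + (t * Im (cnj u * v)) * Re v"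
      by (simp add: algebra_simps)
    also have "\<dots> = Re z * Im (cnj u * v)" unfolding st by (simp add: algebra_simps)
    finally have 1: "Re (s * u + t * v) = Re z" using uv by (metis mult_right_cancel)
    have "Im (s * u + t * v) * Im (cnj u * v)
        = (s * Im (cnj u * v)) * Im u + (t * Im (cnj u * v)) * Im v"
      by (simp add: algebra_simps)
    also have "\<dots> = Im z * Im (cnj u * v)" unfolding st by (simp add: algebra_simps)
    finally have "Im (s * u + t * v) = Im z" using uv by (metis mult_right_cancel)
    with 1 have z: "z = s * u + t * v" by (metis complex_eqI)
    \<comment> \<open>In each case z is rewritten in that pair of ray directions in which both
      coordinates are nonnegative.\<close>
    consider "s \<ge> 0" "t \<ge> 0" | "s \<le> 0" "s \<le> t" | "t \<le> 0" "t \<le> s" by linarith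
    then show ?thesis
    proof cases
      case 1
      show ?thesis unfolding z
        by (rule phragmen_lindelof_wedge[OF hol growth uv]) (use 1 ray in auto)
    next
      case 2
      have "z = complex_of_real (- s) * (- u - v) + complex_of_real (t - s) * v"
        unfolding z by (simp add: algebra_simps)
      also have "norm (f \<dots>) \<le> M"
        by (rule phragmen_lindelof_wedge[OF hol growth uv'(1)]) (use 2 ray in auto)
      finally show ?thesis .
    next
      case 3
      have "z = complex_of_real (- t) * (- u - v) + complex_of_real (s - t) * u"
        unfolding z by (simp add: algebra_simps)
      also have "norm (f \<dots>) \<le> M"
        by (rule phragmen_lindelof_wedge[OF hol growth uv'(2)]) (use 3 ray in auto)
      finally show ?thesis .
    qed
  qed
  then have "bounded (range f)" by (auto simp: bounded_iff)
  then have "f constant_on UNIV" using Liouville_theorem[OF hol] by blast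
  then obtain c where c: "\<And>z. f z = c" by (auto simp: constant_on_def)
  then have "((\<lambda>r::real. c) \<longlongrightarrow> 0) at_top" using lim by simp
  then have "c = 0" by (simp add: tendsto_const_iff)
  then show ?thesis by (simp add: c)
qed

section \<open>Taylor coefficients, orders of vanishing and division\<close>

text \<open>Letting t tend to 0 kills the constant term; divide by t and repeat. This compares
  Taylor coefficients with nothing but a remainder estimate, without complex derivatives.\<close>

lemma coeffs_eq_0_if_small:
  fixes a :: "nat \<Rightarrow> complex"
  assumes \<delta>: "\<delta> > 0"
    and le: "\<And>t. t \<noteq> 0 \<Longrightarrow> norm t < \<delta> \<Longrightarrow> norm (\<Sum>n<m. a n * t ^ n) \<le> C * norm t ^ m"
    and n: "n < m"
  shows "a n = 0"
  using le n
proof (induction m arbitrary: a n)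
  case (Suc m)
  have ev: "eventually (\<lambda>t::complex. t \<noteq> 0 \<and> norm t < \<delta>) (at 0)"
    using \<delta> by (auto simp: eventually_at intro!: exI[of _ \<delta>])
  have "((\<lambda>t::complex. \<Sum>n<Suc m. a n * t ^ n) \<longlongrightarrow> (\<Sum>n<Suc m. a n * 0 ^ n)) (at 0)"
    by (intro tendsto_intros)
  moreover have "(\<Sum>n<Suc m. a n * 0 ^ n) = a 0"
    by (subst sum.lessThan_Suc_shift) simp
  moreover have "((\<lambda>t::complex. \<Sum>n<Suc m. a n * t ^ n) \<longlongrightarrow> 0) (at 0)"
  proof (rule Lim_null_comparison)
    show "eventually (\<lambda>t. norm (\<Sum>n<Suc m. a n * t ^ n) \<le> C * norm t ^ Suc m) (at 0)"
      using ev by eventually_elim (use Suc.prems(1) in blast)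
    have "((\<lambda>t::complex. C * norm t ^ Suc m) \<longlongrightarrow> C * norm (0::complex) ^ Suc m) (at 0)"
      by (intro tendsto_intros)
    then show "((\<lambda>t::complex. C * norm t ^ Suc m) \<longlongrightarrow> 0) (at 0)" by simp
  qed
  ultimately have a0: "a 0 = 0" using tendsto_unique[of "at (0::complex)"] by fastforce
  have "norm (\<Sum>n<m. a (Suc n) * t ^ n) \<le> C * norm t ^ m" if t: "t \<noteq> 0" "norm t < \<delta>" for t
  proof -
    have "(\<Sum>n<Suc m. a n * t ^ n) = t * (\<Sum>n<m. a (Suc n) * t ^ n)"
      unfolding sum.lessThan_Suc_shift a0 by (simp add: sum_distrib_left mult_ac)
    then have "norm t * norm (\<Sum>n<m. a (Suc n) * t ^ n) \<le> norm t * (C * norm t ^ m)"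
      using Suc.prems(1)[OF t] by (simp add: norm_mult mult_ac)
    then show ?thesis using t by simp
  qed
  then have "a (Suc k) = 0" if "k < m" for k using Suc.IH[of "\<lambda>n. a (Suc n)" k] that by blast
  then show ?case using a0 Suc.prems(2) by (cases n) auto
qed simp

text \<open>If the true order k of the zero were below m, the cofactor would be O(|z - w|^(m-k)) and
  would vanish at w.\<close>

lemma entire_factor_if_small:
  fixes F :: "complex \<Rightarrow> complex"
  assumes F: "F holomorphic_on UNIV" and \<delta>: "\<delta> > 0"
    and le: "\<And>z. z \<noteq> w \<Longrightarrow> norm (z - w) < \<delta> \<Longrightarrow> norm (F z) \<le> C * norm (z - w) ^ m"
  shows "\<exists>f. f holomorphic_on UNIV \<and> (\<forall>z. F z = (z - w) ^ m * f z)"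
proof (cases "\<forall>z. F z = 0")
  case True
  then show ?thesis by (intro exI[of _ "\<lambda>_. 0"]) auto
next
  case False
  then obtain a where "F a \<noteq> 0" by blast
  then obtain k g where g: "g holomorphic_on UNIV" "g w \<noteq> 0" "\<And>z. F z = (z - w) ^ k * g z"
    using entire_factor_zero[OF F] by metis
  have "m \<le> k"
  proof (rule ccontr)
    assume "\<not> m \<le> k"
    then have km: "k < m" by simp
    have "(g \<longlongrightarrow> g w) (at w)"
      using g(1) holomorphic_on_imp_continuous_on[OF g(1)]
      by (simp add: continuous_on_eq_continuous_at isCont_def)
    moreover have "(g \<longlongrightarrow> 0) (at w)"
    proof (rule Lim_null_comparison)
      have "eventually (\<lambda>z. z \<noteq> w \<and> norm (z - w) < \<delta>) (at w)"
        using \<delta> by (auto simp: eventually_at dist_norm intro!: exI[of _ \<delta>])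
      then show "eventually (\<lambda>z. norm (g z) \<le> C * norm (z - w) ^ (m - k)) (at w)"
      proof eventually_elim
        case (elim z)
        have "norm (z - w) ^ k * norm (g z) \<le> C * norm (z - w) ^ m"
          using le[of z] elim by (simp add: g(3) norm_mult norm_power)
        also have "norm (z - w) ^ m = norm (z - w) ^ k * norm (z - w) ^ (m - k)"
          using km by (simp flip: power_add)
        finally have "norm (z - w) ^ k * norm (g z) \<le> norm (z - w) ^ k * (C * norm (z - w) ^ (m - k))"
          by (simp only: mult_ac)
        moreover have "norm (z - w) ^ k > 0" using elim by simp
        ultimately show ?case by (simp only: mult_le_cancel_left_pos)
      qed
      have "((\<lambda>z. C * norm (z - w) ^ (m - k)) \<longlongrightarrow> C * norm (w - w) ^ (m - k)) (at w)"
        by (intro tendsto_intros)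
      then show "((\<lambda>z. C * norm (z - w) ^ (m - k)) \<longlongrightarrow> 0) (at w)" using km by (simp add: power_0_left)
    qed
    ultimately have "g w = 0" by (rule tendsto_unique[rotated]) simp
    then show False using g(2) by simp
  qed
  then have "F z = (z - w) ^ m * ((z - w) ^ (k - m) * g z)" for z
    by (simp add: g(3) flip: power_add mult.assoc)
  moreover have "(\<lambda>z. (z - w) ^ (k - m) * g z) holomorphic_on UNIV"
    by (intro holomorphic_intros g)
  ultimately show ?thesis by blast
qed

text \<open>The assumption on F says that every power (z - w)^m which divides D with a cofactor
  nonzero at w also divides F.\<close>

lemma entire_quotient:
  fixes F D :: "complex \<Rightarrow> complex"
  assumes F: "F holomorphic_on UNIV" and D: "D holomorphic_on UNIV" and a: "D a \<noteq> 0"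
    and zeros: "\<And>w m h. h holomorphic_on UNIV \<Longrightarrow> h w \<noteq> 0 \<Longrightarrow> (\<And>z. D z = (z - w) ^ m * h z) \<Longrightarrow>
      \<exists>f. f holomorphic_on UNIV \<and> (\<forall>z. F z = (z - w) ^ m * f z)"
  shows "\<exists>G. G holomorphic_on UNIV \<and> (\<forall>z. F z = D z * G z)"
proof -
  have "\<exists>m h f. h holomorphic_on UNIV \<and> h w \<noteq> 0 \<and> (\<forall>z. D z = (z - w) ^ m * h z) \<and>
      f holomorphic_on UNIV \<and> (\<forall>z. F z = (z - w) ^ m * f z)" for w
  proof -
    obtain m h where h: "h holomorphic_on UNIV" "h w \<noteq> 0" "\<And>z. D z = (z - w) ^ m * h z"
      by (rule entire_factor_zero[OF D a, where w = w]) (rule that; assumption)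
    then show ?thesis using zeros[OF h] by blast
  qed
  then obtain M H K where H: "\<And>w. H w holomorphic_on UNIV" "\<And>w. H w w \<noteq> 0" "\<And>w z. D z = (z - w) ^ M w * H w z"
    and K: "\<And>w. K w holomorphic_on UNIV" "\<And>w z. F z = (z - w) ^ M w * K w z"
    by metis
  \<comment> \<open>Each value is taken from the factorisation centred at that very point.
    \<open>loc\<close> shows that the factorisation centred at a single w represents G near w, so G
    is holomorphic there.\<close>
  define G where "G w = K w w / H w w" for w
  have loc: "G z = K w z / H w z" if "H w z \<noteq> 0" for w z
  proof (cases "z = w")
    case False
    have Dz: "D z \<noteq> 0" using H(3)[of z w] False that by auto
    have Mz: "M z = 0"
    proof (rule ccontr)
      assume "M z \<noteq> 0"
      then have "D z = 0" using H(3)[of z z] by simp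
      then show False using Dz by simp
    qed
    have "G z = F z / D z" using H(3)[of z z] K(2)[of z z] by (simp add: G_def Mz)
    also have "\<dots> = K w z / H w z" unfolding H(3)[of z w] K(2)[of z w] using False by simp
    finally show ?thesis .
  qed (simp add: G_def)
  have "G field_differentiable at w" for w
  proof -
    have "open {z. H w z \<noteq> 0}"
      using holomorphic_on_imp_continuous_on[OF H(1)[of w]] by (intro open_Collect_neq) auto
    moreover have "(\<lambda>z. K w z / H w z) holomorphic_on {z. H w z \<noteq> 0}"
      by (intro holomorphic_intros holomorphic_on_subset[OF K(1)] holomorphic_on_subset[OF H(1)]) auto
    then have "G holomorphic_on {z. H w z \<noteq> 0}"
      by (rule holomorphic_transform) (simp add: loc)
    ultimately show ?thesis using H(2)[of w]
      by (intro holomorphic_on_imp_differentiable_at[of G "{z. H w z \<noteq> 0}" w]) auto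
  qed
  then have "G holomorphic_on UNIV" by (simp add: holomorphic_on_def)
  moreover have "F z = D z * G z" for z
    using H(2,3)[of z] K(2)[of z z] H(3)[of z z] by (simp add: G_def)
  ultimately show ?thesis by blast
qed

text \<open>The origin is moved to a point where D does not vanish, and
  \<open>norm_quotient_le\<close> is applied on a circle of radius proportional to |z|. It bounds G
  by a product of three exponentials of type 2 A, hence the rate 6 A.\<close>

lemma quotient_exponential_type:
  fixes F D G :: "complex \<Rightarrow> complex"
  assumes D: "D holomorphic_on UNIV" and G: "G holomorphic_on UNIV" and a: "D a \<noteq> 0"
    and Fb: "\<And>z. norm (D z * G z) \<le> A * exp (A * norm z)"
    and Db: "\<And>z. norm (D z) \<le> A * exp (A * norm z)" and A: "A > 0"
  shows "\<exists>C. \<forall>z. norm (G z) \<le> C * exp (C * norm z)"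
proof -
  define N where "N = norm a"
  have N: "N \<ge> 0" by (simp add: N_def)
  \<comment> \<open>On the circle of radius R = 2 |w| + 1 around a, the modulus is at most R + N
    \<le> 2 |z| + 3 N + 1. \<open>E\<close> collects the part that does not depend on z.\<close>
  define E where "E = A * exp (A * (3 * N + 1))"
  have E: "E > 0" using A by (simp add: E_def)
  define K where "K = E * (E + 1) ^ 2 / norm (D a) ^ 3"
  have K: "K > 0" using E a by (simp add: K_def)
  have main: "norm (G z) \<le> K * exp (6 * A * norm z)" for z
  proof -
    define w where "w = z - a"
    define R where "R = 2 * norm w + 1"
    have R: "R > 0" by (simp add: R_def add_nonneg_pos)
    have nw: "norm w \<le> norm z + N" unfolding w_def N_def by (rule norm_triangle_ineq4)
    have bd: "A * exp (A * norm (x + a)) \<le> E * exp (2 * A * norm z)" if "norm x = R" for x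
    proof -
      have "norm (x + a) \<le> R + N" using norm_triangle_ineq[of x a] that by (simp add: N_def)
      also have "\<dots> \<le> 2 * norm z + (3 * N + 1)" using nw by (simp add: R_def)
      finally have "A * norm (x + a) \<le> A * (2 * norm z + (3 * N + 1))"
        using A by (intro mult_left_mono) auto
      also have "\<dots> = A * (3 * N + 1) + 2 * A * norm z" by (simp add: algebra_simps)
      finally have "exp (A * norm (x + a)) \<le> exp (A * (3 * N + 1)) * exp (2 * A * norm z)"
        by (simp flip: exp_add)
      then show ?thesis using A by (simp add: E_def mult.assoc)
    qed
    have hol: "(\<lambda>z. D (z + a)) holomorphic_on UNIV" "(\<lambda>z. G (z + a)) holomorphic_on UNIV"
    proof -
      have t: "(\<lambda>z. z + a) holomorphic_on UNIV" by (intro holomorphic_intros)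
      show "(\<lambda>z. D (z + a)) holomorphic_on UNIV" "(\<lambda>z. G (z + a)) holomorphic_on UNIV"
        using holomorphic_on_compose_gen[OF t D] holomorphic_on_compose_gen[OF t G] by (simp_all add: o_def)
    qed
    let ?X = "exp (2 * A * norm z)"
    have X1: "?X \<ge> 1" using A by simp
    have "norm (G (w + a)) * norm (D (0 + a)) ^ 3 \<le> (E * ?X) * (E * ?X + 1) ^ 2"
    proof (rule norm_quotient_le[OF hol _ R])
      show "norm (D (x + a)) \<le> E * ?X" if "norm x = R" for x using Db[of "x + a"] bd[OF that] by linarith
      show "norm (D (x + a) * G (x + a)) \<le> E * ?X" if "norm x = R" for x using Fb[of "x + a"] bd[OF that] by linarith
      show "norm w \<le> R / 2" by (simp add: R_def)
    qed (use a in simp)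
    also have "\<dots> \<le> (E * ?X) * ((E + 1) * ?X) ^ 2"
      using E X1 by (intro mult_left_mono power_mono) (auto simp: algebra_simps)
    also have "\<dots> = E * (E + 1) ^ 2 * ?X ^ 3" by (simp add: power2_eq_square power3_eq_cube)
    also have "?X ^ 3 = exp (6 * A * norm z)" using exp_of_nat_mult[of 3 "2 * A * norm z"] by (simp add: mult.assoc)
    finally show ?thesis using a by (simp add: w_def K_def field_simps)
  qed
  define C where "C = max K (6 * A)"
  have "norm (G z) \<le> C * exp (C * norm z)" for z
  proof -
    have "K * exp (6 * A * norm z) \<le> C * exp (C * norm z)"
      using K A by (intro mult_mono) (auto simp: C_def intro: mult_right_mono)
    then show ?thesis using main[of z] by linarith
  qed
  then show ?thesis by blast
qed

subsection \<open>Initial value problems\<close>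

locale dirac =
  fixes b :: "2 \<Rightarrow> complex" and q :: "2 \<Rightarrow> real \<Rightarrow> complex"
  assumes sq: "square_integrable (q i)"
begin

text \<open>
  Indices live in the cyclic type \<open>2\<close>, so \<open>i + 1\<close> is the other component, and \<open>q 1\<close>, \<open>q 2\<close> stand for
  \<open>Q\<^sub>1\<^sub>2\<close>, \<open>Q\<^sub>2\<^sub>1\<close>. The predicate \<open>sol \<mu> f\<close> is the integrated form of \<open>- i B y' + Q y = \<mu> y + f\<close>.
\<close>

definition rhs :: "complex \<Rightarrow> (2 \<Rightarrow> real \<Rightarrow> complex) \<Rightarrow> (2 \<Rightarrow> real \<Rightarrow> complex) \<Rightarrow> 2 \<Rightarrow> real \<Rightarrow> complex"
  where "rhs \<mu> f y i t = \<i> * b i * (\<mu> * y i t + f i t - q i t * y (i + 1) t)"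

definition sol :: "complex \<Rightarrow> (2 \<Rightarrow> real \<Rightarrow> complex) \<Rightarrow> (2 \<Rightarrow> real \<Rightarrow> complex) \<Rightarrow> bool"
  where "sol \<mu> f y \<longleftrightarrow> (\<forall>i. continuous_on {0..1} (y i)) \<and>
    (\<forall>i. \<forall>x\<in>{0..1}. y i x = y i 0 + integral {0..x} (rhs \<mu> f y i))"

lemma sol_continuous: "sol \<mu> f y \<Longrightarrow> continuous_on {0..1} (y i)"
  unfolding sol_def by blast

lemma sol_eq: "sol \<mu> f y \<Longrightarrow> x \<in> {0..1} \<Longrightarrow> y i x = y i 0 + integral {0..x} (rhs \<mu> f y i)"
  unfolding sol_def by blast

lemma solI:
  assumes "\<And>i. continuous_on {0..1} (y i)"
    and "\<And>i x. x \<in> {0..1} \<Longrightarrow> y i x = y i 0 + integral {0..x} (rhs \<mu> f y i)"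
  shows "sol \<mu> f y"
  using assms unfolding sol_def by blast

lemma square_integrable_rhs:
  assumes f: "\<And>i. square_integrable (f i)" and y: "\<And>i. continuous_on {0..1} (y i)"
  shows "square_integrable (rhs \<mu> f y i)"
proof -
  have "square_integrable (\<lambda>t. - 1 * (q i t * y (i + 1) t))"
    by (intro square_integrable_cmult square_integrable_mult_continuous sq y)
  moreover have "square_integrable (\<lambda>t. \<mu> * y i t)"
    by (intro square_integrable_cmult square_integrable_continuous y)
  ultimately have "square_integrable (\<lambda>t. (\<mu> * y i t + f i t) + (- 1 * (q i t * y (i + 1) t)))"
    by (intro square_integrable_add f)
  then have "square_integrable (\<lambda>t. \<i> * b i * ((\<mu> * y i t + f i t) + (- 1 * (q i t * y (i + 1) t))))"
    by (rule square_integrable_cmult)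
  then show ?thesis by (simp add: rhs_def [abs_def])
qed

lemma integrable_rhs:
  assumes f: "\<And>i. square_integrable (f i)" and y: "\<And>i. continuous_on {0..1} (y i)"
    and ab: "{s..x} \<subseteq> {0..1}"
  shows "rhs \<mu> f y i integrable_on {s..x}"
  using absolutely_integrable_on_subinterval[OF square_integrable_imp_absolutely_integrable(1)[OF square_integrable_rhs[OF f y]] ab]
  by (simp only: absolutely_integrable_on_def)

lemma square_integrable_integrable_on:
  fixes f :: "real \<Rightarrow> complex"
  assumes f: "square_integrable f" and ab: "{s..x} \<subseteq> {0..1}"
  shows "f integrable_on {s..x}" "(\<lambda>t. norm (f t)) integrable_on {s..x}"
  using absolutely_integrable_on_subinterval[OF square_integrable_imp_absolutely_integrable(1)[OF f] ab]
  by (simp_all only: absolutely_integrable_on_def)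

text \<open>
  \<open>\<kappa>\<close> is chosen so that the Picard operator halves the supremum norm with weight \<open>exp (- \<gamma> x)\<close> as soon
  as \<open>\<gamma> \<ge> \<kappa> (1 + \<bar>\<mu>\<bar>)\<close>.
\<close>

definition \<beta> :: real where "\<beta> = norm (b 1) + norm (b 2)"
definition qc :: real where "qc = 1 + integral {0..1} (\<lambda>t. (norm (q 1 t))\<^sup>2) + integral {0..1} (\<lambda>t. (norm (q 2 t))\<^sup>2)"
definition \<kappa> :: real where "\<kappa> = 1 + 4 * \<beta> + 16 * \<beta>\<^sup>2 * qc\<^sup>2"

lemma norm_b_le: "norm (b i) \<le> \<beta>"
  using exhaust_2[of i] by (auto simp: \<beta>_def)

lemma \<beta>_nonneg: "\<beta> \<ge> 0" by (simp add: \<beta>_def)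

lemma qc_ge: "1 + integral {0..1} (\<lambda>t. (norm (q i t))\<^sup>2) \<le> qc" and qc_pos: "qc > 0"
proof -
  have "integral {0..1} (\<lambda>t. (norm (q j t))\<^sup>2) \<ge> 0" for j
    using square_integrable_imp_absolutely_integrable(2)[OF sq, of j]
    by (intro integral_nonneg) (auto simp: absolutely_integrable_on_def)
  from this[of 1] this[of 2] show "1 + integral {0..1} (\<lambda>t. (norm (q i t))\<^sup>2) \<le> qc" "qc > 0"
    using exhaust_2[of i] by (auto simp: qc_def)
qed

lemma \<kappa>_ge1: "\<kappa> \<ge> 1" using \<beta>_nonneg by (simp add: \<kappa>_def)

lemma integral_exp_q_le:
  assumes "\<bar>\<delta>\<bar> > 0" "0 \<le> s" "s \<le> x" "x \<le> 1" "\<delta> > 0 \<Longrightarrow> c = x" "\<delta> < 0 \<Longrightarrow> c = s"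
  shows "integral {s..x} (\<lambda>t. exp (\<delta> * (t - c)) * norm (q i t)) \<le> qc / sqrt \<bar>\<delta>\<bar>"
proof -
  have "(1 + integral {0..1} (\<lambda>t. (norm (q i t))\<^sup>2)) / sqrt \<bar>\<delta>\<bar> \<le> qc / sqrt \<bar>\<delta>\<bar>"
    using qc_ge[of i] by (intro divide_right_mono) auto
  then show ?thesis using integral_exp_norm_le[OF sq[of i] assms] by linarith
qed

lemma integrable_exp_norm:
  fixes p :: "real \<Rightarrow> complex"
  assumes "square_integrable p" "{s..x} \<subseteq> {0..1}"
  shows "(\<lambda>t. exp (\<delta> * (t - c)) * norm (p t)) integrable_on {s..x}"
proof -
  have "(\<lambda>t. p t * of_real (exp (\<delta> * (t - c)))) absolutely_integrable_on {s..x}"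
    using absolutely_integrable_on_subinterval[OF square_integrable_imp_absolutely_integrable(1)[OF assms(1)] assms(2)]
    by (rule absolutely_integrable_mult_continuous) (intro continuous_intros)
  then have "(\<lambda>t. norm (p t * of_real (exp (\<delta> * (t - c))))) integrable_on {s..x}"
    by (simp only: absolutely_integrable_on_def)
  then show ?thesis by (simp add: norm_mult mult.commute)
qed

text \<open>Each of the two terms of the equation contributes a quarter. For the term with \<mu> the
  weight integrates to at most 1 / \<gamma>, so 4 \<beta> |\<mu>| \<le> \<gamma> suffices. For the
  potential only 1 / sqrt \<gamma> is gained, and the condition becomes (4 \<beta> qc)^2 \<le>
  \<gamma>. These are the last two summands of \<open>\<kappa>\<close>.\<close>

lemma contraction:
  assumes u: "\<And>i. continuous_on {0..1} (u i)"
    and \<gamma>: "\<gamma> \<ge> \<kappa> * (1 + norm \<mu>)"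
    and M: "\<And>i t. t \<in> {0..1} \<Longrightarrow> norm (u i t) \<le> M * exp (\<gamma> * t)"
    and x: "x \<in> {0..1}"
  shows "norm (integral {0..x} (rhs \<mu> (\<lambda>i t. 0) u i)) \<le> M / 2 * exp (\<gamma> * x)"
proof -
  have sub: "{0..x} \<subseteq> {0..1}" using x by auto
  have M0: "M \<ge> 0" using order_trans[OF norm_ge_zero M[of 0 1]] by simp
  have k: "\<kappa> * norm \<mu> \<le> \<gamma>" "\<kappa> \<le> \<gamma>" using \<gamma> \<kappa>_ge1 by (auto simp: algebra_simps intro: order_trans[rotated])
  have \<gamma>1: "\<gamma> \<ge> 1" using k \<kappa>_ge1 by linarith
  have "4 * \<beta> * norm \<mu> \<le> \<kappa> * norm \<mu>"
    using \<beta>_nonneg by (intro mult_right_mono) (auto simp: \<kappa>_def)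
  then have g1: "4 * \<beta> * norm \<mu> \<le> \<gamma>" using k by linarith
  have "(4 * \<beta> * qc)\<^sup>2 \<le> \<kappa>" using \<beta>_nonneg by (simp add: \<kappa>_def power_mult_distrib)
  then have "(4 * \<beta> * qc)\<^sup>2 \<le> \<gamma>" using k by linarith
  then have g2: "4 * \<beta> * qc \<le> sqrt \<gamma>" using real_le_rsqrt by blast
  have e: "((\<lambda>t. exp (\<gamma> * (t - x))) has_integral (exp (\<gamma> * (x - x)) - exp (\<gamma> * (0 - x))) / \<gamma>) {0..x}"
    by (rule integral_exp_scaled) (use \<gamma>1 x in auto)
  have ie: "integral {0..x} (\<lambda>t. exp (\<gamma> * (t - x))) \<le> 1 / \<gamma>"
    unfolding integral_unique[OF e] using \<gamma>1 by (intro divide_right_mono) auto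
  have iq: "integral {0..x} (\<lambda>t. exp (\<gamma> * (t - x)) * norm (q i t)) \<le> qc / sqrt \<gamma>"
    using integral_exp_q_le[of \<gamma> 0 x x i] \<gamma>1 x by auto
  have int: "(\<lambda>t. exp (\<gamma> * (t - x)) * norm (q i t)) integrable_on {0..x}"
    by (rule integrable_exp_norm[OF sq sub])
  have "norm (integral {0..x} (rhs \<mu> (\<lambda>i t. 0) u i)) \<le>
      integral {0..x} (\<lambda>t. \<beta> * M * exp (\<gamma> * x) * (norm \<mu> * exp (\<gamma> * (t - x)) + exp (\<gamma> * (t - x)) * norm (q i t)))"
  proof (rule integral_norm_bound_integral)
    show "rhs \<mu> (\<lambda>i t. 0) u i integrable_on {0..x}"
      by (intro integrable_rhs square_integrable_zero u sub)
    show "(\<lambda>t. \<beta> * M * exp (\<gamma> * x) * (norm \<mu> * exp (\<gamma> * (t - x)) + exp (\<gamma> * (t - x)) * norm (q i t))) integrable_on {0..x}"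
      by (intro integrable_on_mult_right integrable_add int has_integral_integrable[OF e])
    fix t assume "t \<in> {0..x}"
    then have t: "t \<in> {0..1}" using sub by auto
    have ex: "exp (\<gamma> * t) = exp (\<gamma> * x) * exp (\<gamma> * (t - x))"
      by (simp flip: exp_add add: algebra_simps)
    have "norm (\<mu> * u i t - q i t * u (i + 1) t) \<le> norm \<mu> * norm (u i t) + norm (q i t) * norm (u (i + 1) t)"
      using norm_triangle_ineq4[of "\<mu> * u i t" "q i t * u (i + 1) t"] by (simp only: norm_mult)
    also have "\<dots> \<le> norm \<mu> * (M * exp (\<gamma> * t)) + norm (q i t) * (M * exp (\<gamma> * t))"
      by (intro add_mono mult_left_mono M t) auto
    finally have "norm (b i) * norm (\<mu> * u i t - q i t * u (i + 1) t) \<le>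
        \<beta> * (norm \<mu> * (M * exp (\<gamma> * t)) + norm (q i t) * (M * exp (\<gamma> * t)))"
      by (intro mult_mono norm_b_le \<beta>_nonneg) auto
    moreover have "norm (rhs \<mu> (\<lambda>i t. 0) u i t) = norm (b i) * norm (\<mu> * u i t - q i t * u (i + 1) t)"
      by (simp add: rhs_def norm_mult)
    moreover have "\<beta> * (norm \<mu> * (M * exp (\<gamma> * t)) + norm (q i t) * (M * exp (\<gamma> * t)))
        = \<beta> * M * exp (\<gamma> * x) * (norm \<mu> * exp (\<gamma> * (t - x)) + exp (\<gamma> * (t - x)) * norm (q i t))"
      unfolding ex by (simp only: distrib_left distrib_right mult_ac)
    ultimately show "norm (rhs \<mu> (\<lambda>i t. 0) u i t) \<le>
        \<beta> * M * exp (\<gamma> * x) * (norm \<mu> * exp (\<gamma> * (t - x)) + exp (\<gamma> * (t - x)) * norm (q i t))"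
      by (simp only:)
  qed
  also have "\<dots> = \<beta> * M * exp (\<gamma> * x) * (norm \<mu> * integral {0..x} (\<lambda>t. exp (\<gamma> * (t - x)))
      + integral {0..x} (\<lambda>t. exp (\<gamma> * (t - x)) * norm (q i t)))"
    using Henstock_Kurzweil_Integration.integral_add[OF integrable_on_mult_right[OF has_integral_integrable[OF e], of "norm \<mu>"] int]
    by simp
  also have "\<dots> \<le> \<beta> * M * exp (\<gamma> * x) * (norm \<mu> * (1 / \<gamma>) + qc / sqrt \<gamma>)"
    using \<beta>_nonneg M0 by (intro mult_left_mono add_mono ie iq) auto
  also have "\<dots> = M * exp (\<gamma> * x) * (\<beta> * norm \<mu> / \<gamma> + \<beta> * qc / sqrt \<gamma>)"
    by (simp add: algebra_simps)
  also have "\<dots> \<le> M * exp (\<gamma> * x) * (1 / 4 + 1 / 4)"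
  proof (intro mult_left_mono add_mono)
    show "\<beta> * norm \<mu> / \<gamma> \<le> 1 / 4" using g1 \<gamma>1 by (simp add: field_simps)
    show "\<beta> * qc / sqrt \<gamma> \<le> 1 / 4" using g2 \<gamma>1 by (simp add: field_simps)
  qed (use M0 in auto)
  finally show ?thesis by simp
qed

lemma bounded_if_continuous:
  fixes u :: "2 \<Rightarrow> real \<Rightarrow> complex"
  assumes "\<And>i. continuous_on {0..1} (u i)"
  obtains M where "M \<ge> 0" "\<And>i t. t \<in> {0..1} \<Longrightarrow> norm (u i t) \<le> M"
proof -
  have "\<exists>M. \<forall>t\<in>{0..1}. norm (u i t) \<le> M" for i
  proof -
    have "bounded (u i ` {0..1})"
      using assms by (intro compact_imp_bounded compact_continuous_image) auto
    then show ?thesis unfolding bounded_iff by blast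
  qed
  then obtain m where m: "\<And>i t. t \<in> {0..1} \<Longrightarrow> norm (u i t) \<le> m i" by metis
  have "norm (u i t) \<le> \<bar>m 1\<bar> + \<bar>m 2\<bar>" if "t \<in> {0..1}" for i t
    using m[OF that, of i] exhaust_2[of i] by auto
  then show ?thesis using that[of "\<bar>m 1\<bar> + \<bar>m 2\<bar>"] by auto
qed

text \<open>Any crude bound M improves: each application of the contraction halves the excess over 2
  m, so the bound 2 m + M / 2^n holds for every n.\<close>

lemma fixed_point_bound:
  assumes y: "\<And>i. continuous_on {0..1} (y i)"
    and \<gamma>: "\<gamma> \<ge> \<kappa> * (1 + norm \<mu>)"
    and eq: "\<And>i x. x \<in> {0..1} \<Longrightarrow> y i x = v i x + integral {0..x} (rhs \<mu> (\<lambda>i t. 0) y i)"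
    and v: "\<And>i x. x \<in> {0..1} \<Longrightarrow> norm (v i x) \<le> m * exp (\<gamma> * x)"
    and x: "x \<in> {0..1}"
  shows "norm (y i x) \<le> 2 * m * exp (\<gamma> * x)"
proof -
  have "\<kappa> * (1 + norm \<mu>) \<ge> 0" using \<kappa>_ge1 by auto
  then have \<gamma>0: "\<gamma> \<ge> 0" using \<gamma> by linarith
  obtain M where M: "M \<ge> 0" "\<And>i t. t \<in> {0..1} \<Longrightarrow> norm (y i t) \<le> M"
    using bounded_if_continuous[of y, OF y] by metis
  have m0: "m \<ge> 0" using order_trans[OF norm_ge_zero v[of 0 1]] by simp
  have step: "norm (y i x) \<le> (2 * m + M * (1 / 2) ^ n) * exp (\<gamma> * x)" if "x \<in> {0..1}" for n i x
    using that
  proof (induction n arbitrary: i x)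
    case 0
    have "M * 1 \<le> M * exp (\<gamma> * x)" using M(1) \<gamma>0 0 by (intro mult_left_mono) auto
    moreover have "2 * m * exp (\<gamma> * x) \<ge> 0" using m0 by simp
    ultimately show ?case using M(2)[OF 0, of i] by (simp add: algebra_simps)
  next
    case (Suc n)
    have "norm (integral {0..x} (rhs \<mu> (\<lambda>i t. 0) y i)) \<le> (2 * m + M * (1 / 2) ^ n) / 2 * exp (\<gamma> * x)"
      by (rule contraction[OF y \<gamma>]) (use Suc in auto)
    then have "norm (y i x) \<le> m * exp (\<gamma> * x) + (2 * m + M * (1 / 2) ^ n) / 2 * exp (\<gamma> * x)"
      unfolding eq[OF Suc.prems, of i]
      using norm_triangle_ineq[of "v i x" "integral {0..x} (rhs \<mu> (\<lambda>i t. 0) y i)"] v[OF Suc.prems, of i]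
      by linarith
    then show ?case by (simp add: add_divide_distrib algebra_simps)
  qed
  have "(\<lambda>n. (2 * m + M * (1 / 2) ^ n) * exp (\<gamma> * x)) \<longlonglongrightarrow> (2 * m + M * 0) * exp (\<gamma> * x)"
    by (intro tendsto_intros LIMSEQ_power_zero) auto
  then have "norm (y i x) \<le> (2 * m + M * 0) * exp (\<gamma> * x)"
    by (rule LIMSEQ_le_const) (use step[OF x] in auto)
  then show ?thesis by simp
qed

lemma continuous_on_integral_rhs:
  assumes f: "\<And>i. square_integrable (f i)" and y: "\<And>i. continuous_on {0..1} (y i)"
  shows "continuous_on {0..1} (\<lambda>x. integral {0..x} (rhs \<mu> f y i))"
  by (intro indefinite_integral_continuous_1 integrable_rhs f y order_refl)

lemma integral_rhs_lin:
  assumes f: "\<And>i. square_integrable (f i)" and y: "\<And>i. continuous_on {0..1} (y i)"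
    and g: "\<And>i. square_integrable (g i)" and z: "\<And>i. continuous_on {0..1} (z i)"
    and x: "x \<in> {0..1}"
  shows "integral {0..x} (rhs \<mu> (\<lambda>i t. f i t + c * g i t) (\<lambda>i t. y i t + c * z i t) i)
    = integral {0..x} (rhs \<mu> f y i) + c * integral {0..x} (rhs \<mu> g z i)"
proof -
  have sub: "{0..x} \<subseteq> {0..1}" using x by auto
  have "rhs \<mu> (\<lambda>i t. f i t + c * g i t) (\<lambda>i t. y i t + c * z i t) i
      = (\<lambda>t. rhs \<mu> f y i t + c * rhs \<mu> g z i t)"
    by (auto simp: rhs_def algebra_simps)
  then show ?thesis
    using Henstock_Kurzweil_Integration.integral_add[OF integrable_rhs[where f = f and y = y and \<mu> = \<mu> and i = i, OF f y sub]
        integrable_on_mult_right[OF integrable_rhs[where f = g and y = z and \<mu> = \<mu> and i = i, OF g z sub], of c]] by simp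
qed

lemma sol_lin:
  assumes f: "\<And>i. square_integrable (f i)" and g: "\<And>i. square_integrable (g i)"
    and y: "sol \<mu> f y" and z: "sol \<mu> g z"
  shows "sol \<mu> (\<lambda>i t. f i t + c * g i t) (\<lambda>i t. y i t + c * z i t)"
  unfolding sol_def
proof (intro conjI allI ballI)
  have yz: "continuous_on {0..1} (y i)" "continuous_on {0..1} (z i)" for i
    by (rule sol_continuous[OF y], rule sol_continuous[OF z])
  show "continuous_on {0..1} (\<lambda>t. y i t + c * z i t)" for i
    by (intro continuous_intros yz)
  fix i :: 2 and x :: real assume x: "x \<in> {0..1}"
  have "y i x = y i 0 + integral {0..x} (rhs \<mu> f y i)" "z i x = z i 0 + integral {0..x} (rhs \<mu> g z i)"
    by (rule sol_eq[OF y x], rule sol_eq[OF z x])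
  then show "y i x + c * z i x = y i 0 + c * z i 0
      + integral {0..x} (rhs \<mu> (\<lambda>i t. f i t + c * g i t) (\<lambda>i t. y i t + c * z i t) i)"
    unfolding integral_rhs_lin[OF f yz(1) g yz(2) x] by (simp only: distrib_left add_ac)
qed

text \<open>The Neumann series of the Picard operator T. Its terms halve in the weighted norm, so it
  converges uniformly, and T may be taken to the limit in s (N + 1) = v + T (s N).\<close>

lemma fixed_point_exists:
  assumes v: "\<And>i. continuous_on {0..1} (v i)"
  shows "\<exists>y. (\<forall>i. continuous_on {0..1} (y i)) \<and>
    (\<forall>i. \<forall>x\<in>{0..1}. y i x = v i x + integral {0..x} (rhs \<mu> (\<lambda>i t. 0) y i))"
proof -
  define \<gamma> where "\<gamma> = \<kappa> * (1 + norm \<mu>)"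
  have \<gamma>0: "\<gamma> \<ge> 0" using \<kappa>_ge1 by (auto simp: \<gamma>_def)
  define T where "T u i x = integral {0..x} (rhs \<mu> (\<lambda>i t. 0) u i)" for u i x
  define w where "w n = (T ^^ n) v" for n
  have w_Suc: "w (Suc n) = T (w n)" for n by (simp add: w_def)
  have wc: "continuous_on {0..1} (w n i)" for n i
  proof (induction n arbitrary: i)
    case 0 then show ?case by (simp add: w_def v)
  next
    case (Suc n)
    then show ?case unfolding w_Suc T_def
      by (intro continuous_on_integral_rhs square_integrable_zero)
  qed
  obtain M where M: "M \<ge> 0" "\<And>i t. t \<in> {0..1} \<Longrightarrow> norm (v i t) \<le> M"
    using bounded_if_continuous[of v, OF v] by metis
  have wb: "norm (w n i x) \<le> M * (1 / 2) ^ n * exp (\<gamma> * x)" if "x \<in> {0..1}" for n i x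
    using that
  proof (induction n arbitrary: i x)
    case 0
    have "M * 1 \<le> M * exp (\<gamma> * x)" using M(1) \<gamma>0 0 by (intro mult_left_mono) auto
    then show ?case using M(2)[OF 0, of i] by (simp add: w_def)
  next
    case (Suc n)
    have "norm (w (Suc n) i x) \<le> M * (1 / 2) ^ n / 2 * exp (\<gamma> * x)"
      unfolding w_Suc T_def by (rule contraction[OF wc]) (use Suc in \<open>auto simp: \<gamma>_def\<close>)
    then show ?case by (simp add: algebra_simps)
  qed
  have wb': "norm (w n i x) \<le> M * exp \<gamma> * (1 / 2) ^ n" if x: "x \<in> {0..1}" for n i x
  proof -
    have "exp (\<gamma> * x) \<le> exp \<gamma>" using x \<gamma>0 mult_left_mono[of x 1 \<gamma>] by simp
    then have "M * (1 / 2) ^ n * exp (\<gamma> * x) \<le> M * (1 / 2) ^ n * exp \<gamma>"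
      using M(1) by (intro mult_left_mono) auto
    then show ?thesis using wb[OF x, of n i] by (simp add: mult_ac)
  qed
  define y where "y i x = (\<Sum>n. w n i x)" for i x
  define s where "s N i x = (\<Sum>n<N. w n i x)" for N i x
  have s_Suc: "s (Suc N) = (\<lambda>i t. s N i t + w N i t)" for N by (auto simp: s_def fun_eq_iff)
  have "uniform_limit {0..1} (\<lambda>N x. \<Sum>n<N. w n i x) (\<lambda>x. \<Sum>n. w n i x) sequentially" for i
    by (rule Weierstrass_m_test[where M = "\<lambda>n. M * exp \<gamma> * (1 / 2) ^ n"])
      (auto intro!: summable_mult summable_geometric wb')
  then have ul: "uniform_limit {0..1} (\<lambda>N. s N i) (y i) sequentially" for i
    by (simp only: s_def[abs_def] y_def[abs_def])
  have sc: "continuous_on {0..1} (s N i)" for N i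
    unfolding s_def[abs_def] by (intro continuous_on_sum wc)
  have yc: "continuous_on {0..1} (y i)" for i
    by (rule uniform_limit_theorem[OF _ ul]) (auto simp: sc)
  have sT: "s (Suc N) i x = v i x + T (s N) i x" if x: "x \<in> {0..1}" for N i x
  proof (induction N)
    case 0
    have "rhs \<mu> (\<lambda>i t. 0) (s 0) i = (\<lambda>t. 0)" by (auto simp: rhs_def s_def)
    then have "T (s 0) i x = 0" unfolding T_def by simp
    moreover have "s (Suc 0) i x = v i x" by (simp add: s_def w_def)
    ultimately show ?case by (simp only: add_0_right)
  next
    case (Suc N)
    have "T (s (Suc N)) i x = T (s N) i x + T (w N) i x"
      unfolding T_def
      using integral_rhs_lin[where f = "\<lambda>i t. 0" and g = "\<lambda>i t. 0" and y = "s N" and z = "w N" and c = 1 and \<mu> = \<mu> and i = i,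
          OF square_integrable_zero sc square_integrable_zero wc x]
      by (simp add: s_Suc)
    moreover have "s (Suc (Suc N)) i x = s (Suc N) i x + T (w N) i x" by (simp add: s_def w_Suc)
    ultimately show ?case using Suc by (simp only: add.assoc)
  qed
  have "y i x = v i x + T y i x" if x: "x \<in> {0..1}" for i x
  proof -
    have "(\<lambda>N. T (s N) i x) \<longlonglongrightarrow> T y i x"
    proof (rule LIMSEQ_I)
      fix e :: real assume e: "e > 0"
      \<comment> \<open>The contraction estimate is weighted and loses a factor of at most exp
        \<gamma>.\<close>
      define e' where "e' = e / exp \<gamma>"
      have e': "e' > 0" using e by (simp add: e'_def)
      have "eventually (\<lambda>N. \<forall>i. \<forall>t\<in>{0..1}. dist (s N i t) (y i t) < e') sequentially"
        using uniform_limitD[OF ul e', of 1] uniform_limitD[OF ul e', of 2]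
        by eventually_elim (simp add: forall_2)
      then obtain N0 where N0: "\<And>N i t. N \<ge> N0 \<Longrightarrow> t \<in> {0..1} \<Longrightarrow> dist (s N i t) (y i t) < e'"
        unfolding eventually_sequentially by blast
      have "norm (T (s N) i x - T y i x) < e" if N: "N \<ge> N0" for N
      proof -
        have c: "continuous_on {0..1} (\<lambda>t. s N j t + - 1 * y j t)" for j
          by (intro continuous_intros sc yc)
        have "T (s N) i x - T y i x = integral {0..x} (rhs \<mu> (\<lambda>i t. 0) (\<lambda>i t. s N i t + - 1 * y i t) i)"
          unfolding T_def
          using integral_rhs_lin[where f = "\<lambda>i t. 0" and g = "\<lambda>i t. 0" and y = "s N" and z = y and c = "- 1" and \<mu> = \<mu> and i = i,
              OF square_integrable_zero sc square_integrable_zero yc x]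
          by simp
        also have "norm \<dots> \<le> e' / 2 * exp (\<gamma> * x)"
        proof (rule contraction[OF c _ _ x])
          show "\<kappa> * (1 + norm \<mu>) \<le> \<gamma>" by (simp add: \<gamma>_def)
          fix j :: 2 and t :: real assume t: "t \<in> {0..1}"
          have "e' * 1 \<le> e' * exp (\<gamma> * t)" using e' \<gamma>0 t by (intro mult_left_mono) auto
          moreover have "norm (s N j t - y j t) < e'"
            using N0[OF N t, of j] unfolding dist_norm .
          moreover have "s N j t + - 1 * y j t = s N j t - y j t" by simp
          ultimately show "norm (s N j t + - 1 * y j t) \<le> e' * exp (\<gamma> * t)"
            by (simp only:)
        qed
        also have "\<dots> \<le> e' / 2 * exp \<gamma>"
          using e' \<gamma>0 x mult_left_mono[of x 1 \<gamma>] by (intro mult_left_mono) auto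
        also have "\<dots> = e / 2" by (simp add: e'_def)
        also have "\<dots> < e" using e by simp
        finally show ?thesis .
      qed
      then show "\<exists>N0. \<forall>N\<ge>N0. norm (T (s N) i x - T y i x) < e" by blast
    qed
    then have "(\<lambda>N. v i x + T (s N) i x) \<longlonglongrightarrow> v i x + T y i x" by (intro tendsto_intros)
    then have "(\<lambda>N. s (Suc N) i x) \<longlonglongrightarrow> v i x + T y i x" by (simp only: sT[OF x])
    moreover have "(\<lambda>N. s (Suc N) i x) \<longlonglongrightarrow> y i x"
      using tendsto_uniform_limitI[OF ul x, of i] by (rule LIMSEQ_Suc)
    ultimately show ?thesis by (rule LIMSEQ_unique[rotated])
  qed
  then show ?thesis using yc by (intro exI[of _ y]) (auto simp: T_def)
qed

lemma rhs_split:
  assumes f: "\<And>i. square_integrable (f i)" and y: "\<And>i. continuous_on {0..1} (y i)"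
    and x: "x \<in> {0..1}"
  shows "integral {0..x} (rhs \<mu> f y i) = integral {0..x} (\<lambda>t. \<i> * b i * f i t) + integral {0..x} (rhs \<mu> (\<lambda>i t. 0) y i)"
proof -
  have "integral {0..x} (rhs \<mu> (\<lambda>i t. f i t + 1 * 0) (\<lambda>i t. 0 + 1 * y i t) i)
    = integral {0..x} (rhs \<mu> f (\<lambda>i t. 0) i) + 1 * integral {0..x} (rhs \<mu> (\<lambda>i t. 0) y i)"
    by (rule integral_rhs_lin[OF f _ square_integrable_zero y x]) auto
  then show ?thesis by (simp add: rhs_def[abs_def])
qed

lemma sol_exists:
  assumes f: "\<And>i. square_integrable (f i)"
  shows "\<exists>y. sol \<mu> f y \<and> (\<forall>i. y i 0 = \<eta> i)"
proof -
  define v where "v i x = \<eta> i + integral {0..x} (\<lambda>t. \<i> * b i * f i t)" for i x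
  have "continuous_on {0..1} (v i)" for i unfolding v_def
    by (intro continuous_intros indefinite_integral_continuous_1 integrable_on_mult_right
        square_integrable_integrable_on f order_refl)
  then obtain y where y: "\<And>i. continuous_on {0..1} (y i)"
    "\<And>i x. x \<in> {0..1} \<Longrightarrow> y i x = v i x + integral {0..x} (rhs \<mu> (\<lambda>i t. 0) y i)"
    using fixed_point_exists[of v \<mu>] by blast
  have y0: "y i 0 = \<eta> i" for i using y(2)[of 0 i] by (simp add: v_def)
  have "y i x = y i 0 + integral {0..x} (rhs \<mu> f y i)" if x: "x \<in> {0..1}" for i x
    unfolding rhs_split[OF f y(1) x] y0 using y(2)[OF x, of i] by (simp add: v_def)
  then have "sol \<mu> f y" by (intro solI y(1))
  then show ?thesis using y0 by blast
qed

lemma sol_bound: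
  assumes f: "\<And>i. square_integrable (f i)" and y: "sol \<mu> f y"
    and \<gamma>: "\<gamma> \<ge> \<kappa> * (1 + norm \<mu>)"
    and m: "\<And>i x. x \<in> {0..1} \<Longrightarrow> norm (y i 0 + integral {0..x} (\<lambda>t. \<i> * b i * f i t)) \<le> m * exp (\<gamma> * x)"
    and x: "x \<in> {0..1}"
  shows "norm (y i x) \<le> 2 * m * exp (\<gamma> * x)"
proof (rule fixed_point_bound[where v = "\<lambda>i x. y i 0 + integral {0..x} (\<lambda>t. \<i> * b i * f i t)", OF _ \<gamma> _ m x])
  show yc: "continuous_on {0..1} (y i)" for i by (rule sol_continuous[OF y])
  show "y i x = y i 0 + integral {0..x} (\<lambda>t. \<i> * b i * f i t) + integral {0..x} (rhs \<mu> (\<lambda>i t. 0) y i)"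
    if x: "x \<in> {0..1}" for i x
  proof -
    have "y i x = y i 0 + integral {0..x} (rhs \<mu> f y i)" by (rule sol_eq[OF y x])
    then show ?thesis unfolding rhs_split[OF f yc x] by (simp only: add.assoc)
  qed
qed

text \<open>The difference solves the homogeneous equation with zero initial values, and the a
  priori bound applies with m = 0.\<close>

lemma sol_unique:
  assumes f: "\<And>i. square_integrable (f i)" and y: "sol \<mu> f y" and z: "sol \<mu> f z"
    and 0: "\<And>i. y i 0 = z i 0" and x: "x \<in> {0..1}"
  shows "y i x = z i x"
proof -
  have s: "sol \<mu> (\<lambda>i t. f i t + - 1 * f i t) (\<lambda>i t. y i t + - 1 * z i t)"
    using sol_lin[where f = f and g = f and c = "- 1", OF f f y z] .
  have eq: "(\<lambda>i t. f i t + - 1 * f i t) = (\<lambda>i t. 0)" by (simp add: fun_eq_iff)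
  have "norm (y i x + - 1 * z i x) \<le> 2 * 0 * exp (\<kappa> * (1 + norm \<mu>) * x)"
  proof (rule sol_bound[where f = "\<lambda>i t. 0" and y = "\<lambda>i t. y i t + - 1 * z i t" and m = 0, OF _ _ order_refl _ x])
    show "sol \<mu> (\<lambda>i t. 0) (\<lambda>i t. y i t + - 1 * z i t)" using s unfolding eq .
    show "norm (y i 0 + - 1 * z i 0 + integral {0..x} (\<lambda>t. \<i> * b i * 0)) \<le> 0 * exp (\<kappa> * (1 + norm \<mu>) * x)" for i x
      using 0[of i] by simp
  qed (rule square_integrable_zero)
  then show ?thesis by simp
qed

lemma sol_cong_AE:
  assumes fg: "\<And>i. AE t in unit_lebesgue. f i t = g i t" and y: "sol \<mu> f y"
  shows "sol \<mu> g y"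
proof (rule solI)
  show "continuous_on {0..1} (y i)" for i by (rule sol_continuous[OF y])
  fix i :: 2 and x :: real assume x: "x \<in> {0..1}"
  have "AE t in lebesgue. t \<in> {0..1} \<longrightarrow> f i t = g i t"
    using fg[of i] by (subst (asm) AE_restrict_space_iff) auto
  then obtain N where N: "N \<in> null_sets lebesgue" "{t. \<not> (t \<in> {0..1} \<longrightarrow> f i t = g i t)} \<subseteq> N"
    by (auto elim!: AE_E3 simp: eventually_ae_filter)
  have "integral {0..x} (rhs \<mu> f y i) = integral {0..x} (rhs \<mu> g y i)"
  proof (rule integral_spike)
    show "negligible N" using N(1) by (simp add: negligible_iff_null_sets)
    show "rhs \<mu> g y i t = rhs \<mu> f y i t" if "t \<in> {0..x} - N" for t
    proof -
      have "f i t = g i t" using that N(2) x by auto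
      then show ?thesis by (simp only: rhs_def)
    qed
  qed
  then show "y i x = y i 0 + integral {0..x} (rhs \<mu> g y i)" using sol_eq[OF y x, of i] by (simp only:)
qed

section \<open>Analytic dependence on the spectral parameter\<close>

text \<open>A change of the spectral parameter can be charged to the source. This is the resolvent
  identity in integrated form, and the origin of all expansions below.\<close>

lemma sol_shift:
  assumes "sol \<nu> f y"
  shows "sol \<mu> (\<lambda>i t. f i t + (\<nu> - \<mu>) * y i t) y"
proof -
  have eq: "rhs \<mu> (\<lambda>i t. f i t + (\<nu> - \<mu>) * y i t) y = rhs \<nu> f y"
    by (simp add: rhs_def fun_eq_iff algebra_simps)
  show ?thesis
    by (rule solI[OF sol_continuous[OF assms]]) (unfold eq, rule sol_eq[OF assms])
qed

text \<open>The resolvent of the initial value problem with zero data. Up to factorials, its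
  iterates applied to a solution are the derivatives of that solution in the spectral
  parameter.\<close>

definition Y :: "complex \<Rightarrow> (2 \<Rightarrow> real \<Rightarrow> complex) \<Rightarrow> 2 \<Rightarrow> real \<Rightarrow> complex"
  where "Y \<mu> f = (SOME y. sol \<mu> f y \<and> (\<forall>i. y i 0 = 0))"

lemma sol_Y: "(\<And>i. square_integrable (f i)) \<Longrightarrow> sol \<mu> f (Y \<mu> f)"
  and Y_0: "(\<And>i. square_integrable (f i)) \<Longrightarrow> Y \<mu> f i 0 = 0"
proof -
  assume f: "\<And>i. square_integrable (f i)"
  have "\<exists>y. sol \<mu> f y \<and> (\<forall>i. y i 0 = 0)" by (rule sol_exists[OF f])
  then have "sol \<mu> f (Y \<mu> f) \<and> (\<forall>i. Y \<mu> f i 0 = 0)" unfolding Y_def by (rule someI_ex)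
  then show "sol \<mu> f (Y \<mu> f)" "Y \<mu> f i 0 = 0" by blast+
qed

lemma Y_lin:
  assumes f: "\<And>i. square_integrable (f i)" and g: "\<And>i. square_integrable (g i)"
    and h: "\<And>i. square_integrable (h i)"
    and eq: "\<And>i. AE t in unit_lebesgue. h i t = f i t + c * g i t" and x: "x \<in> {0..1}"
  shows "Y \<mu> h i x = Y \<mu> f i x + c * Y \<mu> g i x"
proof -
  have "sol \<mu> (\<lambda>i t. f i t + c * g i t) (\<lambda>i t. Y \<mu> f i t + c * Y \<mu> g i t)"
    using sol_lin[where f = f and g = g and c = c, OF f g sol_Y[OF f] sol_Y[OF g]] .
  then have s: "sol \<mu> h (\<lambda>i t. Y \<mu> f i t + c * Y \<mu> g i t)"
    by (rule sol_cong_AE[rotated]) (use eq in \<open>simp add: eq_commute\<close>)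
  show ?thesis
    by (rule sol_unique[where f = h, OF h sol_Y[OF h] s _ x]) (simp add: Y_0 f g h)
qed

lemma continuous_Y_pow:
  assumes "\<And>i. continuous_on {0..1} (u i)"
  shows "continuous_on {0..1} ((Y \<mu> ^^ n) u i)"
proof (induction n arbitrary: i)
  case 0 then show ?case by (simp add: assms)
next
  case (Suc n)
  then have "sol \<mu> ((Y \<mu> ^^ n) u) (Y \<mu> ((Y \<mu> ^^ n) u))"
    by (intro sol_Y square_integrable_continuous)
  then show ?case unfolding funpow.simps o_apply by (rule sol_continuous)
qed

lemma Y_pow_lin:
  assumes u: "\<And>i. continuous_on {0..1} (u i)" and v: "\<And>i. continuous_on {0..1} (v i)"
    and w: "\<And>i. continuous_on {0..1} (w i)"
    and eq: "\<And>i x. x \<in> {0..1} \<Longrightarrow> u i x = v i x + c * w i x" and x: "x \<in> {0..1}"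
  shows "(Y \<mu> ^^ n) u i x = (Y \<mu> ^^ n) v i x + c * (Y \<mu> ^^ n) w i x"
  using x
proof (induction n arbitrary: i x)
  case 0 then show ?case by (simp add: eq)
next
  case (Suc n)
  show ?case unfolding funpow.simps o_apply
  proof (rule Y_lin[OF _ _ _ _ Suc.prems])
    show "AE t in unit_lebesgue. (Y \<mu> ^^ n) u i t = (Y \<mu> ^^ n) v i t + c * (Y \<mu> ^^ n) w i t" for i
      by (rule AE_I2) (use Suc.IH in simp)
  qed (intro square_integrable_continuous continuous_Y_pow u v w)+
qed

text \<open>Integrating the source against exp (\<gamma> t) gains 1 / \<gamma>. Since \<gamma> may
  be taken as large as desired, \<open>Y \<mu>\<close> is quasinilpotent, which is why its power
  series converge everywhere.\<close>

lemma Y_continuous_bound: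
  assumes u: "\<And>i. continuous_on {0..1} (u i)"
    and \<gamma>: "\<gamma> \<ge> \<kappa> * (1 + norm \<mu>)"
    and M: "\<And>i t. t \<in> {0..1} \<Longrightarrow> norm (u i t) \<le> M * exp (\<gamma> * t)"
    and x: "x \<in> {0..1}"
  shows "norm (Y \<mu> u i x) \<le> 2 * \<beta> / \<gamma> * M * exp (\<gamma> * x)"
proof -
  have s: "\<And>i. square_integrable (u i)" by (rule square_integrable_continuous[OF u])
  have "\<kappa> * 1 \<le> \<kappa> * (1 + norm \<mu>)" using \<kappa>_ge1 by (intro mult_left_mono) auto
  then have \<gamma>1: "\<gamma> \<ge> 1" using \<gamma> \<kappa>_ge1 by linarith
  have M0: "M \<ge> 0" using order_trans[OF norm_ge_zero M[of 0 1]] by simp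
  have "norm (Y \<mu> u i x) \<le> 2 * (\<beta> * M / \<gamma>) * exp (\<gamma> * x)"
  proof (rule sol_bound[OF s sol_Y[OF s] \<gamma> _ x])
    fix i :: 2 and x :: real assume x: "x \<in> {0..1}"
    have sub: "{0..x} \<subseteq> {0..1}" using x by auto
    have e: "((\<lambda>t. exp (\<gamma> * (t - 0))) has_integral (exp (\<gamma> * (x - 0)) - exp (\<gamma> * (0 - 0))) / \<gamma>) {0..x}"
      by (rule integral_exp_scaled) (use \<gamma>1 x in auto)
    have "norm (integral {0..x} (\<lambda>t. \<i> * b i * u i t)) \<le> integral {0..x} (\<lambda>t. \<beta> * M * exp (\<gamma> * (t - 0)))"
    proof (rule integral_norm_bound_integral)
      show "(\<lambda>t. \<i> * b i * u i t) integrable_on {0..x}"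
        by (intro integrable_on_mult_right square_integrable_integrable_on s sub)
      show "(\<lambda>t. \<beta> * M * exp (\<gamma> * (t - 0))) integrable_on {0..x}"
        by (intro integrable_on_mult_right has_integral_integrable[OF e])
      fix t assume "t \<in> {0..x}"
      then have "norm (b i) * norm (u i t) \<le> \<beta> * (M * exp (\<gamma> * t))"
        using sub by (intro mult_mono norm_b_le M \<beta>_nonneg) auto
      then show "norm (\<i> * b i * u i t) \<le> \<beta> * M * exp (\<gamma> * (t - 0))"
        by (simp add: norm_mult mult.assoc)
    qed
    also have "\<dots> = \<beta> * M * ((exp (\<gamma> * (x - 0)) - exp (\<gamma> * (0 - 0))) / \<gamma>)"
      by (rule integral_unique) (intro has_integral_mult_right e)
    also have "\<dots> \<le> \<beta> * M * (exp (\<gamma> * x) / \<gamma>)"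
      using \<gamma>1 M0 \<beta>_nonneg by (intro mult_left_mono divide_right_mono) auto
    finally show "norm (Y \<mu> u i 0 + integral {0..x} (\<lambda>t. \<i> * b i * u i t)) \<le> \<beta> * M / \<gamma> * exp (\<gamma> * x)"
      by (simp add: Y_0 s)
  qed
  then show ?thesis by simp
qed

lemma Y_pow_bound:
  assumes u: "\<And>i. continuous_on {0..1} (u i)"
    and \<gamma>: "\<gamma> \<ge> \<kappa> * (1 + norm \<mu>)"
    and M: "\<And>i t. t \<in> {0..1} \<Longrightarrow> norm (u i t) \<le> M * exp (\<gamma> * t)"
    and x: "x \<in> {0..1}"
  shows "norm ((Y \<mu> ^^ n) u i x) \<le> (2 * \<beta> / \<gamma>) ^ n * M * exp (\<gamma> * x)"
  using x
proof (induction n arbitrary: i x)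
  case 0 then show ?case by (simp add: M)
next
  case (Suc n)
  have "norm (Y \<mu> ((Y \<mu> ^^ n) u) i x) \<le> 2 * \<beta> / \<gamma> * ((2 * \<beta> / \<gamma>) ^ n * M) * exp (\<gamma> * x)"
    by (rule Y_continuous_bound[OF continuous_Y_pow[OF u] \<gamma> Suc.IH Suc.prems])
  then show ?case by (simp only: funpow.simps o_apply power_Suc mult.assoc)
qed

text \<open>Taylor expansion in the spectral parameter, obtained by iterating the resolvent identity.\<close>

lemma sol_expansion:
  assumes f: "\<And>i. square_integrable (f i)"
    and y: "sol \<mu> f y" and z: "sol \<nu> f z" and 0: "\<And>i. z i 0 = y i 0" and x: "x \<in> {0..1}"
  shows "z i x = (\<Sum>n<N. (\<nu> - \<mu>) ^ n * (Y \<mu> ^^ n) y i x) + (\<nu> - \<mu>) ^ N * (Y \<mu> ^^ N) z i x"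
  using x
proof (induction N arbitrary: i x)
  case 0 then show ?case by simp
next
  case (Suc N)
  have yc: "\<And>i. continuous_on {0..1} (y i)" and zc: "\<And>i. continuous_on {0..1} (z i)"
    by (rule sol_continuous[OF y], rule sol_continuous[OF z])
  have zs: "\<And>i. square_integrable (z i)" by (rule square_integrable_continuous[OF zc])
  have s1: "sol \<mu> (\<lambda>i t. f i t + (\<nu> - \<mu>) * z i t) z" by (rule sol_shift[OF z])
  have s2: "sol \<mu> (\<lambda>i t. f i t + (\<nu> - \<mu>) * z i t) (\<lambda>i t. y i t + (\<nu> - \<mu>) * Y \<mu> z i t)"
    using sol_lin[where f = f and g = z and c = "\<nu> - \<mu>", OF f zs y sol_Y[OF zs]] .
  have sf: "square_integrable (\<lambda>t. f i t + (\<nu> - \<mu>) * z i t)" for i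
    by (intro square_integrable_add square_integrable_cmult f zs)
  have zy: "z i x = y i x + (\<nu> - \<mu>) * Y \<mu> z i x" if "x \<in> {0..1}" for i x
    by (rule sol_unique[where f = "\<lambda>i t. f i t + (\<nu> - \<mu>) * z i t", OF sf s1 s2 _ that])
      (simp add: 0 Y_0 zs)
  have "(Y \<mu> ^^ N) z i x = (Y \<mu> ^^ N) y i x + (\<nu> - \<mu>) * (Y \<mu> ^^ N) (Y \<mu> z) i x"
    by (rule Y_pow_lin[OF zc yc sol_continuous[OF sol_Y[OF zs]] zy Suc.prems])
  also have "(Y \<mu> ^^ N) (Y \<mu> z) = (Y \<mu> ^^ Suc N) z" by (simp only: funpow_Suc_right o_apply)
  finally have "(\<nu> - \<mu>) ^ N * (Y \<mu> ^^ N) z i x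
      = (\<nu> - \<mu>) ^ N * ((Y \<mu> ^^ N) y i x + (\<nu> - \<mu>) * (Y \<mu> ^^ Suc N) z i x)" by (simp only:)
  then show ?case using Suc.IH[OF Suc.prems, of i]
    by (simp only: sum.lessThan_Suc power_Suc distrib_left mult_ac add_ac)
qed

text \<open>The weight \<gamma> is enlarged in proportion to |\<nu> - \<mu>|, so that |\<nu> -
  \<mu>| times the bound 2 \<beta> / \<gamma> for \<open>Y \<mu>\<close> is at most 1/2. The
  remainder of the expansion then tends to 0 at any distance from \<mu>.\<close>

lemma sol_sums:
  assumes f: "\<And>i. square_integrable (f i)"
    and y: "sol \<mu> f y" and z: "sol \<nu> f z" and 0: "\<And>i. z i 0 = y i 0" and x: "x \<in> {0..1}"
  shows "(\<lambda>n. (Y \<mu> ^^ n) y i x * (\<nu> - \<mu>) ^ n) sums z i x"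
proof -
  have zc: "\<And>i. continuous_on {0..1} (z i)" by (rule sol_continuous[OF z])
  obtain M where M: "M \<ge> 0" "\<And>i t. t \<in> {0..1} \<Longrightarrow> norm (z i t) \<le> M"
    using bounded_if_continuous[of z, OF zc] by metis
  define \<gamma> where "\<gamma> = \<kappa> * (1 + norm \<mu>) + 4 * \<beta> * norm (\<nu> - \<mu>)"
  have \<gamma>: "\<gamma> \<ge> \<kappa> * (1 + norm \<mu>)" using \<beta>_nonneg by (simp add: \<gamma>_def)
  have "\<kappa> * 1 \<le> \<kappa> * (1 + norm \<mu>)" using \<kappa>_ge1 by (intro mult_left_mono) auto
  then have "\<kappa> * (1 + norm \<mu>) \<ge> 1" using \<kappa>_ge1 by linarith
  then have \<gamma>1: "\<gamma> \<ge> 1" "4 * \<beta> * norm (\<nu> - \<mu>) \<le> \<gamma>"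
    using \<gamma> by (linarith, simp add: \<gamma>_def)
  have le: "norm (\<nu> - \<mu>) * (2 * \<beta> / \<gamma>) \<le> 1 / 2" using \<gamma>1 by (simp add: field_simps)
  have Me: "norm (z i t) \<le> M * exp (\<gamma> * t)" if "t \<in> {0..1}" for i t
  proof -
    have "M * 1 \<le> M * exp (\<gamma> * t)" using M(1) \<gamma>1 that by (intro mult_left_mono) auto
    then show ?thesis using M(2)[OF that, of i] by linarith
  qed
  have rem: "norm ((\<nu> - \<mu>) ^ N * (Y \<mu> ^^ N) z i x) \<le> (1 / 2) ^ N * (M * exp (\<gamma> * x))" for N
  proof -
    have "norm ((\<nu> - \<mu>) ^ N * (Y \<mu> ^^ N) z i x) \<le> norm (\<nu> - \<mu>) ^ N * ((2 * \<beta> / \<gamma>) ^ N * M * exp (\<gamma> * x))"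
      unfolding norm_mult norm_power by (intro mult_left_mono Y_pow_bound[OF zc \<gamma> Me x]) auto
    also have "\<dots> = (norm (\<nu> - \<mu>) * (2 * \<beta> / \<gamma>)) ^ N * (M * exp (\<gamma> * x))"
      by (simp only: power_mult_distrib mult_ac)
    also have "\<dots> \<le> (1 / 2) ^ N * (M * exp (\<gamma> * x))"
      using le \<beta>_nonneg \<gamma>1 M by (intro mult_right_mono power_mono) auto
    finally show ?thesis .
  qed
  have "(\<lambda>N. (1 / 2) ^ N * (M * exp (\<gamma> * x))) \<longlonglongrightarrow> 0"
    by (intro tendsto_mult_left_zero LIMSEQ_power_zero) auto
  then have "(\<lambda>N. (\<nu> - \<mu>) ^ N * (Y \<mu> ^^ N) z i x) \<longlonglongrightarrow> 0"
    by (rule Lim_null_comparison[OF always_eventually[OF allI[OF rem]]])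
  then have "(\<lambda>N. z i x - (\<nu> - \<mu>) ^ N * (Y \<mu> ^^ N) z i x) \<longlonglongrightarrow> z i x - 0"
    by (intro tendsto_intros)
  moreover have "z i x - (\<nu> - \<mu>) ^ N * (Y \<mu> ^^ N) z i x = (\<Sum>n<N. (Y \<mu> ^^ n) y i x * (\<nu> - \<mu>) ^ n)" for N
    using sol_expansion[OF f y z 0 x, of i N] by (simp add: mult.commute)
  ultimately show ?thesis by (simp add: sums_def)
qed

lemma sol_holomorphic:
  assumes f: "\<And>i. square_integrable (f i)"
    and y: "\<And>\<nu>. sol \<nu> f (y \<nu>)" and 0: "\<And>\<nu> i. y \<nu> i 0 = \<eta> i" and x: "x \<in> {0..1}"
  shows "(\<lambda>\<nu>. y \<nu> i x) holomorphic_on UNIV"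
proof -
  have "(\<lambda>\<nu>. y \<nu> i x) holomorphic_on ball 0 r" for r
  proof (rule power_series_holomorphic)
    fix \<nu> assume "\<nu> \<in> ball (0::complex) r"
    show "(\<lambda>n. (Y 0 ^^ n) (y 0) i x * (\<nu> - 0) ^ n) sums y \<nu> i x"
      by (rule sol_sums[OF f y y _ x]) (simp add: 0)
  qed
  then have "(\<lambda>\<nu>. y \<nu> i x) holomorphic_on ball 0 (norm \<nu> + 1)" for \<nu> by blast
  then have "(\<lambda>\<nu>. y \<nu> i x) field_differentiable at \<nu>" for \<nu>
    using holomorphic_on_imp_differentiable_at[of "\<lambda>\<nu>. y \<nu> i x" "ball 0 (norm \<nu> + 1)" \<nu>] by auto
  then show ?thesis by (simp add: holomorphic_on_def)
qed

text \<open>The admissible weight \<kappa> (1 + |\<nu>|) is affine in |\<nu>|, and the exponential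
  of it bounds the solution.\<close>

lemma sol_exponential_type:
  assumes f: "\<And>i. square_integrable (f i)"
    and y: "\<And>\<nu>. sol \<nu> f (y \<nu>)" and 0: "\<And>\<nu> i. y \<nu> i 0 = \<eta> i"
  shows "\<exists>A>0. \<forall>\<nu> i. \<forall>x\<in>{0..1}. norm (y \<nu> i x) \<le> A * exp (A * norm \<nu>)"
proof -
  define v where "v i x = \<eta> i + integral {0..x} (\<lambda>t. \<i> * b i * f i t)" for i x
  have "continuous_on {0..1} (v i)" for i unfolding v_def
    by (intro continuous_intros indefinite_integral_continuous_1 integrable_on_mult_right
        square_integrable_integrable_on f order_refl)
  then obtain m where m: "m \<ge> 0" "\<And>i x. x \<in> {0..1} \<Longrightarrow> norm (v i x) \<le> m"
    using bounded_if_continuous[of v] by metis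
  define A where "A = 2 * m * exp \<kappa> + \<kappa>"
  have A: "A \<ge> \<kappa>" "A \<ge> 2 * m * exp \<kappa>" "A > 0" using m \<kappa>_ge1 by (auto simp: A_def add_nonneg_pos)
  have "norm (y \<nu> i x) \<le> A * exp (A * norm \<nu>)" if x: "x \<in> {0..1}" for \<nu> i x
  proof -
    let ?g = "\<kappa> * (1 + norm \<nu>)"
    have g0: "?g \<ge> 0" using \<kappa>_ge1 by auto
    have "norm (y \<nu> i x) \<le> 2 * m * exp (?g * x)"
    proof (rule sol_bound[OF f y order_refl _ x])
      fix i :: 2 and x :: real assume x: "x \<in> {0..1}"
      have "m * 1 \<le> m * exp (?g * x)" using m g0 x by (intro mult_left_mono) auto
      then show "norm (y \<nu> i 0 + integral {0..x} (\<lambda>t. \<i> * b i * f i t)) \<le> m * exp (?g * x)"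
        using m(2)[OF x, of i] by (simp add: v_def 0)
    qed
    also have "\<dots> \<le> 2 * m * exp ?g"
      using m g0 x mult_left_mono[of x 1 ?g] by (intro mult_left_mono) auto
    also have "\<dots> = 2 * m * exp \<kappa> * exp (\<kappa> * norm \<nu>)" by (simp add: distrib_left exp_add)
    also have "\<dots> \<le> A * exp (A * norm \<nu>)"
      using A \<kappa>_ge1 m by (intro mult_mono) (auto intro: mult_right_mono)
    finally show ?thesis .
  qed
  then show ?thesis using A(3) by blast
qed

text \<open>The source enters the equation under an integral, so its L1 norm suffices. This makes
  boundary values of \<open>Y\<close> bounded functionals on L2.\<close>

lemma Y_L1_bound:
  "\<exists>C\<ge>0. \<forall>f i. \<forall>x\<in>{0..1}. (\<forall>i. square_integrable (f i)) \<longrightarrow>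
    norm ((Y \<mu> ^^ Suc n) f i x) \<le> C * (\<Sum>j\<in>UNIV. integral {0..1} (\<lambda>t. norm (f j t)))"
proof -
  let ?g = "\<kappa> * (1 + norm \<mu>)"
  define C where "C = (2 * \<beta> / ?g) ^ n * (2 * \<beta>) * exp ?g"
  have g0: "?g > 0" using \<kappa>_ge1 by (auto intro!: mult_pos_pos add_pos_nonneg)
  have "norm ((Y \<mu> ^^ Suc n) f i x) \<le> C * (\<Sum>j\<in>UNIV. integral {0..1} (\<lambda>t. norm (f j t)))"
    if x: "x \<in> {0..1}" and f: "\<And>i. square_integrable (f i)" for f i x
  proof -
    let ?S = "\<Sum>j\<in>(UNIV::2 set). integral {0..1} (\<lambda>t. norm (f j t))"
    have int: "(\<lambda>t. norm (f j t)) integrable_on {0..1}" for j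
      by (rule square_integrable_integrable_on(2)[OF f order_refl])
    have pos: "integral {0..1} (\<lambda>t. norm (f j t)) \<ge> 0" for j
      by (rule integral_nonneg[OF int]) auto
    have le: "integral {0..1} (\<lambda>t. norm (f j t)) \<le> ?S" for j
      by (rule member_le_sum) (auto intro: pos)
    have S0: "?S \<ge> 0" by (intro sum_nonneg pos)
    have "norm (Y \<mu> f i x) \<le> 2 * (\<beta> * ?S) * exp (?g * x)" if x: "x \<in> {0..1}" for i x
    proof (rule sol_bound[OF f sol_Y[OF f] order_refl _ x])
      fix i :: 2 and x :: real assume x: "x \<in> {0..1}"
      have sub: "{0..x} \<subseteq> {0..1}" using x by auto
      have "norm (integral {0..x} (\<lambda>t. \<i> * b i * f i t)) \<le> integral {0..x} (\<lambda>t. \<beta> * norm (f i t))"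
      proof (rule integral_norm_bound_integral)
        show "(\<lambda>t. \<i> * b i * f i t) integrable_on {0..x}"
          by (intro integrable_on_mult_right square_integrable_integrable_on f sub)
        show "(\<lambda>t. \<beta> * norm (f i t)) integrable_on {0..x}"
          by (intro integrable_on_mult_right square_integrable_integrable_on(2) f sub)
        show "norm (\<i> * b i * f i t) \<le> \<beta> * norm (f i t)" for t
          by (simp add: norm_mult mult_right_mono norm_b_le)
      qed
      also have "\<dots> = \<beta> * integral {0..x} (\<lambda>t. norm (f i t))" by (rule integral_mult_right)
      also have "\<dots> \<le> \<beta> * integral {0..1} (\<lambda>t. norm (f i t))"
        by (intro mult_left_mono integral_subset_le sub int square_integrable_integrable_on(2) f \<beta>_nonneg) auto
      also have "\<dots> \<le> \<beta> * ?S" by (intro mult_left_mono le \<beta>_nonneg)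
      also have "\<dots> * 1 \<le> \<beta> * ?S * exp (?g * x)"
        using g0 x by (intro mult_left_mono mult_nonneg_nonneg \<beta>_nonneg S0) auto
      finally show "norm (Y \<mu> f i 0 + integral {0..x} (\<lambda>t. \<i> * b i * f i t)) \<le> \<beta> * ?S * exp (?g * x)"
        by (simp add: Y_0 f)
    qed
    then have Yb: "norm (Y \<mu> f i x) \<le> 2 * \<beta> * ?S * exp (?g * x)" if x: "x \<in> {0..1}" for i x
      using that by (simp only: mult.assoc)
    have "norm ((Y \<mu> ^^ n) (Y \<mu> f) i x) \<le> (2 * \<beta> / ?g) ^ n * (2 * \<beta> * ?S) * exp (?g * x)"
      by (rule Y_pow_bound[OF sol_continuous[OF sol_Y[OF f]] order_refl Yb x])
    also have "\<dots> \<le> (2 * \<beta> / ?g) ^ n * (2 * \<beta> * ?S) * exp ?g"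
      using g0 x mult_left_mono[of x 1 ?g] S0 \<beta>_nonneg by (intro mult_left_mono) auto
    also have "\<dots> = C * ?S" by (simp only: C_def mult_ac)
    finally show ?thesis by (simp only: funpow_Suc_right o_apply)
  qed
  moreover have "C \<ge> 0" using g0 \<beta>_nonneg by (simp add: C_def)
  ultimately show ?thesis by blast
qed

subsection \<open>Asymptotics along rays\<close>

text \<open>Variation of constants in one component: the diagonal term is absorbed into the
  exponential, and only the source and the other component remain under the integral.\<close>

lemma sol_integrating_factor:
  assumes f: "\<And>i. square_integrable (f i)" and y: "sol \<mu> f y" and x: "x \<in> {0..1}"
  shows "exp (- (\<i> * b i * \<mu>) * x) * y i x = y i 0 +
    integral {0..x} (\<lambda>t. exp (- (\<i> * b i * \<mu>) * t) * (\<i> * b i * (f i t - q i t * y (i + 1) t)))"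
proof -
  define c where "c = - (\<i> * b i * \<mu>)"
  have "square_integrable (rhs \<mu> f y i)"
    by (rule square_integrable_rhs[OF f sol_continuous[OF y]])
  then have p: "rhs \<mu> f y i absolutely_integrable_on {0..1}"
    by (rule square_integrable_imp_absolutely_integrable)
  have r: "(\<lambda>t::real. c * exp (c * t)) absolutely_integrable_on {0..1}"
    by (intro absolutely_integrable_continuous_real continuous_intros)
  have R: "exp (c * of_real x) = exp (c * of_real 0) + integral {0..x} (\<lambda>t::real. c * exp (c * t))"
    if "x \<in> {0..1}" for x :: real
  proof -
    have h: "((\<lambda>t::real. c * exp (c * t)) has_integral (exp (c * of_real x) - exp (c * of_real 0))) {0..x}"
    proof (rule fundamental_theorem_of_calculus)
      show "((\<lambda>t. exp (c * of_real t)) has_vector_derivative c * exp (c * of_real t)) (at t within {0..x})" for t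
        by (rule has_vector_derivative_real_field[THEN has_vector_derivative_at_within])
          (auto intro!: derivative_eq_intros)
    qed (use that in auto)
    show ?thesis unfolding integral_unique[OF h] by simp
  qed
  have "y i x * exp (c * of_real x) = y i 0 * exp (c * of_real 0) +
      integral {0..x} (\<lambda>t. rhs \<mu> f y i t * exp (c * of_real t) + y i t * (c * exp (c * of_real t)))"
    by (rule absolutely_continuous_product[OF p r sol_eq[OF y] R x])
  also have "(\<lambda>t. rhs \<mu> f y i t * exp (c * of_real t) + y i t * (c * exp (c * of_real t)))
      = (\<lambda>t. exp (c * of_real t) * (\<i> * b i * (f i t - q i t * y (i + 1) t)))"
    by (simp add: rhs_def c_def fun_eq_iff algebra_simps)
  finally show ?thesis by (simp add: c_def mult.commute)
qed

text \<open>The numerator that \<open>integral_exp_norm_le\<close> yields for a component of the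
  source, as \<open>qc\<close> does for the potential.\<close>

definition fc :: "(2 \<Rightarrow> real \<Rightarrow> complex) \<Rightarrow> 2 \<Rightarrow> real"
  where "fc f i = 1 + integral {0..1} (\<lambda>t. (norm (f i t))\<^sup>2)"

lemma fc_ge1: "(\<And>i. square_integrable (f i)) \<Longrightarrow> fc f i \<ge> 1"
proof -
  assume f: "\<And>i. square_integrable (f i)"
  have "integral {0..1} (\<lambda>t. (norm (f i t))\<^sup>2) \<ge> 0"
    using square_integrable_imp_absolutely_integrable(2)[OF f, of i]
    by (intro integral_nonneg) (auto simp: absolutely_integrable_on_def)
  then show ?thesis by (simp add: fc_def)
qed

lemma integral_source_bound:
  assumes f: "\<And>i. square_integrable (f i)" and y: "\<And>i. continuous_on {0..1} (y i)"
    and \<delta>: "\<bar>\<delta>\<bar> > 0" and s: "0 \<le> s" "s \<le> x" "x \<le> 1"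
    and c: "\<delta> > 0 \<Longrightarrow> c = x" "\<delta> < 0 \<Longrightarrow> c = s"
    and M: "M \<ge> 0"
    and le: "\<And>t. t \<in> {s..x} \<Longrightarrow> norm (g t) \<le> K * (exp (\<delta> * (t - c)) * (\<beta> * (norm (f i t) + M * norm (q i t))))"
    and g: "g integrable_on {s..x}" and K: "K \<ge> 0"
  shows "norm (integral {s..x} (g :: real \<Rightarrow> complex)) \<le> K * (\<beta> * (fc f i + M * qc) / sqrt \<bar>\<delta>\<bar>)"
proof -
  have sub: "{s..x} \<subseteq> {0..1}" using s by auto
  have i1: "(\<lambda>t. exp (\<delta> * (t - c)) * norm (f i t)) integrable_on {s..x}"
    and i2: "(\<lambda>t. exp (\<delta> * (t - c)) * norm (q i t)) integrable_on {s..x}"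
    by (intro integrable_exp_norm f sq sub)+
  have "norm (integral {s..x} g) \<le> integral {s..x}
      (\<lambda>t. K * \<beta> * (exp (\<delta> * (t - c)) * norm (f i t) + M * (exp (\<delta> * (t - c)) * norm (q i t))))"
  proof (rule integral_norm_bound_integral[OF g])
    show "(\<lambda>t. K * \<beta> * (exp (\<delta> * (t - c)) * norm (f i t) + M * (exp (\<delta> * (t - c)) * norm (q i t)))) integrable_on {s..x}"
      by (intro integrable_on_mult_right integrable_add i1 i2)
    show "norm (g t) \<le> K * \<beta> * (exp (\<delta> * (t - c)) * norm (f i t) + M * (exp (\<delta> * (t - c)) * norm (q i t)))"
      if "t \<in> {s..x}" for t
      using le[OF that] by (simp only: distrib_left mult_ac)
  qed
  also have "\<dots> = K * \<beta> * (integral {s..x} (\<lambda>t. exp (\<delta> * (t - c)) * norm (f i t))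
      + M * integral {s..x} (\<lambda>t. exp (\<delta> * (t - c)) * norm (q i t)))"
    using Henstock_Kurzweil_Integration.integral_add[OF i1 integrable_on_mult_right[OF i2, of M]] by simp
  also have "\<dots> \<le> K * \<beta> * (fc f i / sqrt \<bar>\<delta>\<bar> + M * (qc / sqrt \<bar>\<delta>\<bar>))"
    unfolding fc_def
    by (intro mult_left_mono add_mono integral_exp_norm_le integral_exp_q_le f \<delta> s c M mult_nonneg_nonneg K \<beta>_nonneg)
  also have "\<dots> = K * (\<beta> * (fc f i + M * qc) / sqrt \<bar>\<delta>\<bar>)"
    by (simp add: add_divide_distrib algebra_simps)
  finally show ?thesis .
qed

lemma integrable_source:
  assumes f: "\<And>i. square_integrable (f i)" and y: "\<And>i. continuous_on {0..1} (y i)"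
    and ab: "{s..x} \<subseteq> {0..1}"
  shows "(\<lambda>t. exp (c * complex_of_real t) * (\<i> * b i * (f i t - q i t * y (i + 1) t))) integrable_on {s..x}"
proof -
  have "square_integrable (\<lambda>t. f i t + - 1 * (q i t * y (i + 1) t))"
    by (intro square_integrable_add square_integrable_cmult square_integrable_mult_continuous f sq y)
  then have "square_integrable (\<lambda>t. (\<i> * b i * (f i t + - 1 * (q i t * y (i + 1) t))) * exp (c * complex_of_real t))"
    by (intro square_integrable_mult_continuous square_integrable_cmult continuous_intros)
  then have "square_integrable (\<lambda>t. exp (c * complex_of_real t) * (\<i> * b i * (f i t - q i t * y (i + 1) t)))"
    by (simp add: mult.commute)
  then show ?thesis by (rule square_integrable_integrable_on(1)[OF _ ab])
qed

lemma norm_source_le: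
  assumes "norm (y (i + 1) t) \<le> M"
  shows "norm (exp (c * complex_of_real t) * (\<i> * b i * (f i t - q i t * y (i + 1) t)))
    \<le> exp (Re c * t) * (\<beta> * (norm (f i t) + M * norm (q i t)))"
proof -
  have "norm (f i t - q i t * y (i + 1) t) \<le> norm (f i t) + norm (q i t) * norm (y (i + 1) t)"
    using norm_triangle_ineq4[of "f i t" "q i t * y (i + 1) t"] by (simp only: norm_mult)
  also have "\<dots> \<le> norm (f i t) + norm (q i t) * M" by (intro add_left_mono mult_left_mono assms) auto
  finally have "norm (b i) * norm (f i t - q i t * y (i + 1) t) \<le> \<beta> * (norm (f i t) + M * norm (q i t))"
    by (intro mult_mono norm_b_le \<beta>_nonneg) (auto simp: mult.commute)
  then have "exp (Re c * t) * (norm (b i) * norm (f i t - q i t * y (i + 1) t))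
      \<le> exp (Re c * t) * (\<beta> * (norm (f i t) + M * norm (q i t)))" by (intro mult_left_mono) auto
  then show ?thesis by (simp add: norm_mult)
qed

text \<open>Integration from the left end. The other component grows at a rate \<alpha> larger than
  \<rho>, so after division by exp (\<rho> t) the weight has rate \<alpha> - \<rho> > 0, which
  yields the gain 1 / sqrt (\<alpha> - \<rho>).\<close>

lemma sol_forward_bound:
  assumes f: "\<And>i. square_integrable (f i)" and y: "sol \<mu> f y"
    and \<rho>: "\<rho> = Re (\<i> * b i * \<mu>)" "\<rho> < \<alpha>" and \<alpha>: "\<alpha> \<ge> 0" and M: "M \<ge> 0"
    and le: "\<And>t. t \<in> {0..1} \<Longrightarrow> norm (y (i + 1) t) \<le> M * exp (\<alpha> * t)"
    and x: "x \<in> {0..1}"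
  shows "norm (y i x) \<le> norm (y i 0) * exp (\<rho> * x) + \<beta> * (fc f i + M * qc) / sqrt (\<alpha> - \<rho>) * exp (\<alpha> * x)"
proof -
  have sub: "{0..x} \<subseteq> {0..1}" using x by auto
  define c where "c = - (\<i> * b i * \<mu>)"
  have Rec: "Re c = - \<rho>" by (simp add: c_def \<rho>)
  define g where "g t = exp (c * complex_of_real t) * (\<i> * b i * (f i t - q i t * y (i + 1) t))" for t
  have "norm (integral {0..x} g) \<le> exp ((\<alpha> - \<rho>) * x) * (\<beta> * (fc f i + M * qc) / sqrt \<bar>\<alpha> - \<rho>\<bar>)"
  proof (rule integral_source_bound[OF f sol_continuous[OF y], where c = x])
    show "g integrable_on {0..x}" unfolding g_def
      by (rule integrable_source[OF f sol_continuous[OF y] sub])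
    fix t assume "t \<in> {0..x}"
    then have t: "t \<in> {0..1}" using sub by auto
    have "norm (g t) \<le> exp (Re c * t) * (\<beta> * (norm (f i t) + M * exp (\<alpha> * t) * norm (q i t)))"
      unfolding g_def by (rule norm_source_le[where y = y and f = f and i = i, OF le[OF t]])
    \<comment> \<open>As \<alpha> is nonnegative, the source may be given the same growth factor as
      the other component.\<close>
    also have "\<dots> \<le> exp (Re c * t) * (\<beta> * (exp (\<alpha> * t) * norm (f i t) + M * exp (\<alpha> * t) * norm (q i t)))"
      using \<alpha> t mult_right_mono[of 1 "exp (\<alpha> * t)" "norm (f i t)"]
      by (intro mult_left_mono add_right_mono \<beta>_nonneg) auto
    also have "\<dots> = exp (Re c * t) * exp (\<alpha> * t) * (\<beta> * (norm (f i t) + M * norm (q i t)))"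
      by (simp only: distrib_left mult_ac)
    also have "exp (Re c * t) * exp (\<alpha> * t) = exp ((\<alpha> - \<rho>) * x) * exp ((\<alpha> - \<rho>) * (t - x))"
      by (simp add: Rec flip: exp_add) (simp add: algebra_simps)
    finally show "norm (g t) \<le> exp ((\<alpha> - \<rho>) * x) * (exp ((\<alpha> - \<rho>) * (t - x)) * (\<beta> * (norm (f i t) + M * norm (q i t))))"
      by (simp only: mult.assoc)
  qed (use x \<rho> M in auto)
  then have I: "norm (integral {0..x} g) \<le> exp ((\<alpha> - \<rho>) * x) * (\<beta> * (fc f i + M * qc) / sqrt (\<alpha> - \<rho>))"
    using \<rho> by simp
  have "exp (c * x) * y i x = y i 0 + integral {0..x} g"
    unfolding c_def g_def by (rule sol_integrating_factor[OF f y x])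
  then have "norm (exp (c * x)) * norm (y i x) \<le> norm (y i 0) + norm (integral {0..x} g)"
    by (metis norm_mult norm_triangle_ineq)
  then have "exp (- \<rho> * x) * norm (y i x) \<le> norm (y i 0) + exp ((\<alpha> - \<rho>) * x) * (\<beta> * (fc f i + M * qc) / sqrt (\<alpha> - \<rho>))"
    using I Rec by simp
  then have "exp (\<rho> * x) * (exp (- \<rho> * x) * norm (y i x))
    \<le> exp (\<rho> * x) * (norm (y i 0) + exp ((\<alpha> - \<rho>) * x) * (\<beta> * (fc f i + M * qc) / sqrt (\<alpha> - \<rho>)))"
    by (intro mult_left_mono) auto
  moreover have "exp (\<rho> * x) * exp (- \<rho> * x) = 1" "exp (\<rho> * x) * exp ((\<alpha> - \<rho>) * x) = exp (\<alpha> * x)"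
    by (simp_all add: algebra_simps flip: exp_add)
  ultimately show ?thesis by (simp only: distrib_left mult_ac) (simp only: mult.assoc[symmetric] mult_1_left)
qed

text \<open>For a positive rate forward integration would amplify errors, whereas integrating back
  from 1 damps them. The price is that the end value at 1 appears instead of the initial
  value.\<close>

lemma sol_backward_bound:
  assumes f: "\<And>i. square_integrable (f i)" and y: "sol \<mu> f y"
    and \<rho>: "\<rho> = Re (\<i> * b i * \<mu>)" "\<rho> > 0" and M: "M \<ge> 0"
    and le: "\<And>t. t \<in> {0..1} \<Longrightarrow> norm (y (i + 1) t) \<le> M"
    and x: "x \<in> {0..1}"
  shows "norm (y i x) \<le> norm (y i 1) + \<beta> * (fc f i + M * qc) / sqrt \<rho>"
proof -
  have sub: "{x..1} \<subseteq> {0..1}" using x by auto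
  define c where "c = - (\<i> * b i * \<mu>)"
  have Rec: "Re c = - \<rho>" by (simp add: c_def \<rho>)
  define g where "g t = exp (c * complex_of_real t) * (\<i> * b i * (f i t - q i t * y (i + 1) t))" for t
  have "norm (integral {x..1} g) \<le> exp (- \<rho> * x) * (\<beta> * (fc f i + M * qc) / sqrt \<bar>- \<rho>\<bar>)"
  proof (rule integral_source_bound[OF f sol_continuous[OF y], where c = x])
    show "g integrable_on {x..1}" unfolding g_def
      by (rule integrable_source[OF f sol_continuous[OF y] sub])
    fix t assume "t \<in> {x..1}"
    then have t: "t \<in> {0..1}" using sub by auto
    have "norm (g t) \<le> exp (Re c * t) * (\<beta> * (norm (f i t) + M * norm (q i t)))"
      unfolding g_def by (rule norm_source_le[where y = y and f = f and i = i, OF le[OF t]])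
    also have "exp (Re c * t) = exp (- \<rho> * x) * exp (- \<rho> * (t - x))"
      by (simp add: Rec flip: exp_add) (simp add: algebra_simps)
    finally show "norm (g t) \<le> exp (- \<rho> * x) * (exp (- \<rho> * (t - x)) * (\<beta> * (norm (f i t) + M * norm (q i t))))"
      by (simp only: mult.assoc)
  qed (use x \<rho> M in auto)
  then have I: "norm (integral {x..1} g) \<le> exp (- \<rho> * x) * (\<beta> * (fc f i + M * qc) / sqrt \<rho>)"
    using \<rho>(2) by simp
  have "exp (c * of_real x) * y i x = y i 0 + integral {0..x} g"
    unfolding c_def g_def by (rule sol_integrating_factor[OF f y x])
  moreover have "exp (c * of_real 1) * y i 1 = y i 0 + integral {0..1} g"
    unfolding c_def g_def by (rule sol_integrating_factor[OF f y]) simp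
  moreover have "integral {0..x} g + integral {x..1} g = integral {0..1} g"
    unfolding g_def
    by (intro Henstock_Kurzweil_Integration.integral_combine integrable_source f sol_continuous[OF y]) (use x in auto)
  ultimately have "exp (c * of_real x) * y i x = exp (c * of_real 1) * y i 1 - integral {x..1} g"
    by (simp add: algebra_simps)
  then have "norm (exp (c * of_real x)) * norm (y i x) \<le> norm (exp (c * of_real 1)) * norm (y i 1) + norm (integral {x..1} g)"
    by (metis norm_mult norm_triangle_ineq4)
  then have *: "exp (- \<rho> * x) * norm (y i x) \<le> exp (- \<rho>) * norm (y i 1) + exp (- \<rho> * x) * (\<beta> * (fc f i + M * qc) / sqrt \<rho>)"
    using I Rec by simp
  have "\<rho> * x \<le> \<rho> * 1" using \<rho> x by (intro mult_left_mono) auto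
  then have "exp (- \<rho>) * norm (y i 1) \<le> exp (- \<rho> * x) * norm (y i 1)" by (intro mult_right_mono) auto
  with * have "exp (- \<rho> * x) * norm (y i x) \<le> exp (- \<rho> * x) * (norm (y i 1) + \<beta> * (fc f i + M * qc) / sqrt \<rho>)"
    unfolding distrib_left by linarith
  then show ?thesis by (simp only: mult_le_cancel_left_pos exp_gt_zero)
qed

lemma integral_norm_q_le: "integral {0..1} (\<lambda>t. norm (q i t)) \<le> qc"
proof -
  have i2: "(\<lambda>x. (norm (q i x))\<^sup>2) integrable_on {0..1}"
    using square_integrable_imp_absolutely_integrable(2)[OF sq, of i]
    by (auto simp: absolutely_integrable_on_def)
  have "integral {0..1} (\<lambda>t. norm (q i t)) \<le> integral {0..1} (\<lambda>t. 1 + (norm (q i t))\<^sup>2)"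
  proof (rule integral_le)
    show "norm (q i t) \<le> 1 + (norm (q i t))\<^sup>2" for t
      using self_le_power[of "norm (q i t)" 2] zero_le_power2[of "norm (q i t)"]
      by (cases "norm (q i t) \<le> 1") (linarith, simp)
  qed (intro integrable_add integrable_const_ivl i2 square_integrable_integrable_on(2) sq order_refl)+
  also have "\<dots> = 1 + integral {0..1} (\<lambda>t. (norm (q i t))\<^sup>2)"
    using Henstock_Kurzweil_Integration.integral_add[OF integrable_const_ivl i2, of 1] by simp
  also have "\<dots> \<le> qc" by (rule qc_ge)
  finally show ?thesis .
qed

text \<open>Compared with the dominant exponential, the first part of the other component decays and
  contributes A / sqrt (\<rho> - \<rho>'). The second part grows equally fast and counts only
  through its coefficient K, which will be small.\<close>

lemma sol_dominant_bound:
  assumes y: "sol \<mu> (\<lambda>i t. 0) y"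
    and \<rho>: "\<rho> = Re (\<i> * b i * \<mu>)" "\<rho>' < \<rho>" and K: "K \<ge> 0"
    and le: "\<And>t. t \<in> {0..1} \<Longrightarrow> norm (y (i + 1) t) \<le> A * exp (\<rho>' * t) + K * exp (\<rho> * t)"
    and A: "A \<ge> 0" and x: "x \<in> {0..1}"
  shows "norm (exp (- (\<i> * b i * \<mu>) * x) * y i x - y i 0) \<le> \<beta> * qc * (A / sqrt (\<rho> - \<rho>') + K)"
proof -
  have sub: "{0..x} \<subseteq> {0..1}" using x by auto
  define c where "c = - (\<i> * b i * \<mu>)"
  have Rec: "Re c = - \<rho>" by (simp add: c_def \<rho>)
  define g where "g t = exp (c * complex_of_real t) * (\<i> * b i * (0 - q i t * y (i + 1) t))" for t
  have gi: "g integrable_on {0..x}" unfolding g_def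
    by (rule integrable_source[OF _ sol_continuous[OF y] sub]) (rule square_integrable_zero)
  have i1: "(\<lambda>t. exp ((\<rho>' - \<rho>) * (t - 0)) * norm (q i t)) integrable_on {0..1}"
    by (intro integrable_exp_norm sq order_refl)
  have i1x: "(\<lambda>t. exp ((\<rho>' - \<rho>) * (t - 0)) * norm (q i t)) integrable_on {0..x}"
    by (intro integrable_exp_norm sq sub)
  have i2: "(\<lambda>t. norm (q i t)) integrable_on {0..1}" "(\<lambda>t. norm (q i t)) integrable_on {0..x}"
    by (intro square_integrable_integrable_on(2) sq order_refl sub)+
  have "norm (integral {0..x} g) \<le> integral {0..x}
     (\<lambda>t. \<beta> * (A * (exp ((\<rho>' - \<rho>) * (t - 0)) * norm (q i t)) + K * norm (q i t)))"
  proof (rule integral_norm_bound_integral[OF gi])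
    show "(\<lambda>t. \<beta> * (A * (exp ((\<rho>' - \<rho>) * (t - 0)) * norm (q i t)) + K * norm (q i t))) integrable_on {0..x}"
      by (intro integrable_on_mult_right integrable_add i1x i2)
    fix t assume "t \<in> {0..x}"
    then have t: "t \<in> {0..1}" using sub by auto
    have "norm (g t) \<le> exp (Re c * t) * (\<beta> * (norm (0::complex) + (A * exp (\<rho>' * t) + K * exp (\<rho> * t)) * norm (q i t)))"
      unfolding g_def by (rule norm_source_le[where y = y and f = "\<lambda>i t. 0" and i = i, OF le[OF t]])
    also have "\<dots> = \<beta> * (A * (exp (Re c * t) * exp (\<rho>' * t) * norm (q i t)) + K * (exp (Re c * t) * exp (\<rho> * t)) * norm (q i t))"
      by (simp only: norm_zero add_0_left distrib_left distrib_right mult_ac)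
    also have "exp (Re c * t) * exp (\<rho>' * t) = exp ((\<rho>' - \<rho>) * (t - 0))"
      by (simp add: Rec flip: exp_add) (simp add: algebra_simps)
    also have "exp (Re c * t) * exp (\<rho> * t) = 1"
      by (simp add: Rec flip: exp_add)
    finally show "norm (g t) \<le> \<beta> * (A * (exp ((\<rho>' - \<rho>) * (t - 0)) * norm (q i t)) + K * norm (q i t))"
      by (simp only: mult_1_right)
  qed
  also have "\<dots> = \<beta> * (A * integral {0..x} (\<lambda>t. exp ((\<rho>' - \<rho>) * (t - 0)) * norm (q i t)) + K * integral {0..x} (\<lambda>t. norm (q i t)))"
    using Henstock_Kurzweil_Integration.integral_add[OF integrable_on_mult_right[OF i1x, of A] integrable_on_mult_right[OF i2(2), of K]] by simp
  also have "\<dots> \<le> \<beta> * (A * (qc / sqrt \<bar>\<rho>' - \<rho>\<bar>) + K * qc)"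
  proof (intro mult_left_mono add_mono \<beta>_nonneg A K)
    show "integral {0..x} (\<lambda>t. exp ((\<rho>' - \<rho>) * (t - 0)) * norm (q i t)) \<le> qc / sqrt \<bar>\<rho>' - \<rho>\<bar>"
      by (rule integral_exp_q_le) (use \<rho> x in auto)
    have "integral {0..x} (\<lambda>t. norm (q i t)) \<le> integral {0..1} (\<lambda>t. norm (q i t))"
      by (rule integral_subset_le[OF sub i2(2,1)]) auto
    then show "integral {0..x} (\<lambda>t. norm (q i t)) \<le> qc" using integral_norm_q_le[of i] by linarith
  qed
  also have "\<dots> = \<beta> * qc * (A / sqrt (\<rho> - \<rho>') + K)"
    using \<rho> by (simp add: algebra_simps)
  finally have "norm (integral {0..x} g) \<le> \<beta> * qc * (A / sqrt (\<rho> - \<rho>') + K)" .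
  moreover have "exp (- (\<i> * b i * \<mu>) * x) * y i x = y i 0 + integral {0..x} g"
    unfolding c_def g_def by (rule sol_integrating_factor[OF _ y x]) (rule square_integrable_zero)
  ultimately show ?thesis by simp
qed

end

section \<open>Reflection of the interval and Green's formula\<close>

lemma square_integrable_reflect:
  fixes f :: "real \<Rightarrow> complex"
  assumes "square_integrable f"
  shows "square_integrable (\<lambda>x. f (1 - x))"
proof -
  have ind: "indicator {0..1} (1 + - 1 * x) = (indicator {0..1} x :: real)" for x :: real
    by (auto simp: indicator_def)
  have "f \<in> borel_measurable unit_lebesgue" using assms by (simp add: square_integrable_def)
  then have "(\<lambda>x. indicator {0..1} x *\<^sub>R f x) \<in> borel_measurable lebesgue"
    by (subst (asm) borel_measurable_restrict_space_iff) auto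
  from borel_measurable_affine[OF this, of "- 1" 1]
  have "(\<lambda>x. indicator {0..1} (1 + - 1 * x) *\<^sub>R f (1 + - 1 * x)) \<in> borel_measurable lebesgue"
    unfolding real_scaleR_def by simp
  then have "(\<lambda>x. indicator {0..1} x *\<^sub>R f (1 - x)) \<in> borel_measurable lebesgue"
    unfolding ind by simp
  then have m: "(\<lambda>x. f (1 - x)) \<in> borel_measurable unit_lebesgue"
    by (subst borel_measurable_restrict_space_iff) auto
  have "integrable unit_lebesgue (\<lambda>x. (norm (f x))\<^sup>2)" using assms by (simp add: square_integrable_def)
  then have "integrable lebesgue (\<lambda>x. indicator {0..1} x *\<^sub>R (norm (f x))\<^sup>2)"
    by (subst (asm) integrable_restrict_space) auto
  from lebesgue_integrable_real_affine[OF this, of "- 1" 1]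
  have "integrable lebesgue (\<lambda>x. indicator {0..1} (1 + - 1 * x) *\<^sub>R (norm (f (1 + - 1 * x)))\<^sup>2)"
    by simp
  then have "integrable lebesgue (\<lambda>x. indicator {0..1} x *\<^sub>R (norm (f (1 - x)))\<^sup>2)"
    unfolding ind by simp
  then have "integrable unit_lebesgue (\<lambda>x. (norm (f (1 - x)))\<^sup>2)"
    by (subst integrable_restrict_space) auto
  with m show ?thesis by (simp add: square_integrable_def)
qed

lemma integral_reflect_Icc:
  fixes f :: "real \<Rightarrow> complex"
  assumes "f integrable_on {1 - x..1}"
  shows "integral {0..x} (\<lambda>t. f (1 - t)) = integral {1 - x..1} f"
proof -
  have "(f has_integral integral {1 - x..1} f) (cbox (1 - x) 1)"
    using assms by (simp add: integrable_integral)
  from has_integral_affinity[OF this, of "- 1" 1]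
  have "((\<lambda>t. f (1 - t)) has_integral integral {1 - x..1} f) ((\<lambda>t. 1 - t) ` {1 - x..1})"
    by simp
  also have "(\<lambda>t. 1 - t) ` {1 - x..1} = {0..x}"
    by (auto simp: image_iff intro!: bexI[where x = "1 - t" for t])
  finally show ?thesis by (rule integral_unique)
qed

lemma plus_one_2: "(1::2) + 1 = 2" "(2::2) + 1 = 1" "(i::2) + 1 + 1 = i"
proof -
  show "(1::2) + 1 = 2" "(2::2) + 1 = 1" by simp_all
  then show "(i::2) + 1 + 1 = i" using exhaust_2[of i] by auto
qed

context dirac
begin

text \<open>
  The reflection \<open>x \<mapsto> 1 - x\<close> turns the terminal value problem for the adjoint equation into an initial
  value problem of the original form.
\<close>

abbreviation q_refl :: "2 \<Rightarrow> real \<Rightarrow> complex"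
  where "q_refl \<equiv> \<lambda>i x. q (i + 1) (1 - x)"

lemma dirac_refl: "dirac q_refl"
  by unfold_locales (rule square_integrable_reflect[OF sq])

text \<open>Integrate the derivative of y_i(x) z_i(1 - x) over [0,1] and divide by i b_i. The
  spectral terms cancel in each component, and the potential terms cancel in the sum because the
  reflected problem has its two coefficients exchanged. As z vanishes at 0, only the boundary term
  at x = 0 survives.\<close>

lemma green_formula:
  assumes g: "\<And>i. square_integrable (g i)" and y: "sol \<mu> (\<lambda>i t. 0) y"
    and z: "dirac.sol b q_refl \<mu> (\<lambda>i x. g i (1 - x)) z" and z0: "\<And>i. z i 0 = 0"
    and b0: "\<And>i. b i \<noteq> 0"
  shows "integral {0..1} (\<lambda>x. \<Sum>i\<in>UNIV. y i x * g i x) = - \<i> * (\<Sum>i\<in>UNIV. y i 0 * z i 1 / b i)"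
proof -
  interpret R: dirac b q_refl by (rule dirac_refl)
  have g': "\<And>i. square_integrable (\<lambda>x. g i (1 - x))" by (rule square_integrable_reflect[OF g])
  note yc = sol_continuous[OF y] and zc = R.sol_continuous[OF z]
  let ?p = "rhs \<mu> (\<lambda>i t. 0) y"
  let ?s = "R.rhs \<mu> (\<lambda>i x. g i (1 - x)) z"
  have sp: "square_integrable (?p i)" for i by (rule square_integrable_rhs[OF square_integrable_zero yc])
  have ss: "square_integrable (?s i)" for i by (rule R.square_integrable_rhs[OF g' zc])
  have ss': "square_integrable (\<lambda>t. - 1 * ?s i (1 - t))" for i
    by (intro square_integrable_cmult square_integrable_reflect ss)
  have zr: "z i (1 - x) = z i (1 - 0) + integral {0..x} (\<lambda>t. - 1 * ?s i (1 - t))" if x: "x \<in> {0..1}" for i x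
  proof -
    have "integral {0..1} (?s i) - integral {0..1 - x} (?s i) = integral {1 - x..1} (?s i)"
      by (rule integral_diff_eq) (use x square_integrable_imp_absolutely_integrable(1)[OF ss] in auto)
    also have "\<dots> = integral {0..x} (\<lambda>t. ?s i (1 - t))"
      by (rule integral_reflect_Icc[symmetric]) (rule square_integrable_integrable_on[OF ss], use x in auto)
    finally have "integral {0..1} (?s i) - integral {0..1 - x} (?s i) = integral {0..x} (\<lambda>t. ?s i (1 - t))" .
    moreover have "integral {0..x} (\<lambda>t. - 1 * ?s i (1 - t)) = - 1 * integral {0..x} (\<lambda>t. ?s i (1 - t))"
      by (rule integral_mult_right)
    moreover have "c - a = d \<Longrightarrow> e = - 1 * d \<Longrightarrow> e = a - c" for a c d e :: complex by auto
    ultimately have "integral {0..x} (\<lambda>t. - 1 * ?s i (1 - t)) = integral {0..1 - x} (?s i) - integral {0..1} (?s i)"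
      by blast
    moreover have "z i (1 - x) = z i 0 + integral {0..1 - x} (?s i)" by (rule R.sol_eq[OF z]) (use x in auto)
    moreover have "z i 1 = z i 0 + integral {0..1} (?s i)" by (rule R.sol_eq[OF z]) auto
    ultimately show ?thesis by simp
  qed
  \<comment> \<open>The derivative of y_i(t) z_i(1 - t) with the factor i b_i taken out.\<close>
  define h where "h i t = - (q i t * y (i + 1) t * z i (1 - t)) + q (i + 1) t * y i t * z (i + 1) (1 - t) - y i t * g i t" for i t
  have cr: "continuous_on {0..1} (\<lambda>t. z i (1 - t))" for i
    by (rule continuous_on_compose2[OF zc]) (auto intro!: continuous_intros)
  have hs: "square_integrable (h i)" for i
  proof -
    have 1: "square_integrable (\<lambda>t. q i t * (y (i + 1) t * z i (1 - t)))"
      by (intro square_integrable_mult_continuous sq continuous_intros yc cr)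
    have 2: "square_integrable (\<lambda>t. q (i + 1) t * (y i t * z (i + 1) (1 - t)))"
      by (intro square_integrable_mult_continuous sq continuous_intros yc cr)
    have 3: "square_integrable (\<lambda>t. g i t * y i t)"
      by (intro square_integrable_mult_continuous g yc)
    have "square_integrable (\<lambda>t. (- 1 * (q i t * (y (i + 1) t * z i (1 - t))) + q (i + 1) t * (y i t * z (i + 1) (1 - t))) + - 1 * (g i t * y i t))"
      by (intro square_integrable_add square_integrable_cmult 1 2 3)
    then show ?thesis by (simp add: h_def[abs_def] mult_ac)
  qed
  have "y i 0 * z i 1 / b i = - \<i> * integral {0..1} (h i)" for i
  proof -
    have "y i 1 * z i (1 - 1) = y i 0 * z i (1 - 0) +
       integral {0..1} (\<lambda>t. ?p i t * z i (1 - t) + y i t * (- 1 * ?s i (1 - t)))"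
    proof (rule absolutely_continuous_product[where P = "y i" and R = "\<lambda>x. z i (1 - x)"
          and p = "?p i" and r = "\<lambda>t. - 1 * ?s i (1 - t)"])
      show "?p i absolutely_integrable_on {0..1}" "(\<lambda>t. - 1 * ?s i (1 - t)) absolutely_integrable_on {0..1}"
        by (rule square_integrable_imp_absolutely_integrable(1)[OF sp],
            rule square_integrable_imp_absolutely_integrable(1)[OF ss'])
      show "y i x = y i 0 + integral {0..x} (?p i)" if "x \<in> {0..1}" for x
        by (rule sol_eq[OF y that])
      show "z i (1 - x) = z i (1 - 0) + integral {0..x} (\<lambda>t. - 1 * ?s i (1 - t))" if "x \<in> {0..1}" for x
        by (rule zr[OF that])
    qed simp
    also have "(\<lambda>t. ?p i t * z i (1 - t) + y i t * (- 1 * ?s i (1 - t))) = (\<lambda>t. \<i> * b i * h i t)"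
    proof (rule ext)
      fix t :: real
      have e: "1 - (1 - t) = t" by simp
      have alg: "\<i> * B * (\<mu> * u + 0 - q1 * u') * v + u * (- 1 * (\<i> * B * (\<mu> * v + w - q2 * v')))
        = \<i> * B * (- (q1 * u' * v) + q2 * u * v' - u * w)" for B u u' v v' w q1 q2 :: complex
        by (simp add: algebra_simps)
      show "?p i t * z i (1 - t) + y i t * (- 1 * ?s i (1 - t)) = \<i> * b i * h i t"
        unfolding rhs_def R.rhs_def h_def e by (rule alg)
    qed
    also have "integral {0..1} (\<lambda>t. \<i> * b i * h i t) = \<i> * b i * integral {0..1} (h i)"
      by (rule integral_mult_right)
    finally have "y i 0 * z i 1 = - (\<i> * b i * integral {0..1} (h i))"
      by (simp add: z0 eq_neg_iff_add_eq_0)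
    then show ?thesis using b0[of i] by simp
  qed
  then have "(\<Sum>i\<in>UNIV. y i 0 * z i 1 / b i) = - \<i> * (\<Sum>i\<in>UNIV. integral {0..1} (h i))"
    by (simp add: sum_distrib_left)
  also have "(\<Sum>i\<in>UNIV. integral {0..1} (h i)) = integral {0..1} (\<lambda>t. \<Sum>i\<in>UNIV. h i t)"
    by (rule integral_sum[symmetric]) (auto intro: square_integrable_integrable_on[OF hs])
  also have "(\<lambda>t. \<Sum>i\<in>UNIV. h i t) = (\<lambda>t. - (\<Sum>i\<in>UNIV. y i t * g i t))"
  proof (rule ext)
    show "(\<Sum>i\<in>UNIV. h i t) = - (\<Sum>i\<in>UNIV. y i t * g i t)" for t
      by (simp only: h_def sum_2 plus_one_2) (simp only: minus_add_distrib diff_conv_add_uminus add_ac, simp)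
  qed
  also have "integral {0..1} \<dots> = - integral {0..1} (\<lambda>t. \<Sum>i\<in>UNIV. y i t * g i t)"
    by (rule integral_neg)
  finally have S: "(\<Sum>i\<in>UNIV. y i 0 * z i 1 / b i) = - \<i> * - integral {0..1} (\<lambda>t. \<Sum>i\<in>UNIV. y i t * g i t)" .
  have "- \<i> * (- \<i> * - w) = w" for w :: complex by (simp add: complex_eq_iff)
  then show ?thesis unfolding S by (rule sym)
qed

text \<open>Since the supremum s is a value of the function, an estimate of all values in terms of s
  is an inequality for s itself and can be solved for s.\<close>

lemma attained_bound:
  fixes u :: "2 \<Rightarrow> real \<Rightarrow> complex"
  assumes "\<And>i. continuous_on {0..1} (u i)"
  obtains s where "s \<ge> 0" "\<And>i t. t \<in> {0..1} \<Longrightarrow> norm (u i t) \<le> s" "\<exists>i. \<exists>t\<in>{0..1}. s = norm (u i t)"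
proof -
  have "\<exists>t\<in>{0..1}. \<forall>t'\<in>{0..1}. norm (u i t') \<le> norm (u i t)" for i
    by (rule continuous_attains_sup) (auto intro!: continuous_intros assms)
  then obtain T where T: "\<And>i. T i \<in> {0..1}" "\<And>i t. t \<in> {0..1} \<Longrightarrow> norm (u i t) \<le> norm (u i (T i))"
    by metis
  define s where "s = max (norm (u 1 (T 1))) (norm (u 2 (T 2)))"
  have "norm (u i t) \<le> s" if "t \<in> {0..1}" for i t
    using T(2)[OF that, of i] exhaust_2[of i] by (auto simp: s_def)
  moreover have "\<exists>i. \<exists>t\<in>{0..1}. s = norm (u i t)"
    using T(1) unfolding s_def by (metis max_def)
  moreover have "s \<ge> 0" by (auto simp: s_def le_max_iff_disj)
  ultimately show ?thesis using that by blast
qed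

section \<open>Decay and dominant growth of solutions along rays\<close>

lemma eventually_le_inverse_sqrt:
  assumes "a > 0" "e > 0"
  shows "eventually (\<lambda>r::real. r > 0 \<and> C / sqrt (r * a) \<le> e) at_top"
proof -
  have "eventually (\<lambda>r::real. r \<ge> (C / e)\<^sup>2 / a) at_top" by (rule eventually_ge_at_top)
  moreover have "eventually (\<lambda>r::real. r > 0) at_top" by (rule eventually_gt_at_top)
  ultimately show ?thesis
  proof eventually_elim
    case (elim r)
    have "(C / e)\<^sup>2 \<le> r * a" using elim(1) assms by (simp add: field_simps)
    then have "C / e \<le> sqrt (r * a)" by (rule real_le_rsqrt)
    then show ?case using elim(2) assms by (simp add: field_simps)
  qed
qed

text \<open>A component with negative rate is integrated forward from its zero initial value. One
  with positive rate is integrated back from 1, where \<open>rel\<close> controls it by the other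
  component, whose rate is then negative. All errors carry the factor 1 / sqrt (r a0), so the
  supremum is absorbed for large r and tends to 0.\<close>

lemma decay_on_ray:
  assumes f: "\<And>i. square_integrable (f i)" and z: "\<And>\<nu>. sol \<nu> f (z \<nu>)" and z0: "\<And>\<nu> i. z \<nu> i 0 = 0"
    and a: "\<And>i. Re (\<i> * b i * \<omega>) \<noteq> 0" and np: "\<exists>i. Re (\<i> * b i * \<omega>) < 0"
    and C: "C \<ge> 0"
    and rel: "\<And>\<nu> i. Re (\<i> * b i * \<omega>) > 0 \<Longrightarrow> norm (z \<nu> i 1) \<le> C * norm (z \<nu> (i + 1) 1)"
    and x: "x \<in> {0..1}"
  shows "((\<lambda>r::real. z (of_real r * \<omega>) i x) \<longlongrightarrow> 0) at_top"
proof -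
  \<comment> \<open>The smaller of the two absolute rates; along the ray every rate has modulus at
    least r a0.\<close>
  define a0 where "a0 = min \<bar>Re (\<i> * b 1 * \<omega>)\<bar> \<bar>Re (\<i> * b 2 * \<omega>)\<bar>"
  have a0: "a0 > 0" "a0 \<le> \<bar>Re (\<i> * b j * \<omega>)\<bar>" for j
  proof -
    show "a0 > 0" using a[of 1] a[of 2] unfolding a0_def by (simp del: times_complex.sel)
    show "a0 \<le> \<bar>Re (\<i> * b j * \<omega>)\<bar>"
      using exhaust_2[of j] unfolding a0_def by (auto simp del: times_complex.sel)
  qed
  define Fm where "Fm = fc f 1 + fc f 2"
  have Fm: "fc f j \<le> Fm" "Fm \<ge> 1" for j
    using fc_ge1[of f 1, OF f] fc_ge1[of f 2, OF f] exhaust_2[of j] unfolding Fm_def by auto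
  let ?E = "\<lambda>r::real. (C + 1) * (\<beta> * qc) / sqrt (r * a0)"
  have key: "norm (z (of_real r * \<omega>) i x) \<le> 2 * ((C + 1) * (\<beta> * Fm) / sqrt (r * a0))"
    if r: "r > 0" "?E r \<le> 1 / 2" and x: "x \<in> {0..1}" for r i x
  proof -
    let ?\<nu> = "of_real r * \<omega>"
    define y where "y = z ?\<nu>"
    have y: "sol ?\<nu> f y" unfolding y_def by (rule z)
    have re: "Re (\<i> * b j * ?\<nu>) = r * Re (\<i> * b j * \<omega>)" for j by (simp add: algebra_simps)
    obtain s where s: "s \<ge> 0" "\<And>i t. t \<in> {0..1} \<Longrightarrow> norm (y i t) \<le> s" "\<exists>i. \<exists>t\<in>{0..1}. s = norm (y i t)"
      using attained_bound[of y, OF sol_continuous[OF y]] by metis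
    let ?n = "\<beta> * (Fm + s * qc) / sqrt (r * a0)"
    have n: "\<beta> * (fc f j + s * qc) / sqrt \<bar>Re (\<i> * b j * ?\<nu>)\<bar> \<le> ?n" for j
    proof (rule frac_le)
      show "0 \<le> \<beta> * (Fm + s * qc)" using \<beta>_nonneg Fm s qc_pos by (intro mult_nonneg_nonneg add_nonneg_nonneg) auto
      show "\<beta> * (fc f j + s * qc) \<le> \<beta> * (Fm + s * qc)" using Fm \<beta>_nonneg by (intro mult_left_mono) auto
      show "0 < sqrt (r * a0)" using r a0 by simp
      show "sqrt (r * a0) \<le> sqrt \<bar>Re (\<i> * b j * ?\<nu>)\<bar>"
        unfolding re abs_mult using r a0(1) a0(2)[of j] by (intro real_sqrt_le_mono mult_mono) auto
    qed
    have neg: "norm (y j t) \<le> ?n" if "Re (\<i> * b j * \<omega>) < 0" "t \<in> {0..1}" for j t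
    proof -
      have lt: "Re (\<i> * b j * ?\<nu>) < 0" unfolding re using that r by (simp add: mult_pos_neg)
      have "norm (y j t) \<le> norm (y j 0) * exp (Re (\<i> * b j * ?\<nu>) * t)
          + \<beta> * (fc f j + s * qc) / sqrt (0 - Re (\<i> * b j * ?\<nu>)) * exp (0 * t)"
        by (rule sol_forward_bound[OF f y refl lt order_refl s(1) _ that(2)]) (use s(2) in simp)
      then show ?thesis using n[of j] lt z0 by (simp add: y_def del: times_complex.sel)
    qed
    have all: "norm (y j t) \<le> (C + 1) * ?n" if t: "t \<in> {0..1}" for j t
    proof (cases "Re (\<i> * b j * \<omega>) < 0")
      case True
      have "?n \<ge> 0" using neg[OF True t] norm_ge_zero order_trans by blast
      then have "1 * ?n \<le> (C + 1) * ?n" using C by (intro mult_right_mono) auto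
      then show ?thesis using neg[OF True t] by linarith
    next
      case False
      then have pos: "Re (\<i> * b j * \<omega>) > 0" using a[of j] by linarith
      then have neg': "Re (\<i> * b (j + 1) * \<omega>) < 0"
      proof -
        obtain k where k: "Re (\<i> * b k * \<omega>) < 0" using np by blast
        then have "k \<noteq> j" using pos by auto
        then have "k = j + 1" using exhaust_2[of j] exhaust_2[of k] plus_one_2 by auto
        then show ?thesis using k by (simp only:)
      qed
      have gt: "Re (\<i> * b j * ?\<nu>) > 0" unfolding re using pos r by (intro mult_pos_pos) auto
      have "norm (y j t) \<le> norm (y j 1) + \<beta> * (fc f j + s * qc) / sqrt (Re (\<i> * b j * ?\<nu>))"
        by (rule sol_backward_bound[OF f y refl gt s(1) s(2) t])
      moreover have "norm (y j 1) \<le> C * ?n"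
        using rel[OF pos, of ?\<nu>] mult_left_mono[OF neg[OF neg', of 1] C] by (auto simp: y_def)
      moreover have "\<beta> * (fc f j + s * qc) / sqrt (Re (\<i> * b j * ?\<nu>)) \<le> ?n"
        using n[of j] unfolding abs_of_pos[OF gt] .
      moreover have "(C + 1) * ?n = C * ?n + ?n" by (simp only: distrib_right mult_1_left)
      ultimately show ?thesis by linarith
    qed
    \<comment> \<open>\<open>?n\<close> itself contains s, but with a factor at most 1/2 for the
      radii considered, so s can be moved to the left.\<close>
    have "s \<le> (C + 1) * ?n" using s(3) all by auto
    also have "\<dots> = (C + 1) * (\<beta> * Fm) / sqrt (r * a0) + ?E r * s"
      by (simp add: add_divide_distrib algebra_simps)
    also have "\<dots> \<le> (C + 1) * (\<beta> * Fm) / sqrt (r * a0) + 1 / 2 * s"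
      by (intro add_left_mono mult_right_mono r s)
    finally have "s \<le> 2 * ((C + 1) * (\<beta> * Fm) / sqrt (r * a0))" by simp
    then show ?thesis using s(2)[OF x, of i] by (simp add: y_def)
  qed
  show ?thesis
  proof (rule tendstoI)
    fix e :: real assume e: "e > 0"
    have "eventually (\<lambda>r::real. r > 0 \<and> ?E r \<le> 1 / 2) at_top"
      by (rule eventually_le_inverse_sqrt[OF a0(1)]) simp
    moreover have "eventually (\<lambda>r::real. r > 0 \<and> (C + 1) * (\<beta> * Fm) / sqrt (r * a0) \<le> e / 4) at_top"
      by (rule eventually_le_inverse_sqrt[OF a0(1)]) (use e in simp)
    ultimately show "eventually (\<lambda>r::real. dist (z (of_real r * \<omega>) i x) 0 < e) at_top"
    proof eventually_elim
      case (elim r)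
      have "norm (z (of_real r * \<omega>) i x) \<le> 2 * ((C + 1) * (\<beta> * Fm) / sqrt (r * a0))"
        by (rule key[OF _ _ x]) (use elim(1) in simp_all)
      also have "\<dots> \<le> 2 * (e / 4)" using elim(2) by (intro mult_left_mono) auto
      also have "\<dots> < e" using e by simp
      finally show ?case by (simp add: dist_norm)
    qed
  qed
qed

text \<open>Here the initial values are fixed and need not vanish, so there is no decay uniform in
  x: the term exp (-r a0 x) is harmless only away from 0. Hence the statement concerns the end point
  1.\<close>

lemma homogeneous_decay:
  assumes y: "\<And>\<nu>. sol \<nu> (\<lambda>i t. 0) (y \<nu>)" and 0: "\<And>\<nu> i. y \<nu> i 0 = \<eta> i"
    and a: "\<And>i. Re (\<i> * b i * \<omega>) < 0"
  shows "((\<lambda>r::real. y (of_real r * \<omega>) i 1) \<longlongrightarrow> 0) at_top"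
proof -
  define a0 where "a0 = min (- Re (\<i> * b 1 * \<omega>)) (- Re (\<i> * b 2 * \<omega>))"
  have a0': "a0 \<le> - Re (\<i> * b i * \<omega>)" for i
    using exhaust_2[of i] unfolding a0_def by (auto simp del: times_complex.sel)
  have a0: "a0 > 0" using a[of 1] a[of 2] unfolding a0_def by (simp del: times_complex.sel)
  define E where "E = norm (\<eta> 1) + norm (\<eta> 2)"
  have E: "norm (\<eta> i) \<le> E" "E \<ge> 0" for i using exhaust_2[of i] by (auto simp: E_def)
  \<comment> \<open>The numerator \<beta> (1 + s qc) of the error term, with the bound s \<le> 2 (E
    + 1) obtained below.\<close>
  define K where "K = \<beta> * (1 + (2 * (E + 1)) * qc)"
  have fc0: "fc (\<lambda>i t. 0) i = 1" for i by (simp add: fc_def)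
  have key: "norm (y (of_real r * \<omega>) i 1) \<le> E * exp (- (r * a0)) + K / sqrt (r * a0)"
    if r: "r > 0" "\<beta> * qc / sqrt (r * a0) \<le> 1 / 2" "\<beta> / sqrt (r * a0) \<le> 1" for r
  proof -
    let ?\<nu> = "of_real r * \<omega>"
    define u where "u = y ?\<nu>"
    have u: "sol ?\<nu> (\<lambda>i t. 0) u" unfolding u_def by (rule y)
    have re: "Re (\<i> * b j * ?\<nu>) = r * Re (\<i> * b j * \<omega>)" for j by (simp add: algebra_simps)
    have re_le: "Re (\<i> * b j * ?\<nu>) \<le> - (r * a0)" for j
      unfolding re using a0'[of j] r mult_left_mono[of a0 "- Re (\<i> * b j * \<omega>)" r] by (simp del: times_complex.sel)
    have ra: "r * a0 > 0" using r a0 by simp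
    obtain s where s: "s \<ge> 0" "\<And>i t. t \<in> {0..1} \<Longrightarrow> norm (u i t) \<le> s" "\<exists>i. \<exists>t\<in>{0..1}. s = norm (u i t)"
      using attained_bound[of u, OF sol_continuous[OF u]] by metis
    have b1: "norm (u j t) \<le> E * exp (- (r * a0) * t) + \<beta> * (1 + s * qc) / sqrt (r * a0)" if t: "t \<in> {0..1}" for j t
    proof -
      have lt: "Re (\<i> * b j * ?\<nu>) < 0" using re_le[of j] ra by linarith
      have "norm (u j t) \<le> norm (u j 0) * exp (Re (\<i> * b j * ?\<nu>) * t)
          + \<beta> * (fc (\<lambda>i t. 0) j + s * qc) / sqrt (0 - Re (\<i> * b j * ?\<nu>)) * exp (0 * t)"
        by (rule sol_forward_bound[OF square_integrable_zero u refl lt order_refl s(1) _ t]) (use s(2) in simp)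
      also have "\<dots> = norm (\<eta> j) * exp (Re (\<i> * b j * ?\<nu>) * t)
          + \<beta> * (1 + s * qc) / sqrt (- Re (\<i> * b j * ?\<nu>))"
        unfolding fc0 u_def 0 by (simp del: times_complex.sel)
      also have "\<dots> \<le> E * exp (- (r * a0) * t) + \<beta> * (1 + s * qc) / sqrt (r * a0)"
      proof (rule add_mono)
        have "exp (Re (\<i> * b j * ?\<nu>) * t) \<le> exp (- (r * a0) * t)"
          unfolding exp_le_cancel_iff by (rule mult_right_mono[OF re_le]) (use t in simp)
        then show "norm (\<eta> j) * exp (Re (\<i> * b j * ?\<nu>) * t) \<le> E * exp (- (r * a0) * t)"
          using E by (intro mult_mono) (auto simp del: times_complex.sel)
        have "r * a0 \<le> - Re (\<i> * b j * ?\<nu>)" using re_le[of j] by linarith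
        then have "sqrt (r * a0) \<le> sqrt (- Re (\<i> * b j * ?\<nu>))" by (rule real_sqrt_le_mono)
        moreover have "0 \<le> \<beta> * (1 + s * qc)"
          by (intro mult_nonneg_nonneg add_nonneg_nonneg \<beta>_nonneg s(1) less_imp_le[OF qc_pos]) simp
        ultimately show "\<beta> * (1 + s * qc) / sqrt (- Re (\<i> * b j * ?\<nu>)) \<le> \<beta> * (1 + s * qc) / sqrt (r * a0)"
          using ra by (intro frac_le order_refl) auto
      qed
      finally show ?thesis .
    qed
    obtain j t where jt: "t \<in> {0..1}" "s = norm (u j t)" using s(3) by blast
    have "s \<le> E * exp (- (r * a0) * t) + \<beta> * (1 + s * qc) / sqrt (r * a0)" using b1[OF jt(1), of j] jt(2) by simp
    also have "\<dots> \<le> E * 1 + (\<beta> / sqrt (r * a0) + \<beta> * qc / sqrt (r * a0) * s)"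
    proof (rule add_mono)
      have "r * a0 * t \<ge> 0" using ra jt(1) by (intro mult_nonneg_nonneg[OF less_imp_le]) auto
      then show "E * exp (- (r * a0) * t) \<le> E * 1" using E by (intro mult_left_mono) auto
      show "\<beta> * (1 + s * qc) / sqrt (r * a0) \<le> \<beta> / sqrt (r * a0) + \<beta> * qc / sqrt (r * a0) * s"
        by (simp add: add_divide_distrib distrib_left mult_ac)
    qed
    also have "\<dots> \<le> E * 1 + (1 + 1 / 2 * s)"
      by (intro add_mono mult_right_mono r s order_refl)
    finally have s2: "s \<le> 2 * (E + 1)" by simp
    have "norm (u i 1) \<le> E * exp (- (r * a0) * 1) + \<beta> * (1 + s * qc) / sqrt (r * a0)" by (rule b1) simp
    also have "\<dots> \<le> E * exp (- (r * a0) * 1) + K / sqrt (r * a0)"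
      unfolding K_def using s2 \<beta>_nonneg qc_pos ra
      by (intro add_left_mono divide_right_mono mult_left_mono mult_right_mono) auto
    finally show ?thesis by (simp add: u_def)
  qed
  show ?thesis
  proof (rule tendstoI)
    fix e :: real assume e: "e > 0"
    have "filterlim (\<lambda>r. - (r * a0)) at_bot at_top"
      unfolding filterlim_uminus_at_bot minus_minus
      by (rule filterlim_at_top_mult_tendsto_pos[OF _ a0 filterlim_ident, where f = "\<lambda>_. a0", simplified mult.commute]) simp
    then have "((\<lambda>r. E * exp (- (r * a0))) \<longlongrightarrow> E * 0) at_top"
      by (intro tendsto_mult tendsto_const filterlim_compose[OF exp_at_bot])
    then have "eventually (\<lambda>r. E * exp (- (r * a0)) < e / 4) at_top"
      by (rule order_tendstoD) (use e in simp)
    moreover have "eventually (\<lambda>r::real. r > 0 \<and> \<beta> * qc / sqrt (r * a0) \<le> 1 / 2) at_top"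
      by (rule eventually_le_inverse_sqrt[OF a0(1)]) simp
    moreover have "eventually (\<lambda>r::real. r > 0 \<and> \<beta> / sqrt (r * a0) \<le> 1) at_top"
      by (rule eventually_le_inverse_sqrt[OF a0(1)]) simp
    moreover have "eventually (\<lambda>r::real. r > 0 \<and> K / sqrt (r * a0) \<le> e / 4) at_top"
      by (rule eventually_le_inverse_sqrt[OF a0(1)]) (use e in simp)
    ultimately show "eventually (\<lambda>r::real. dist (y (of_real r * \<omega>) i 1) 0 < e) at_top"
    proof eventually_elim
      case (elim r)
      have "norm (y (of_real r * \<omega>) i 1) \<le> E * exp (- (r * a0)) + K / sqrt (r * a0)"
        using key elim by blast
      also have "\<dots> < e" using elim e by linarith
      finally show ?case by (simp add: dist_norm)
    qed
  qed
qed

text \<open>The component with the larger rate, divided by its exponential, keeps its initial value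
  up to O(1 / sqrt r). The other component is at most A exp (\<rho>' t) + K exp (\<rho> t) with K =
  O(1 / sqrt r), and feeding this back closes the estimate for the weighted supremum of the dominant
  component.\<close>

lemma homogeneous_dominant:
  assumes y: "\<And>\<nu>. sol \<nu> (\<lambda>i t. 0) (y \<nu>)" and 0: "\<And>\<nu> i. y \<nu> i 0 = \<eta> i"
    and a: "Re (\<i> * b i * \<omega>) > 0" "Re (\<i> * b (i + 1) * \<omega>) < Re (\<i> * b i * \<omega>)"
  shows "((\<lambda>r::real. exp (- (\<i> * b i * (of_real r * \<omega>))) * y (of_real r * \<omega>) i 1) \<longlongrightarrow> \<eta> i) at_top"
    and "\<exists>C. eventually (\<lambda>r::real. \<forall>j. \<forall>x\<in>{0..1}.
        norm (y (of_real r * \<omega>) j x) \<le> C * exp (r * Re (\<i> * b i * \<omega>))) at_top"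
proof -
  define a0 where "a0 = Re (\<i> * b i * \<omega>) - Re (\<i> * b (i + 1) * \<omega>)"
  have a0: "a0 > 0" using a by (simp add: a0_def)
  define A where "A = norm (\<eta> (i + 1))"
  \<comment> \<open>The feedback reads s \<le> P + s / 2, so the weighted supremum s is at most 2
    P.\<close>
  define P where "P = norm (\<eta> i) + \<beta> * qc * (A + \<beta>)"
  have P0: "P \<ge> 0" using \<beta>_nonneg qc_pos by (simp add: P_def A_def)
  have A0: "A \<ge> 0" by (simp add: A_def)
  have fc0: "fc (\<lambda>i t. 0) i = 1" for i by (simp add: fc_def)
  have key: "norm (exp (- (\<i> * b i * (of_real r * \<omega>)) * x) * y (of_real r * \<omega>) i x - \<eta> i) \<le>
        \<beta> * qc * ((A + \<beta> * (1 + 2 * P * qc)) / sqrt (r * a0)) \<and>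
      norm (y (of_real r * \<omega>) i x) \<le> 2 * P * exp (r * Re (\<i> * b i * \<omega>)) \<and>
      norm (y (of_real r * \<omega>) (i + 1) x) \<le> (A + \<beta> * (1 + 2 * P * qc)) * exp (r * Re (\<i> * b i * \<omega>))"
    if r: "r > 0" "\<beta> * qc * (\<beta> * qc) / sqrt (r * a0) \<le> 1 / 2" "1 / sqrt (r * a0) \<le> 1" and x: "x \<in> {0..1}" for r x
  proof -
    let ?\<nu> = "of_real r * \<omega>"
    define u where "u = y ?\<nu>"
    have u: "sol ?\<nu> (\<lambda>i t. 0) u" unfolding u_def by (rule y)
    define \<rho> \<rho>' where "\<rho> = Re (\<i> * b i * ?\<nu>)" and "\<rho>' = Re (\<i> * b (i + 1) * ?\<nu>)"
    have re: "\<rho> = r * Re (\<i> * b i * \<omega>)" "\<rho> - \<rho>' = r * a0"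
      by (simp_all add: \<rho>_def \<rho>'_def a0_def algebra_simps)
    have ra: "r * a0 > 0" using r a0 by simp
    have lt: "\<rho>' < \<rho>" using re ra by linarith
    have \<rho>0: "\<rho> > 0" unfolding re using r a by (intro mult_pos_pos) auto
    have w: "continuous_on {0..1} (\<lambda>t. exp (- (\<rho> * t)) * norm (u i t))"
      by (intro continuous_intros sol_continuous[OF u])
    obtain t0 where t0: "t0 \<in> {0..1}" "\<And>t. t \<in> {0..1} \<Longrightarrow> exp (- (\<rho> * t)) * norm (u i t) \<le> exp (- (\<rho> * t0)) * norm (u i t0)"
      using continuous_attains_sup[OF _ _ w] by auto
    define s where "s = exp (- (\<rho> * t0)) * norm (u i t0)"
    have s0: "s \<ge> 0" by (simp add: s_def)
    have us: "norm (u i t) \<le> s * exp (\<rho> * t)" if "t \<in> {0..1}" for t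
    proof -
      have "exp (\<rho> * t) * (exp (- (\<rho> * t)) * norm (u i t)) \<le> exp (\<rho> * t) * s"
        using t0(2)[OF that] by (intro mult_left_mono) (auto simp: s_def)
      moreover have "exp (\<rho> * t) * (exp (- (\<rho> * t)) * norm (u i t)) = norm (u i t)"
        by (simp flip: mult.assoc exp_add)
      ultimately show ?thesis by (simp only: mult.commute)
    qed
    define K where "K = \<beta> * (1 + s * qc) / sqrt (r * a0)"
    have K0: "K \<ge> 0" using \<beta>_nonneg s0 qc_pos ra by (simp add: K_def)
    have u2: "norm (u (i + 1) t) \<le> A * exp (\<rho>' * t) + K * exp (\<rho> * t)" if t: "t \<in> {0..1}" for t
    proof -
      have "norm (u (i + 1) t) \<le> norm (u (i + 1) 0) * exp (\<rho>' * t)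
          + \<beta> * (fc (\<lambda>i t. 0) (i + 1) + s * qc) / sqrt (\<rho> - \<rho>') * exp (\<rho> * t)"
      proof (rule sol_forward_bound[OF square_integrable_zero u \<rho>'_def lt _ s0 _ t])
        show "norm (u (i + 1 + 1) t) \<le> s * exp (\<rho> * t)" if "t \<in> {0..1}" for t
          using us[OF that] by (simp only: plus_one_2)
      qed (use \<rho>0 in simp)
      then show ?thesis unfolding fc0 re(2) K_def A_def by (simp only: u_def 0)
    qed
    have dom: "norm (exp (- (\<i> * b i * ?\<nu>) * t) * u i t - u i 0) \<le> \<beta> * qc * (A / sqrt (r * a0) + K)"
      if t: "t \<in> {0..1}" for t
      using sol_dominant_bound[OF u \<rho>_def lt K0 u2 A0 t] unfolding re(2) .
    have ne: "norm (exp (- (\<i> * b i * ?\<nu>) * of_real t)) = exp (- (\<rho> * t))" for t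
      by (simp add: \<rho>_def)
    have "s = norm (exp (- (\<i> * b i * ?\<nu>) * of_real t0) * u i t0)" unfolding norm_mult ne s_def ..
    also have "\<dots> \<le> norm (u i 0) + \<beta> * qc * (A / sqrt (r * a0) + K)"
      using dom[OF t0(1)] norm_triangle_sub[of "exp (- (\<i> * b i * ?\<nu>) * of_real t0) * u i t0" "u i 0"] by linarith
    also have "\<dots> = norm (\<eta> i) + \<beta> * qc * (A + \<beta>) * (1 / sqrt (r * a0)) + \<beta> * qc * (\<beta> * qc) / sqrt (r * a0) * s"
      by (simp add: u_def 0 K_def add_divide_distrib algebra_simps)
    also have "\<dots> \<le> norm (\<eta> i) + \<beta> * qc * (A + \<beta>) * 1 + 1 / 2 * s"
      using r \<beta>_nonneg qc_pos A0 s0 by (intro add_mono mult_left_mono mult_right_mono order_refl) auto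
    finally have s2: "s \<le> 2 * P" by (simp add: P_def)
    have K2: "K \<le> \<beta> * (1 + 2 * P * qc) / sqrt (r * a0)"
      unfolding K_def using s2 \<beta>_nonneg qc_pos ra
      by (intro divide_right_mono mult_left_mono add_left_mono mult_right_mono) auto
    have e1: "exp (\<rho> * x) \<le> exp \<rho>" "exp (\<rho>' * x) \<le> exp \<rho>"
    proof -
      have "\<rho> * x \<le> \<rho> * 1" using \<rho>0 x by (intro mult_left_mono) auto
      moreover have "\<rho>' * x \<le> \<rho> * x" using lt x by (intro mult_right_mono) auto
      ultimately show "exp (\<rho> * x) \<le> exp \<rho>" "exp (\<rho>' * x) \<le> exp \<rho>" by auto
    qed
    have "norm (exp (- (\<i> * b i * ?\<nu>) * x) * u i x - \<eta> i) \<le> \<beta> * qc * (A / sqrt (r * a0) + K)"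
      using dom[OF x] by (simp only: u_def 0)
    also have "\<dots> \<le> \<beta> * qc * (A / sqrt (r * a0) + \<beta> * (1 + 2 * P * qc) / sqrt (r * a0))"
      using \<beta>_nonneg qc_pos K2 by (intro mult_left_mono add_left_mono) auto
    finally have 1: "norm (exp (- (\<i> * b i * ?\<nu>) * x) * u i x - \<eta> i) \<le> \<beta> * qc * ((A + \<beta> * (1 + 2 * P * qc)) / sqrt (r * a0))"
      by (simp only: add_divide_distrib)
    have "norm (u i x) \<le> s * exp (\<rho> * x)" by (rule us[OF x])
    also have "\<dots> \<le> 2 * P * exp \<rho>" using s2 s0 e1 P0 by (intro mult_mono) auto
    finally have 2: "norm (u i x) \<le> 2 * P * exp \<rho>" .
    have "norm (u (i + 1) x) \<le> A * exp (\<rho>' * x) + K * exp (\<rho> * x)" by (rule u2[OF x])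
    also have "\<dots> \<le> A * exp \<rho> + (\<beta> * (1 + 2 * P * qc)) * exp \<rho>"
    proof (intro add_mono mult_mono e1 A0 order_refl)
      have "\<beta> * (1 + 2 * P * qc) * (1 / sqrt (r * a0)) \<le> \<beta> * (1 + 2 * P * qc) * 1"
        using r P0 \<beta>_nonneg qc_pos by (intro mult_left_mono) auto
      then show "K \<le> \<beta> * (1 + 2 * P * qc)" using K2 by simp
    qed (use P0 \<beta>_nonneg qc_pos in auto)
    finally have 3: "norm (u (i + 1) x) \<le> (A + \<beta> * (1 + 2 * P * qc)) * exp \<rho>" by (simp only: distrib_right)
    show ?thesis using 1 2 3 unfolding u_def re(1)[symmetric] by blast
  qed
  have ev1: "eventually (\<lambda>r::real. r > 0 \<and> \<beta> * qc * (\<beta> * qc) / sqrt (r * a0) \<le> 1 / 2) at_top"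
    by (rule eventually_le_inverse_sqrt[OF a0(1)]) simp
  have ev2: "eventually (\<lambda>r::real. r > 0 \<and> 1 / sqrt (r * a0) \<le> 1) at_top"
    by (rule eventually_le_inverse_sqrt[OF a0(1)]) simp
  show "((\<lambda>r::real. exp (- (\<i> * b i * (of_real r * \<omega>))) * y (of_real r * \<omega>) i 1) \<longlongrightarrow> \<eta> i) at_top"
  proof (rule tendstoI)
    fix e :: real assume e: "e > 0"
    have "eventually (\<lambda>r::real. r > 0 \<and> \<beta> * qc * (A + \<beta> * (1 + 2 * P * qc)) / sqrt (r * a0) \<le> e / 2) at_top"
      by (rule eventually_le_inverse_sqrt[OF a0(1)]) (use e in simp)
    with ev1 ev2 show "eventually (\<lambda>r::real. dist (exp (- (\<i> * b i * (of_real r * \<omega>))) * y (of_real r * \<omega>) i 1) (\<eta> i) < e) at_top"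
    proof eventually_elim
      case (elim r)
      have "norm (exp (- (\<i> * b i * (of_real r * \<omega>)) * of_real 1) * y (of_real r * \<omega>) i 1 - \<eta> i) \<le>
        \<beta> * qc * ((A + \<beta> * (1 + 2 * P * qc)) / sqrt (r * a0))"
        using key[of r 1] elim(1,2) by (simp only: atLeastAtMost_iff zero_le_one order_refl simp_thms)
      also have "\<dots> \<le> e / 2" using elim by simp
      also have "\<dots> < e" using e by simp
      finally show ?case by (simp add: dist_norm)
    qed
  qed
  have "eventually (\<lambda>r::real. \<forall>j. \<forall>x\<in>{0..1}. norm (y (of_real r * \<omega>) j x)
      \<le> (2 * P + (A + \<beta> * (1 + 2 * P * qc))) * exp (r * Re (\<i> * b i * \<omega>))) at_top"
    using ev1 ev2
  proof eventually_elim
    case (elim r)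
    have nn: "0 \<le> 2 * P * exp (r * Re (\<i> * b i * \<omega>))" "0 \<le> (A + \<beta> * (1 + 2 * P * qc)) * exp (r * Re (\<i> * b i * \<omega>))"
      using P0 A0 \<beta>_nonneg qc_pos by auto
    show ?case
    proof (intro allI ballI)
      fix j and x :: real assume x: "x \<in> {0..1}"
      have "j = i \<or> j = i + 1" using exhaust_2[of i] exhaust_2[of j] plus_one_2 by auto
      then show "norm (y (of_real r * \<omega>) j x) \<le> (2 * P + (A + \<beta> * (1 + 2 * P * qc))) * exp (r * Re (\<i> * b i * \<omega>))"
      proof (elim disjE)
        have k: "norm (y (of_real r * \<omega>) i x) \<le> 2 * P * exp (r * Re (\<i> * b i * \<omega>))"
          "norm (y (of_real r * \<omega>) (i + 1) x) \<le> (A + \<beta> * (1 + 2 * P * qc)) * exp (r * Re (\<i> * b i * \<omega>))"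
          using key[OF _ _ _ x, of r] elim by blast+
        have d: "(2 * P + (A + \<beta> * (1 + 2 * P * qc))) * exp (r * Re (\<i> * b i * \<omega>))
          = 2 * P * exp (r * Re (\<i> * b i * \<omega>)) + (A + \<beta> * (1 + 2 * P * qc)) * exp (r * Re (\<i> * b i * \<omega>))"
          by (rule distrib_right)
        show ?thesis if "j = i" unfolding d that using k nn by linarith
        show ?thesis if "j = i + 1" unfolding d that using k nn by linarith
      qed
    qed
  qed
  then show "\<exists>C. eventually (\<lambda>r::real. \<forall>j. \<forall>x\<in>{0..1}.
        norm (y (of_real r * \<omega>) j x) \<le> C * exp (r * Re (\<i> * b i * \<omega>))) at_top" by blast
qed

end

subsection \<open>The Hilbert space \<open>L\<^sup>2\<close>\<close>

lemma square_integrable_diff: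
  fixes f g :: "real \<Rightarrow> 'a::euclidean_space"
  assumes "square_integrable f" "square_integrable g"
  shows "square_integrable (\<lambda>x. f x - g x)"
  using square_integrable_add[OF assms(1) square_integrable_scaleR[OF assms(2), of "- 1"]] by simp

lemma finite_measure_unit_lebesgue: "finite_measure unit_lebesgue"
  by (rule finite_measureI) (simp add: space_restrict_space emeasure_restrict_space)

lemma square_integrable_rep: "square_integrable (rep_L2 u)"
  using Quotient_rep_reflp[OF Quotient_L2, of u] by (simp add: L2_eq_def)

lemma abs_rep_L2: "abs_L2 (rep_L2 u) = u"
  by (rule Quotient_abs_rep[OF Quotient_L2])

lemma abs_L2_eqI:
  assumes "square_integrable f" "square_integrable g" "AE x in unit_lebesgue. f x = g x"
  shows "abs_L2 f = abs_L2 g"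
  by (rule Quotient_rel_abs[OF Quotient_L2]) (use assms in \<open>simp add: L2_eq_def\<close>)

lemma rep_abs_L2:
  assumes "square_integrable f"
  shows "AE x in unit_lebesgue. rep_L2 (abs_L2 f) x = f x"
  using Quotient_rep_abs[OF Quotient_L2, of f] assms by (simp add: L2_eq_def)

lemma abs_L2_add: "square_integrable f \<Longrightarrow> square_integrable g \<Longrightarrow> abs_L2 f + abs_L2 g = abs_L2 (\<lambda>x. f x + g x)"
  by (rule plus_L2.abs_eq) (simp_all add: eq_onp_def L2_eq_def)

lemma abs_L2_scaleC: "square_integrable f \<Longrightarrow> c *\<^sub>C abs_L2 f = abs_L2 (\<lambda>x. c *s f x)"
  by (rule scaleC_L2.abs_eq) (simp add: eq_onp_def L2_eq_def)

lemma inner_abs_L2: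
  "square_integrable f \<Longrightarrow> square_integrable g \<Longrightarrow> abs_L2 f \<bullet> abs_L2 g = (\<integral>x. f x \<bullet> g x \<partial>unit_lebesgue)"
  by (rule inner_L2.abs_eq) (simp_all add: eq_onp_def L2_eq_def)

lemma abs_L2_scaleR: "square_integrable f \<Longrightarrow> r *\<^sub>R abs_L2 f = abs_L2 (\<lambda>x. r *\<^sub>R f x)"
  by (rule scaleR_L2.abs_eq) (simp add: eq_onp_def L2_eq_def)

lemma abs_L2_diff:
  assumes "square_integrable f" "square_integrable g"
  shows "abs_L2 f - abs_L2 g = abs_L2 (\<lambda>x. f x - g x)"
  unfolding minus_L2_def abs_L2_scaleR[OF assms(2)] abs_L2_add[OF assms(1) square_integrable_scaleR[OF assms(2)]]
  by simp

lemma scaleR_eq_scaleC: "r *\<^sub>R (u :: L2) = complex_of_real r *\<^sub>C u"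
proof -
  have "r *\<^sub>R v = complex_of_real r *s v" for v :: "complex^2"
    unfolding vec_eq_iff vector_scaleR_component vector_smult_component by (simp add: scaleR_conv_of_real)
  then have "abs_L2 (\<lambda>x. r *\<^sub>R rep_L2 u x) = abs_L2 (\<lambda>x. complex_of_real r *s rep_L2 u x)"
    by (simp only:)
  then show ?thesis
    using abs_L2_scaleR[OF square_integrable_rep, of r u] abs_L2_scaleC[OF square_integrable_rep, of "of_real r" u]
    by (simp only: abs_rep_L2)
qed

lemma norm_abs_L2:
  assumes "square_integrable f"
  shows "(norm (abs_L2 f))\<^sup>2 = (\<integral>x. (norm (f x))\<^sup>2 \<partial>unit_lebesgue)"
  by (simp add: power2_norm_eq_inner inner_abs_L2 assms)

text \<open>The interval has measure 1, so this is the nonnegativity of the variance of |f|.\<close>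

lemma integral_norm_le_norm_L2:
  assumes f: "square_integrable f"
  shows "(\<integral>x. norm (f x) \<partial>unit_lebesgue) \<le> norm (abs_L2 f)"
proof -
  interpret finite_measure unit_lebesgue by (rule finite_measure_unit_lebesgue)
  have i1: "integrable unit_lebesgue (\<lambda>x. norm (f x))"
    using square_integrable_imp_absolutely_integrable(1)[OF f]
    by (simp flip: integrable_unit_lebesgue_iff)
  have i2: "integrable unit_lebesgue (\<lambda>x. (norm (f x))\<^sup>2)"
    using f by (simp add: square_integrable_def)
  define m where "m = (\<integral>x. norm (f x) \<partial>unit_lebesgue)"
  have one: "(\<integral>x. 1 \<partial>unit_lebesgue) = (1::real)"
    by (simp add: measure_restrict_space space_restrict_space)
  have "0 \<le> (\<integral>x. (norm (f x) - m)\<^sup>2 \<partial>unit_lebesgue)" by simp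
  also have "\<dots> = (\<integral>x. (norm (f x))\<^sup>2 - 2 * m * norm (f x) + m\<^sup>2 * 1 \<partial>unit_lebesgue)"
    by (simp add: power2_diff algebra_simps)
  also have "\<dots> = (\<integral>x. (norm (f x))\<^sup>2 \<partial>unit_lebesgue) - 2 * m * m + m\<^sup>2 * 1"
    using i1 i2 one by (simp add: m_def)
  also have "\<dots> = (norm (abs_L2 f))\<^sup>2 - m\<^sup>2"
    unfolding norm_abs_L2[OF f] by (simp add: power2_eq_square[of m])
  finally have "m\<^sup>2 \<le> (norm (abs_L2 f))\<^sup>2" by simp
  then show ?thesis unfolding m_def by (rule power2_le_imp_le) simp
qed

text \<open>Riesz-Fischer: a rapidly convergent Cauchy sequence converges almost everywhere,
  and Fatou's lemma identifies the limit.\<close>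

lemma L2_rapidly_Cauchy_convergent:
  fixes X :: "nat \<Rightarrow> L2"
  assumes X: "\<And>n. norm (X (Suc n) - X n) \<le> (1 / 2) ^ n"
  shows "\<exists>l. X \<longlonglongrightarrow> l"
proof -
  define f where "f n = rep_L2 (X n)" for n
  have f: "square_integrable (f n)" for n by (simp add: f_def square_integrable_rep)
  have absf: "abs_L2 (f n) = X n" for n by (simp add: f_def abs_rep_L2)
  have fm: "f n \<in> borel_measurable unit_lebesgue" for n using f by (simp add: square_integrable_def)
  have diff: "X m - X n = abs_L2 (\<lambda>x. f m x - f n x)" for m n
    unfolding absf[symmetric] by (rule abs_L2_diff[OF f f])
  have dist_le: "norm (X m - X n) \<le> 2 * (1 / 2) ^ n" if "m \<ge> n" for m n
  proof -
    have "norm (X (n + k) - X n) \<le> 2 * (1 / 2) ^ n - 2 * (1 / 2) ^ (n + k)" for k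
    proof (induction k)
      case (Suc k)
      have "norm (X (n + Suc k) - X n) \<le> norm (X (Suc (n + k)) - X (n + k)) + norm (X (n + k) - X n)"
        using norm_triangle_ineq[of "X (Suc (n + k)) - X (n + k)" "X (n + k) - X n"] by simp
      also have "\<dots> \<le> (1 / 2) ^ (n + k) + (2 * (1 / 2) ^ n - 2 * (1 / 2) ^ (n + k))"
        by (intro add_mono X Suc)
      finally show ?case by simp
    qed simp
    from this[of "m - n"] have "norm (X m - X n) \<le> 2 * (1 / 2) ^ n - 2 * (1 / 2) ^ m"
      using that by simp
    moreover have "(1 / 2 :: real) ^ m \<ge> 0" by simp
    ultimately show ?thesis by linarith
  qed
  define S where "S n = (\<lambda>x. norm (f (Suc n) x - f n x))" for n
  have Sint: "integrable unit_lebesgue (S n)" for n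
    unfolding S_def using square_integrable_imp_absolutely_integrable(1)[OF square_integrable_diff[OF f f]]
    by (simp flip: integrable_unit_lebesgue_iff)
  have Sle: "(\<integral>x. norm (S n x) \<partial>unit_lebesgue) \<le> (1 / 2) ^ n" for n
    using integral_norm_le_norm_L2[OF square_integrable_diff[OF f f], of "Suc n" n] X[of n]
    unfolding diff S_def by simp
  have Spos: "0 \<le> (\<integral>x. norm (S n x) \<partial>unit_lebesgue)" for n by (rule integral_nonneg_AE) simp
  have Ssum: "summable (\<lambda>n. \<integral>x. norm (S n x) \<partial>unit_lebesgue)"
  proof (rule summable_comparison_test'[where g = "\<lambda>n. (1 / 2) ^ n" and N = 0])
    show "summable (\<lambda>n. (1 / 2 :: real) ^ n)" by (rule summable_geometric) simp
    show "norm (\<integral>x. norm (S n x) \<partial>unit_lebesgue) \<le> (1 / 2) ^ n" for n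
      using Spos[of n] Sle[of n] by simp
  qed
  have fin: "(\<Sum>n. ennreal (\<integral>x. norm (S n x) \<partial>unit_lebesgue)) \<noteq> \<infinity>"
    unfolding suminf_ennreal2[OF Spos Ssum] by simp
  \<comment> \<open>The L1 norms of the increments are summable, so the increments are summable at
    almost every point.\<close>
  have "AE x in unit_lebesgue. (\<Sum>n. ennreal (norm (S n x))) \<noteq> \<infinity>"
  proof (rule nn_integral_PInf_AE)
    show "(\<lambda>x. \<Sum>n. ennreal (norm (S n x))) \<in> borel_measurable unit_lebesgue"
      using borel_measurable_integrable[OF Sint] by measurable
    have "(\<integral>\<^sup>+x. (\<Sum>n. ennreal (norm (S n x))) \<partial>unit_lebesgue)
        = (\<Sum>n. \<integral>\<^sup>+x. ennreal (norm (S n x)) \<partial>unit_lebesgue)"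
      using borel_measurable_integrable[OF Sint] by (intro nn_integral_suminf) measurable
    also have "\<dots> = (\<Sum>n. ennreal (\<integral>x. norm (S n x) \<partial>unit_lebesgue))"
      by (rule arg_cong[where f = suminf], rule ext, rule nn_integral_eq_integral[OF integrable_norm[OF Sint]]) simp
    finally show "(\<integral>\<^sup>+x. (\<Sum>n. ennreal (norm (S n x))) \<partial>unit_lebesgue) \<noteq> \<infinity>" using fin by simp
  qed
  then have "AE x in unit_lebesgue. summable (\<lambda>n. norm (S n x))"
    by eventually_elim (rule summable_suminf_not_top, simp_all)
  then have "AE x in unit_lebesgue. convergent (\<lambda>n. f n x)"
  proof eventually_elim
    case (elim x)
    then have "summable (\<lambda>n. norm (f (Suc n) x - f n x))" by (simp add: S_def)
    then have "summable (\<lambda>n. f (Suc n) x - f n x)" by (rule summable_norm_cancel)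
    then have "convergent (\<lambda>n. \<Sum>k<n. f (Suc k) x - f k x)" by (simp add: summable_iff_convergent)
    then have "convergent (\<lambda>n. f n x - f 0 x)" 
      unfolding sum_lessThan_telescope[of "\<lambda>k. f k x"] .
    then have "convergent (\<lambda>n. (f n x - f 0 x) + f 0 x)" by (intro convergent_add convergent_const)
    then show ?case by simp
  qed
  then have lim: "AE x in unit_lebesgue. (\<lambda>n. f n x) \<longlonglongrightarrow> lim (\<lambda>n. f n x)"
    by eventually_elim (simp add: convergent_LIMSEQ_iff)
  define g where "g x = lim (\<lambda>n. f n x)" for x
  have gm: "g \<in> borel_measurable unit_lebesgue"
    unfolding g_def[abs_def] by (rule borel_measurable_lim_metric[OF fm])
  have fatou: "(\<integral>\<^sup>+x. ennreal ((norm (g x - f n x))\<^sup>2) \<partial>unit_lebesgue) \<le> ennreal ((2 * (1 / 2) ^ n)\<^sup>2)" for n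
  proof -
    have "(\<integral>\<^sup>+x. ennreal ((norm (g x - f n x))\<^sup>2) \<partial>unit_lebesgue)
        = (\<integral>\<^sup>+x. liminf (\<lambda>m. ennreal ((norm (f m x - f n x))\<^sup>2)) \<partial>unit_lebesgue)"
    proof (rule nn_integral_cong_AE)
      show "AE x in unit_lebesgue. ennreal ((norm (g x - f n x))\<^sup>2) = liminf (\<lambda>m. ennreal ((norm (f m x - f n x))\<^sup>2))"
        using lim
      proof eventually_elim
        case (elim x)
        then have "(\<lambda>m. ennreal ((norm (f m x - f n x))\<^sup>2)) \<longlonglongrightarrow> ennreal ((norm (g x - f n x))\<^sup>2)"
          unfolding g_def by (intro tendsto_intros)
        then show ?case by (rule lim_imp_Liminf[symmetric, rotated]) simp
      qed
    qed
    also have "\<dots> \<le> liminf (\<lambda>m. \<integral>\<^sup>+x. ennreal ((norm (f m x - f n x))\<^sup>2) \<partial>unit_lebesgue)"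
    proof (rule nn_integral_liminf)
      show "(\<lambda>x. ennreal ((norm (f m x - f n x))\<^sup>2)) \<in> borel_measurable unit_lebesgue" for m
        using fm by measurable
    qed
    also have "\<dots> \<le> ennreal ((2 * (1 / 2) ^ n)\<^sup>2)"
    proof (rule Liminf_le)
      show "eventually (\<lambda>m. (\<integral>\<^sup>+x. ennreal ((norm (f m x - f n x))\<^sup>2) \<partial>unit_lebesgue) \<le> ennreal ((2 * (1 / 2) ^ n)\<^sup>2)) sequentially"
        using eventually_ge_at_top[of n]
      proof eventually_elim
        case (elim m)
        have sd: "square_integrable (\<lambda>x. f m x - f n x)" by (rule square_integrable_diff[OF f f])
        have "(\<integral>\<^sup>+x. ennreal ((norm (f m x - f n x))\<^sup>2) \<partial>unit_lebesgue) = ennreal (\<integral>x. (norm (f m x - f n x))\<^sup>2 \<partial>unit_lebesgue)"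
          using sd by (intro nn_integral_eq_integral) (auto simp: square_integrable_def)
        also have "\<dots> = ennreal ((norm (X m - X n))\<^sup>2)" unfolding diff by (simp add: norm_abs_L2[OF sd])
        also have "\<dots> \<le> ennreal ((2 * (1 / 2) ^ n)\<^sup>2)"
          using dist_le[OF elim] by (intro ennreal_leI power_mono) auto
        finally show ?case .
      qed
    qed simp
    finally show ?thesis .
  qed
  have gf: "square_integrable (\<lambda>x. g x - f n x)" for n
    unfolding square_integrable_def
  proof
    show m: "(\<lambda>x. g x - f n x) \<in> borel_measurable unit_lebesgue" using gm fm by measurable
    have "(\<integral>\<^sup>+x. ennreal (norm ((norm (g x - f n x))\<^sup>2)) \<partial>unit_lebesgue) < \<infinity>"
      using le_less_trans[OF fatou[of n] ennreal_less_top] by simp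
    then show "integrable unit_lebesgue (\<lambda>x. (norm (g x - f n x))\<^sup>2)"
      using m by (intro integrableI_bounded) auto
  qed
  have g: "square_integrable g" using square_integrable_add[OF gf[of 0] f[of 0]] by simp
  have le: "norm (X n - abs_L2 g) \<le> 2 * (1 / 2) ^ n" for n
  proof -
    have e: "abs_L2 g - X n = abs_L2 (\<lambda>x. g x - f n x)"
      unfolding absf[symmetric] by (rule abs_L2_diff[OF g f])
    have "ennreal ((norm (abs_L2 g - X n))\<^sup>2) = (\<integral>\<^sup>+x. ennreal ((norm (g x - f n x))\<^sup>2) \<partial>unit_lebesgue)"
      unfolding e norm_abs_L2[OF gf] using gf[of n]
      by (intro nn_integral_eq_integral[symmetric]) (auto simp: square_integrable_def)
    also have "\<dots> \<le> ennreal ((2 * (1 / 2) ^ n)\<^sup>2)" by (rule fatou)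
    finally have "(norm (abs_L2 g - X n))\<^sup>2 \<le> (2 * (1 / 2) ^ n)\<^sup>2" by simp
    then have "norm (abs_L2 g - X n) \<le> 2 * (1 / 2) ^ n" by (rule power2_le_imp_le) simp
    then show ?thesis by (simp add: norm_minus_commute)
  qed
  have "(\<lambda>n. 2 * (1 / 2) ^ n :: real) \<longlonglongrightarrow> 0"
    by (intro tendsto_mult_right_zero LIMSEQ_power_zero) auto
  then have "(\<lambda>n. X n - abs_L2 g) \<longlonglongrightarrow> 0"
    by (rule Lim_null_comparison[OF always_eventually[OF allI[OF le]]])
  then have "X \<longlonglongrightarrow> abs_L2 g" by (rule LIM_zero_cancel)
  then show ?thesis by (rule exI)
qed

text \<open>A sequence in a subspace minimising the distance to a point is Cauchy by the parallelogram law.\<close>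

lemma exists_orthogonal:
  fixes M :: "L2 set"
  assumes M: "subspace M" and cl: "closure M \<noteq> UNIV"
  shows "\<exists>w. w \<noteq> 0 \<and> (\<forall>v\<in>M. v \<bullet> w = 0)"
proof -
  obtain u where u: "u \<notin> closure M" using cl by auto
  have ne: "M \<noteq> {}" using subspace_0[OF M] by auto
  define d where "d = infdist u M"
  have dle: "d \<le> norm (u - v)" if "v \<in> M" for v
    unfolding d_def using infdist_le[OF that, of u] by (simp add: dist_norm)
  have d0: "d \<ge> 0" unfolding d_def by (rule infdist_nonneg)
  have near: "\<exists>v\<in>M. norm (u - v) < d + e" if "e > 0" for e
  proof (rule ccontr)
    assume "\<not> ?thesis"
    then have "d + e \<le> infdist u M" unfolding infdist_notempty[OF ne]
      by (intro cINF_greatest ne) (auto simp: dist_norm not_less)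
    then show False using that by (simp add: d_def)
  qed
  have par: "(norm (v - w))\<^sup>2 \<le> 2 * (norm (u - v))\<^sup>2 + 2 * (norm (u - w))\<^sup>2 - 4 * d\<^sup>2" if "v \<in> M" "w \<in> M" for v w
  proof -
    have "(1 / 2) *\<^sub>R (v + w) \<in> M" using M that by (simp add: subspace_def)
    from dle[OF this] have "d\<^sup>2 \<le> (norm (u - (1 / 2) *\<^sub>R (v + w)))\<^sup>2" using d0 by (intro power_mono) auto
    moreover have "(norm (v - w))\<^sup>2 = 2 * (norm (u - v))\<^sup>2 + 2 * (norm (u - w))\<^sup>2 - 4 * (norm (u - (1 / 2) *\<^sub>R (v + w)))\<^sup>2"
      by (simp add: power2_norm_eq_inner inner_diff inner_add inner_commute algebra_simps)
    ultimately show ?thesis by linarith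
  qed
  \<comment> \<open>Chosen so that the parallelogram bound 4 (2 d + 1) e n stays below the square of
    (1 / 2)^n.\<close>
  define e where "e n = ((1 / 2) ^ n)\<^sup>2 / (8 * d + 8)" for n :: nat
  have e0: "e n > 0" for n using d0 by (simp add: e_def)
  have "\<exists>v\<in>M. norm (u - v) < d + e n" for n by (rule near[OF e0])
  then obtain X where X: "\<And>n. X n \<in> M" "\<And>n. norm (u - X n) < d + e n" by metis
  have e_mono: "e (Suc n) \<le> e n" "e n \<le> 1" for n
  proof -
    have p: "((1 / 2) ^ n)\<^sup>2 \<le> (1::real)" by (simp add: power_le_one)
    show "e (Suc n) \<le> e n" unfolding e_def using d0 by (intro divide_right_mono power_mono) auto
    have "((1 / 2) ^ n)\<^sup>2 \<le> 8 * d + 8" using p d0 by linarith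
    then show "e n \<le> 1" unfolding e_def using d0 by (simp add: divide_le_eq)
  qed
  have sq: "(norm (u - X m))\<^sup>2 \<le> d\<^sup>2 + (2 * d + 1) * e n" if "m = n \<or> m = Suc n" for m n
  proof -
    have "norm (u - X m) \<le> d + e n" using X(2)[of m] e_mono(1)[of n] that by auto
    then have "(norm (u - X m))\<^sup>2 \<le> (d + e n)\<^sup>2" by (intro power_mono) auto
    also have "\<dots> = d\<^sup>2 + 2 * d * e n + e n * e n" by (simp add: power2_eq_square algebra_simps)
    also have "e n * e n \<le> 1 * e n" using e_mono(2)[of n] e0[of n] by (intro mult_right_mono) auto
    finally show ?thesis by (simp add: algebra_simps)
  qed
  have "norm (X (Suc n) - X n) \<le> (1 / 2) ^ n" for n
  proof -
    define k where "k = (2 * d + 1) * e n"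
    have "(norm (u - X (Suc n)))\<^sup>2 \<le> d\<^sup>2 + k" "(norm (u - X n))\<^sup>2 \<le> d\<^sup>2 + k"
      unfolding k_def by (rule sq, simp)+
    then have "(norm (X (Suc n) - X n))\<^sup>2 \<le> 4 * k"
      using par[OF X(1)[of "Suc n"] X(1)[of n]] by linarith
    also have "\<dots> = (8 * d + 4) * e n" by (simp add: k_def algebra_simps)
    also have "\<dots> \<le> (8 * d + 8) * e n" using e0[of n] by (intro mult_right_mono) auto
    also have "\<dots> = ((1 / 2) ^ n)\<^sup>2" using d0 by (simp add: e_def)
    finally show ?thesis by (rule power2_le_imp_le) simp
  qed
  then obtain p where p: "X \<longlonglongrightarrow> p" using L2_rapidly_Cauchy_convergent by blast
  have "(\<lambda>n. d + e n) \<longlonglongrightarrow> d + 0"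
  proof (intro tendsto_intros)
    have "(\<lambda>n. ((1 / 2) ^ n)\<^sup>2 / (8 * d + 8)) \<longlonglongrightarrow> 0\<^sup>2 / (8 * d + 8)"
      using d0 by (intro tendsto_intros LIMSEQ_power_zero) auto
    then show "e \<longlonglongrightarrow> 0" by (simp add: e_def[abs_def])
  qed
  moreover have "(\<lambda>n. norm (u - X n)) \<longlonglongrightarrow> norm (u - p)" by (intro tendsto_intros p)
  ultimately have pd: "norm (u - p) \<le> d"
    by (intro LIMSEQ_le[where X = "\<lambda>n. norm (u - X n)" and Y = "\<lambda>n. d + e n"]) (auto intro: less_imp_le X)
  have "p \<in> closure M" using p X(1) closure_sequential by blast
  then have wn: "u - p \<noteq> 0" using u by auto
  have orth: "v \<bullet> (u - p) = 0" if v: "v \<in> M" for v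
  proof -
    have ge: "(norm (u - p))\<^sup>2 \<le> (norm (u - p - t *\<^sub>R v))\<^sup>2" for t
    proof -
      have "d \<le> norm (u - (X n + t *\<^sub>R v))" for n
        by (rule dle) (use M X(1) v in \<open>simp add: subspace_def\<close>)
      moreover have "(\<lambda>n. norm (u - (X n + t *\<^sub>R v))) \<longlonglongrightarrow> norm (u - (p + t *\<^sub>R v))"
        by (intro tendsto_intros p)
      ultimately have "d \<le> norm (u - (p + t *\<^sub>R v))" by (intro LIMSEQ_le_const) auto
      then have "norm (u - p) \<le> norm (u - p - t *\<^sub>R v)" using pd by (simp add: diff_diff_add)
      then show ?thesis by (intro power_mono) auto
    qed
    have "0 \<le> t\<^sup>2 * (v \<bullet> v) - 2 * t * (v \<bullet> (u - p))" for t
    proof -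
      have "(norm (w - t *\<^sub>R v))\<^sup>2 = (norm w)\<^sup>2 - 2 * t * (v \<bullet> w) + t\<^sup>2 * (v \<bullet> v)" for w
        unfolding power2_norm_eq_inner by (simp add: inner_diff inner_commute power2_eq_square algebra_simps)
      from this[of "u - p"] ge[of t] show ?thesis by linarith
    qed
    note q = this
    \<comment> \<open>The quadratic in t is tested at c / k. Adding 1 in k avoids a division by zero
      when v = 0.\<close>
    define c where "c = v \<bullet> (u - p)"
    define k where "k = v \<bullet> v + 1"
    have k: "k > 0" "v \<bullet> v \<le> k" by (simp_all add: k_def add_nonneg_pos)
    have "0 \<le> (c / k)\<^sup>2 * (v \<bullet> v) - 2 * (c / k) * c" using q[of "c / k"] by (simp add: c_def)
    also have "\<dots> \<le> (c / k)\<^sup>2 * k - 2 * (c / k) * c" using k by (intro diff_right_mono mult_left_mono) auto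
    also have "\<dots> = - (c\<^sup>2 / k)" using k by (simp add: power2_eq_square field_simps)
    finally have "c\<^sup>2 / k \<le> 0" by simp
    then have "c\<^sup>2 \<le> 0" using k by (simp add: divide_le_0_iff)
    then show ?thesis by (simp add: c_def)
  qed
  show ?thesis using wn orth by blast
qed

subsection \<open>The characteristic determinant\<close>

locale dirac_bvp = dirac b q for b q +
  fixes h0 h1 :: complex
  assumes b_nz: "b i \<noteq> 0" and ratio: "b 1 / b 2 \<notin> \<real>" and h0: "h0 \<noteq> 0" and h1: "h1 \<noteq> 0"
begin

definition e :: "2 \<Rightarrow> complex" where "e i = (if i = 1 then h0 else 1)"

text \<open>\<open>\<phi> \<nu>\<close> satisfies the boundary condition at \<open>0\<close>; the zeros of \<open>\<Delta>\<close> are the eigenvalues.\<close>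

definition \<phi> :: "complex \<Rightarrow> 2 \<Rightarrow> real \<Rightarrow> complex"
  where "\<phi> \<nu> = (SOME y. sol \<nu> (\<lambda>i t. 0) y \<and> (\<forall>i. y i 0 = e i))"

lemma sol_\<phi>: "sol \<nu> (\<lambda>i t. 0) (\<phi> \<nu>)" and \<phi>_0: "\<phi> \<nu> i 0 = e i"
proof -
  have "\<exists>y. sol \<nu> (\<lambda>i t. 0) y \<and> (\<forall>i. y i 0 = e i)" by (rule sol_exists[OF square_integrable_zero])
  then have "sol \<nu> (\<lambda>i t. 0) (\<phi> \<nu>) \<and> (\<forall>i. \<phi> \<nu> i 0 = e i)" unfolding \<phi>_def by (rule someI_ex)
  then show "sol \<nu> (\<lambda>i t. 0) (\<phi> \<nu>)" "\<phi> \<nu> i 0 = e i" by blast+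
qed

definition \<Delta> :: "complex \<Rightarrow> complex" where "\<Delta> \<nu> = \<phi> \<nu> 1 1 - h1"

lemma e_simps: "e 1 = h0" "e 2 = 1" by (simp_all add: e_def)

lemma Im_b_nz: "Im (cnj (\<i> * b 1) * (\<i> * b 2)) \<noteq> 0"
proof
  assume "Im (cnj (\<i> * b 1) * (\<i> * b 2)) = 0"
  then have "Im (b 1 * cnj (b 2)) = 0" by (simp add: algebra_simps)
  moreover have "b 1 / b 2 = b 1 * cnj (b 2) / of_real ((norm (b 2))\<^sup>2)"
    using b_nz[of 2] unfolding complex_norm_square by simp
  ultimately have "Im (b 1 / b 2) = 0" by (simp only: Im_divide_of_real div_0)
  then show False using ratio by (simp add: complex_is_Real_iff)
qed

text \<open>As \<open>b 1 / b 2\<close> is not real, \<open>i b 1\<close> and \<open>i b 2\<close> are linearly independent over the reals.\<close>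

lemma direction:
  obtains \<omega> where "Re (\<i> * b 1 * \<omega>) = A1" "Re (\<i> * b 2 * \<omega>) = A2"
proof -
  define x y where "x = \<i> * b 1" and "y = \<i> * b 2"
  define D where "D = Im (cnj x * y)"
  have D: "D \<noteq> 0" "D = Re x * Im y - Im x * Re y" using Im_b_nz by (simp_all add: D_def x_def y_def)
  \<comment> \<open>Cramer's rule for the real and imaginary parts of the direction;
    \<open>D\<close> is the determinant of the two linear conditions.\<close>
  define p q where "p = (A1 * Im y - A2 * Im x) / D" and "q = (Re y * A1 - Re x * A2) / D"
  have pD: "p * D = A1 * Im y - A2 * Im x" and qD: "q * D = Re y * A1 - Re x * A2"
    using D(1) by (simp_all add: p_def q_def)
  have "(Re x * p - Im x * q) * D = Re x * (p * D) - Im x * (q * D)"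
    "(Re y * p - Im y * q) * D = Re y * (p * D) - Im y * (q * D)" by (simp_all only: left_diff_distrib mult.assoc)
  then have "(Re x * p - Im x * q) * D = A1 * D" "(Re y * p - Im y * q) * D = A2 * D"
    unfolding pD qD by (simp_all add: D(2) algebra_simps)
  then have "Re (x * Complex p q) = A1" "Re (y * Complex p q) = A2" using D(1) by simp_all
  then show ?thesis using that[of "Complex p q"] by (simp only: x_def y_def)
qed

text \<open>The determinant of the prescribed rates is, up to sign, the determinant of i b 1, i b 2
  times that of u, v. Linear independence can therefore be read off the rates.\<close>

lemma independent_directions:
  assumes "Re (\<i> * b 1 * u) * Re (\<i> * b 2 * v) - Re (\<i> * b 1 * v) * Re (\<i> * b 2 * u) \<noteq> 0"
  shows "Im (cnj u * v) \<noteq> 0"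
proof
  assume 0: "Im (cnj u * v) = 0"
  have "Re (x * u) * Re (y * v) - Re (x * v) * Re (y * u) = - Im (cnj x * y) * Im (cnj u * v)" for x y :: complex
    by (simp add: algebra_simps)
  then show False using assms 0 by (simp only: mult_zero_right)
qed

lemma \<phi>_continuous: "continuous_on {0..1} (\<phi> \<nu> i)" by (rule sol_continuous[OF sol_\<phi>])

lemma \<Delta>_holomorphic: "\<Delta> holomorphic_on UNIV"
proof -
  have "(\<lambda>\<nu>. \<phi> \<nu> 1 1) holomorphic_on UNIV"
    by (rule sol_holomorphic[OF square_integrable_zero sol_\<phi> \<phi>_0]) simp
  then show ?thesis unfolding \<Delta>_def[abs_def] by (intro holomorphic_intros)
qed

lemma \<Delta>_exponential_type: "\<exists>A>0. \<forall>\<nu>. norm (\<Delta> \<nu>) \<le> A * exp (A * norm \<nu>)"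
proof -
  obtain A where A: "A > 0" "\<And>\<nu> i x. x \<in> {0..1} \<Longrightarrow> norm (\<phi> \<nu> i x) \<le> A * exp (A * norm \<nu>)"
    using sol_exponential_type[OF square_integrable_zero sol_\<phi> \<phi>_0] by blast
  define B where "B = A + norm h1"
  have "norm (\<Delta> \<nu>) \<le> B * exp (B * norm \<nu>)" for \<nu>
  proof -
    have "norm (\<Delta> \<nu>) \<le> norm (\<phi> \<nu> 1 1) + norm h1" unfolding \<Delta>_def by (rule norm_triangle_ineq4)
    also have "\<dots> \<le> A * exp (A * norm \<nu>) + norm h1 * exp (A * norm \<nu>)"
      using A mult_left_mono[of 1 "exp (A * norm \<nu>)" "norm h1"] by (intro add_mono A(2)) auto
    also have "\<dots> = B * exp (A * norm \<nu>)" by (simp add: B_def distrib_right)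
    also have "\<dots> \<le> B * exp (B * norm \<nu>)"
      using A(1) by (intro mult_left_mono) (auto simp: B_def intro: mult_right_mono)
    finally show ?thesis .
  qed
  moreover have "B > 0" using A(1) by (simp add: B_def add_pos_nonneg)
  ultimately show ?thesis by blast
qed

lemma \<Delta>_tendsto:
  assumes "\<And>i. Re (\<i> * b i * \<omega>) < 0"
  shows "((\<lambda>r::real. \<Delta> (of_real r * \<omega>)) \<longlongrightarrow> - h1) at_top"
proof -
  have "((\<lambda>r::real. \<phi> (of_real r * \<omega>) 1 1 - h1) \<longlongrightarrow> 0 - h1) at_top"
    by (intro tendsto_diff tendsto_const homogeneous_decay[where y = \<phi>, OF sol_\<phi> \<phi>_0 assms])
  then show ?thesis by (simp add: \<Delta>_def)
qed

lemma forall_2_neg: "Re (\<i> * b 1 * \<omega>) < 0 \<Longrightarrow> Re (\<i> * b 2 * \<omega>) < 0 \<Longrightarrow> Re (\<i> * b i * \<omega>) < 0"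
  using exhaust_2[of i] by (auto simp del: times_complex.sel)

lemma \<Delta>_nonzero: "\<exists>\<nu>. \<Delta> \<nu> \<noteq> 0"
proof -
  obtain \<omega> where \<omega>: "Re (\<i> * b 1 * \<omega>) = - 1" "Re (\<i> * b 2 * \<omega>) = - 1" by (rule direction)
  have "((\<lambda>r::real. \<Delta> (of_real r * \<omega>)) \<longlongrightarrow> - h1) at_top"
    by (rule \<Delta>_tendsto, rule forall_2_neg) (use \<omega> in linarith)+
  then have "eventually (\<lambda>r::real. \<Delta> (of_real r * \<omega>) \<noteq> 0) at_top"
    by (rule tendsto_imp_eventually_ne) (use h1 in simp)
  then obtain R where "\<And>r::real. r \<ge> R \<Longrightarrow> \<Delta> (of_real r * \<omega>) \<noteq> 0"
    unfolding eventually_at_top_linorder by blast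
  then show ?thesis by blast
qed

text \<open>Bilinear and not Hermitian, so that it is holomorphic in \<nu> along
  \<open>\<phi> \<nu>\<close>. For orthogonality in L2 the conjugate is put on g.\<close>

definition pairing :: "(2 \<Rightarrow> real \<Rightarrow> complex) \<Rightarrow> (2 \<Rightarrow> real \<Rightarrow> complex) \<Rightarrow> complex"
  where "pairing y g = integral {0..1} (\<lambda>x. \<Sum>i\<in>UNIV. y i x * g i x)"

lemma pairing_integrable:
  fixes y g :: "2 \<Rightarrow> real \<Rightarrow> complex"
  assumes g: "\<And>i. square_integrable (g i)" and y: "\<And>i. continuous_on {0..1} (y i)"
  shows "(\<lambda>x. y i x * g i x) integrable_on {0..1}"
proof -
  have "square_integrable (\<lambda>x. g i x * y i x)" by (rule square_integrable_mult_continuous[OF g y])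
  then have "(\<lambda>x. g i x * y i x) integrable_on {0..1}"
    by (rule square_integrable_integrable_on(1)) (rule order_refl)
  then show ?thesis by (simp only: mult.commute)
qed

lemma pairing_norm_le:
  assumes g: "\<And>i. square_integrable (g i)" and y: "\<And>i. continuous_on {0..1} (y i)"
    and M: "\<And>i x. x \<in> {0..1} \<Longrightarrow> norm (y i x) \<le> M"
  shows "norm (pairing y g) \<le> M * integral {0..1} (\<lambda>x. \<Sum>i\<in>UNIV. norm (g i x))"
proof -
  have gi: "(\<lambda>x. norm (g i x)) integrable_on {0..1}" for i
    by (rule square_integrable_integrable_on(2)[OF g order_refl])
  have "norm (pairing y g) \<le> integral {0..1} (\<lambda>x. M * (\<Sum>i\<in>UNIV. norm (g i x)))"
    unfolding pairing_def
  proof (rule integral_norm_bound_integral)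
    show "(\<lambda>x. \<Sum>i\<in>UNIV. y i x * g i x) integrable_on {0..1}"
      by (intro integrable_sum pairing_integrable g y) simp_all
    show "(\<lambda>x. M * (\<Sum>i\<in>UNIV. norm (g i x))) integrable_on {0..1}"
      by (intro integrable_on_mult_right integrable_sum gi) simp_all
    fix x :: real assume x: "x \<in> {0..1}"
    have "norm (\<Sum>i\<in>UNIV. y i x * g i x) \<le> (\<Sum>i\<in>UNIV. norm (y i x * g i x))" by (rule norm_sum)
    also have "\<dots> \<le> (\<Sum>i\<in>UNIV. M * norm (g i x))"
      unfolding norm_mult by (intro sum_mono mult_right_mono M x) auto
    finally show "norm (\<Sum>i\<in>UNIV. y i x * g i x) \<le> M * (\<Sum>i\<in>UNIV. norm (g i x))"
      by (simp only: sum_distrib_left)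
  qed
  also have "\<dots> = M * integral {0..1} (\<lambda>x. \<Sum>i\<in>UNIV. norm (g i x))" by (rule integral_mult_right)
  finally show ?thesis .
qed

section \<open>The adjoint problem and the two arguments with three rays\<close>

context
  fixes g :: "2 \<Rightarrow> real \<Rightarrow> complex"
  assumes g: "\<And>i. square_integrable (g i)"
begin

interpretation R: dirac b q_refl by (rule dirac_refl)

text \<open>The adjoint solution with source g, read from the right end: its value at 1 is the
  adjoint solution's value at the left end of the interval.\<close>

definition z :: "complex \<Rightarrow> 2 \<Rightarrow> real \<Rightarrow> complex"
  where "z \<nu> = R.Y \<nu> (\<lambda>i x. g i (1 - x))"

lemma g_refl: "square_integrable (\<lambda>x. g i (1 - x))" by (rule square_integrable_reflect[OF g])

lemma sol_z: "R.sol \<nu> (\<lambda>i x. g i (1 - x)) (z \<nu>)" unfolding z_def by (rule R.sol_Y[OF g_refl])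

lemma z_0: "z \<nu> i 0 = 0" unfolding z_def by (rule R.Y_0[OF g_refl])

lemma pairing_eq: "pairing (\<phi> \<nu>) g = - \<i> * (\<Sum>i\<in>UNIV. e i * z \<nu> i 1 / b i)"
  using green_formula[OF g sol_\<phi> sol_z z_0 b_nz] unfolding pairing_def \<phi>_0 .

lemma z_holomorphic: "x \<in> {0..1} \<Longrightarrow> (\<lambda>\<nu>. z \<nu> i x) holomorphic_on UNIV"
  by (rule R.sol_holomorphic[OF g_refl sol_z z_0])

lemma z_exponential_type: "\<exists>A>0. \<forall>\<nu> i. \<forall>x\<in>{0..1}. norm (z \<nu> i x) \<le> A * exp (A * norm \<nu>)"
  by (rule R.sol_exponential_type[OF g_refl sol_z z_0])

lemma pairing_holomorphic: "(\<lambda>\<nu>. pairing (\<phi> \<nu>) g) holomorphic_on UNIV"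
  unfolding pairing_eq by (intro holomorphic_intros z_holomorphic b_nz) auto

lemma pairing_exponential_type: "\<exists>A>0. \<forall>\<nu>. norm (pairing (\<phi> \<nu>) g) \<le> A * exp (A * norm \<nu>)"
proof -
  obtain A where A: "A > 0" "\<And>\<nu> i x. x \<in> {0..1} \<Longrightarrow> norm (z \<nu> i x) \<le> A * exp (A * norm \<nu>)"
    using z_exponential_type by blast
  define S where "S = (\<Sum>i\<in>UNIV. norm (e i) / norm (b i))"
  have S: "S \<ge> 0" unfolding S_def by (intro sum_nonneg) auto
  define B where "B = S * A + A"
  have "norm (pairing (\<phi> \<nu>) g) \<le> B * exp (B * norm \<nu>)" for \<nu>
  proof -
    have "norm (pairing (\<phi> \<nu>) g) = norm (\<Sum>i\<in>UNIV. e i * z \<nu> i 1 / b i)"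
      unfolding pairing_eq by (simp add: norm_mult)
    also have "\<dots> \<le> (\<Sum>i\<in>UNIV. norm (e i * z \<nu> i 1 / b i))" by (rule norm_sum)
    also have "\<dots> = (\<Sum>i\<in>UNIV. norm (e i) / norm (b i) * norm (z \<nu> i 1))"
      by (simp add: norm_mult norm_divide)
    also have "\<dots> \<le> (\<Sum>i\<in>UNIV. norm (e i) / norm (b i) * (A * exp (A * norm \<nu>)))"
      by (intro sum_mono mult_left_mono A(2)) auto
    also have "\<dots> = S * A * exp (A * norm \<nu>)" unfolding S_def sum_distrib_right by (simp only: mult.assoc)
    also have "\<dots> \<le> B * exp (B * norm \<nu>)"
      using A(1) S by (intro mult_mono) (auto simp: B_def intro!: mult_right_mono)
    finally show ?thesis .
  qed
  moreover have "B > 0" using A(1) S by (simp add: B_def add_nonneg_pos)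
  ultimately show ?thesis by blast
qed

lemma z_tendsto_neg:
  assumes neg: "\<And>i. Re (\<i> * b i * \<omega>) < 0" and x: "x \<in> {0..1}"
  shows "((\<lambda>r::real. z (of_real r * \<omega>) i x) \<longlongrightarrow> 0) at_top"
proof (rule R.decay_on_ray[where C = 0, OF g_refl sol_z z_0 _ _ order_refl _ x])
  show "Re (\<i> * b i * \<omega>) \<noteq> 0" for i using neg[of i] by linarith
  show "\<exists>i. Re (\<i> * b i * \<omega>) < 0" using neg by blast
  show "norm (z \<nu> i 1) \<le> 0 * norm (z \<nu> (i + 1) 1)" if "Re (\<i> * b i * \<omega>) > 0" for \<nu> i
    using neg[of i] that by linarith
qed

lemma pairing_tendsto:
  assumes neg: "\<And>i. Re (\<i> * b i * \<omega>) < 0"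
  shows "((\<lambda>r::real. pairing (\<phi> (of_real r * \<omega>)) g) \<longlongrightarrow> 0) at_top"
proof -
  have "((\<lambda>r::real. - \<i> * (\<Sum>i\<in>UNIV. e i * z (of_real r * \<omega>) i 1 / b i)) \<longlongrightarrow> - \<i> * (\<Sum>i\<in>UNIV. e i * 0 / b i)) at_top"
    by (intro tendsto_intros z_tendsto_neg neg b_nz) auto
  then show ?thesis unfolding pairing_eq by simp
qed

lemma pairing_zero_if_divisible:
  assumes G: "G holomorphic_on UNIV" and FG: "\<And>\<nu>. pairing (\<phi> \<nu>) g = \<Delta> \<nu> * G \<nu>"
  shows "pairing (\<phi> \<nu>) g = 0"
proof -
  \<comment> \<open>The pairs of rates are (-1, -1) along u, (3, 2) along v and (-2, -1) along -u -
    v. On the two negative rays the numerator tends to 0 and \<Delta> to -h1. Along v the first rate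
    is positive and dominates, as the asymptotics of \<Delta> require.\<close>
  obtain u where u: "Re (\<i> * b 1 * u) = - 1" "Re (\<i> * b 2 * u) = - 1" by (rule direction)
  obtain v where v: "Re (\<i> * b 1 * v) = 3" "Re (\<i> * b 2 * v) = 2" by (rule direction)
  have w: "Re (\<i> * b 1 * (- u - v)) = - 2" "Re (\<i> * b 2 * (- u - v)) = - 1"
    unfolding right_diff_distrib mult_minus_right minus_complex.sel uminus_complex.sel u v by simp_all
  have uneg: "Re (\<i> * b i * u) < 0" for i by (rule forall_2_neg) (use u in linarith)+
  have wneg: "Re (\<i> * b i * (- u - v)) < 0" for i by (rule forall_2_neg) (use w in linarith)+
  have uv: "Im (cnj u * v) \<noteq> 0" by (rule independent_directions) (simp only: u v; simp)
  obtain a where a: "\<Delta> a \<noteq> 0" using \<Delta>_nonzero by blast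
  obtain A1 where A1: "A1 > 0" "\<And>\<nu>. norm (\<Delta> \<nu>) \<le> A1 * exp (A1 * norm \<nu>)" using \<Delta>_exponential_type by blast
  obtain A2 where A2: "A2 > 0" "\<And>\<nu>. norm (pairing (\<phi> \<nu>) g) \<le> A2 * exp (A2 * norm \<nu>)"
    using pairing_exponential_type by blast
  define A where "A = max A1 A2"
  have "A1 * exp (A1 * norm \<nu>) \<le> A * exp (A * norm \<nu>)" "A2 * exp (A2 * norm \<nu>) \<le> A * exp (A * norm \<nu>)" for \<nu> :: complex
    using A1(1) A2(1) by (auto simp: A_def intro!: mult_mono mult_right_mono)
  then have A: "norm (\<Delta> \<nu>) \<le> A * exp (A * norm \<nu>)" "norm (\<Delta> \<nu> * G \<nu>) \<le> A * exp (A * norm \<nu>)" for \<nu>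
    unfolding FG[symmetric] using A1(2)[of \<nu>] A2(2)[of \<nu>] order_trans by blast+
  have A0: "A > 0" using A1 by (simp add: A_def less_max_iff_disj)
  obtain C where C: "\<And>\<nu>. norm (G \<nu>) \<le> C * exp (C * norm \<nu>)"
    using quotient_exponential_type[OF \<Delta>_holomorphic G a A(2,1) A0] by blast
  have limneg: "((\<lambda>r::real. G (of_real r * \<omega>)) \<longlongrightarrow> 0) at_top" if neg: "\<And>i. Re (\<i> * b i * \<omega>) < 0" for \<omega>
  proof -
    have "((\<lambda>r::real. pairing (\<phi> (of_real r * \<omega>)) g / \<Delta> (of_real r * \<omega>)) \<longlongrightarrow> 0 / (- h1)) at_top"
      by (intro tendsto_divide pairing_tendsto \<Delta>_tendsto neg) (use h1 in simp)
    moreover have "eventually (\<lambda>r::real. \<Delta> (of_real r * \<omega>) \<noteq> 0) at_top"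
      by (rule tendsto_imp_eventually_ne[OF \<Delta>_tendsto[OF neg]]) (use h1 in simp)
    then have "eventually (\<lambda>r::real. pairing (\<phi> (of_real r * \<omega>)) g / \<Delta> (of_real r * \<omega>) = G (of_real r * \<omega>)) at_top"
      by eventually_elim (simp add: FG)
    ultimately show ?thesis by (simp add: tendsto_cong)
  qed
  have bdneg: "\<exists>M. eventually (\<lambda>r::real. norm (G (of_real r * \<omega>)) \<le> M) at_top"
    if neg: "\<And>i. Re (\<i> * b i * \<omega>) < 0" for \<omega>
  proof -
    have "eventually (\<lambda>r::real. dist (G (of_real r * \<omega>)) 0 < 1) at_top"
      by (rule tendstoD[OF limneg[OF neg]]) simp
    then have "eventually (\<lambda>r::real. norm (G (of_real r * \<omega>)) \<le> 1) at_top"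
      by eventually_elim simp
    then show ?thesis by blast
  qed
  have bdv: "\<exists>M. eventually (\<lambda>r::real. norm (G (of_real r * v)) \<le> M) at_top"
  proof -
    have lt: "0 < Re (\<i> * b 1 * v)" "Re (\<i> * b (1 + 1) * v) < Re (\<i> * b 1 * v)"
      unfolding plus_one_2 v by simp_all
    note dom = homogeneous_dominant[where y = \<phi> and \<eta> = e and i = 1, OF sol_\<phi> \<phi>_0 lt]
    let ?E = "\<lambda>r::real. exp (- (\<i> * b 1 * (of_real r * v)))"
    have nE: "norm (?E r) = exp (- (3 * r))" for r
    proof -
      have "\<i> * b 1 * (of_real r * v) = r *\<^sub>R (\<i> * b 1 * v)" by (simp add: scaleR_conv_of_real)
      then have "Re (- (\<i> * b 1 * (of_real r * v))) = - (r * Re (\<i> * b 1 * v))"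
        by (simp only: uminus_complex.sel scaleR_complex.sel)
      then show ?thesis unfolding norm_exp_eq_Re v by (simp add: mult.commute)
    qed
    have "filterlim (\<lambda>r::real. - (3 * r)) at_bot at_top"
      unfolding filterlim_at_bot
    proof
      fix Z :: real
      show "eventually (\<lambda>r. - (3 * r) \<le> Z) at_top"
        using eventually_ge_at_top[of "- Z / 3"] by eventually_elim simp
    qed
    then have "((\<lambda>r. exp (- (3 * r))) \<longlongrightarrow> (0::real)) at_top"
      by (rule filterlim_compose[OF exp_at_bot])
    then have "((\<lambda>r. ?E r) \<longlongrightarrow> 0) at_top"
      by (subst tendsto_norm_zero_iff[symmetric]) (simp only: nE)
    \<comment> \<open>The normalising exponential tends to 0, so the constant h1 disappears and
      normalised \<Delta> tends to h0.\<close>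
    then have "((\<lambda>r::real. ?E r * \<phi> (of_real r * v) 1 1 - ?E r * h1) \<longlongrightarrow> e 1 - 0 * h1) at_top"
      by (intro tendsto_diff dom(1) tendsto_mult tendsto_const)
    then have lim: "((\<lambda>r::real. ?E r * \<Delta> (of_real r * v)) \<longlongrightarrow> h0) at_top"
      unfolding \<Delta>_def right_diff_distrib by (simp add: e_simps)
    have evD: "eventually (\<lambda>r::real. norm (?E r * \<Delta> (of_real r * v)) > norm h0 / 2) at_top"
      by (rule order_tendstoD(1)[OF tendsto_norm[OF lim]]) (use h0 in simp)
    obtain K where K: "eventually (\<lambda>r::real. \<forall>j. \<forall>x\<in>{0..1}. norm (\<phi> (of_real r * v) j x) \<le> K * exp (r * Re (\<i> * b 1 * v))) at_top"
      using dom(2) by blast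
    let ?I = "integral {0..1} (\<lambda>x. \<Sum>i\<in>UNIV. norm (g i x))"
    have "eventually (\<lambda>r::real. norm (G (of_real r * v)) \<le> K * ?I / (norm h0 / 2)) at_top"
      using evD K
    proof eventually_elim
      case (elim r)
      have "norm (pairing (\<phi> (of_real r * v)) g) \<le> K * exp (r * Re (\<i> * b 1 * v)) * ?I"
        by (rule pairing_norm_le[OF g \<phi>_continuous]) (use elim(2) in blast)
      then have "norm (?E r) * norm (pairing (\<phi> (of_real r * v)) g) \<le> norm (?E r) * (K * exp (r * Re (\<i> * b 1 * v)) * ?I)"
        by (intro mult_left_mono) auto
      also have "\<dots> = exp (- (3 * r)) * exp (r * 3) * (K * ?I)" unfolding nE v by (simp only: mult_ac)
      also have "exp (- (3 * r)) * exp (r * 3) = 1" by (simp flip: exp_add)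
      finally have "norm (?E r * \<Delta> (of_real r * v)) * norm (G (of_real r * v)) \<le> K * ?I"
        unfolding FG by (simp add: norm_mult mult.assoc)
      moreover have "norm h0 / 2 * norm (G (of_real r * v)) \<le> norm (?E r * \<Delta> (of_real r * v)) * norm (G (of_real r * v))"
        using elim(1) by (intro mult_right_mono) auto
      ultimately have "norm h0 / 2 * norm (G (of_real r * v)) \<le> K * ?I" by linarith
      then show ?case using h0 by (simp add: field_simps)
    qed
    then show ?thesis by blast
  qed
  have "G \<nu> = 0" for \<nu>
  proof (rule entire_eq_0_if_tends_to_0_on_rays[OF G C uv _ limneg[OF uneg]])
    show "\<exists>M. eventually (\<lambda>r::real. norm (G (of_real r * d)) \<le> M) at_top" if "d \<in> {u, v, - u - v}" for d
      using that bdneg[OF uneg] bdv bdneg[OF wneg] by blast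
  qed
  then show ?thesis by (simp add: FG)
qed

lemma z_zero_if_pairing_zero:
  assumes F0: "\<And>\<nu>. pairing (\<phi> \<nu>) g = 0" and x: "x \<in> {0..1}"
  shows "z \<nu> i x = 0"
proof -
  \<comment> \<open>The pairs of rates are now (-1, -1), (2, -1) and (-1, 2). Each has a negative
    entry, and a positive one is handled by the proportionality of the end values.\<close>
  obtain u where u: "Re (\<i> * b 1 * u) = - 1" "Re (\<i> * b 2 * u) = - 1" by (rule direction)
  obtain v where v: "Re (\<i> * b 1 * v) = 2" "Re (\<i> * b 2 * v) = - 1" by (rule direction)
  have w: "Re (\<i> * b 1 * (- u - v)) = - 1" "Re (\<i> * b 2 * (- u - v)) = 2"
    unfolding right_diff_distrib mult_minus_right minus_complex.sel uminus_complex.sel u v by simp_all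
  have uv: "Im (cnj u * v) \<noteq> 0" by (rule independent_directions) (simp only: u v; simp)
  have rel: "e 1 * z \<nu> 1 1 / b 1 + e 2 * z \<nu> 2 1 / b 2 = 0" for \<nu>
    using F0[of \<nu>] unfolding pairing_eq sum_2 by simp
  \<comment> \<open>One constant for both directions of the proportionality, since the positive rate
    belongs to either component depending on the ray.\<close>
  define C where "C = norm (b 1 / (b 2 * h0)) + norm (b 2 * h0 / b 1)"
  have C0: "C \<ge> 0" by (simp add: C_def)
  have z1: "z \<nu> 1 1 = - (b 1 / (b 2 * h0)) * z \<nu> 2 1" and z2: "z \<nu> 2 1 = - (b 2 * h0 / b 1) * z \<nu> 1 1" for \<nu>
  proof -
    have "h0 * z \<nu> 1 1 * b 2 + z \<nu> 2 1 * b 1 = 0"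
      using rel[of \<nu>] b_nz[of 1] b_nz[of 2] by (simp add: e_simps field_simps)
    then have "z \<nu> 2 1 * b 1 = - (h0 * z \<nu> 1 1 * b 2)" by (simp only: eq_neg_iff_add_eq_0 add.commute)
    then show "z \<nu> 1 1 = - (b 1 / (b 2 * h0)) * z \<nu> 2 1" "z \<nu> 2 1 = - (b 2 * h0 / b 1) * z \<nu> 1 1"
      using b_nz[of 1] b_nz[of 2] h0 by (simp_all add: field_simps)
  qed
  have Cle: "norm (z \<nu> j 1) \<le> C * norm (z \<nu> (j + 1) 1)" for \<nu> j
  proof -
    have "norm (z \<nu> 1 1) = norm (b 1 / (b 2 * h0)) * norm (z \<nu> 2 1)" "norm (z \<nu> 2 1) = norm (b 2 * h0 / b 1) * norm (z \<nu> 1 1)"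
      by (subst z1 z2, simp only: norm_mult norm_minus_cancel)+
    moreover have "norm (b 1 / (b 2 * h0)) * norm (z \<nu> 2 1) \<le> C * norm (z \<nu> 2 1)"
      "norm (b 2 * h0 / b 1) * norm (z \<nu> 1 1) \<le> C * norm (z \<nu> 1 1)"
      by (intro mult_right_mono, simp_all add: C_def)+
    ultimately have "norm (z \<nu> 1 1) \<le> C * norm (z \<nu> 2 1)" "norm (z \<nu> 2 1) \<le> C * norm (z \<nu> 1 1)"
      by linarith+
    then have "norm (z \<nu> 1 1) \<le> C * norm (z \<nu> (1 + 1) 1)" "norm (z \<nu> 2 1) \<le> C * norm (z \<nu> (2 + 1) 1)"
      by (simp_all only: plus_one_2)
    then show ?thesis using exhaust_2[of j] by (elim disjE) simp_all
  qed
  have lim: "((\<lambda>r::real. z (of_real r * d) i x) \<longlongrightarrow> 0) at_top" if d: "d \<in> {u, v, - u - v}" for d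
  proof (rule R.decay_on_ray[OF g_refl sol_z z_0 _ _ C0 Cle x])
    show "Re (\<i> * b j * d) \<noteq> 0" for j
      using d exhaust_2[of j] u v w by (auto simp del: times_complex.sel minus_complex.sel uminus_complex.sel)
    show "\<exists>j. Re (\<i> * b j * d) < 0"
    proof -
      have "Re (\<i> * b 1 * d) < 0 \<or> Re (\<i> * b 2 * d) < 0"
        using d u v w by (auto simp del: times_complex.sel minus_complex.sel uminus_complex.sel)
      then show ?thesis by blast
    qed
  qed
  obtain A where A: "A > 0" "\<And>\<nu>. norm (z \<nu> i x) \<le> A * exp (A * norm \<nu>)"
    using z_exponential_type x by blast
  show ?thesis
  proof (rule entire_eq_0_if_tends_to_0_on_rays[OF z_holomorphic[OF x] A(2) uv _ lim])
    fix d assume d: "d \<in> {u, v, - u - v}"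
    have "eventually (\<lambda>r::real. dist (z (of_real r * d) i x) 0 < 1) at_top"
      by (rule tendstoD[OF lim[OF d]]) simp
    then have "eventually (\<lambda>r::real. norm (z (of_real r * d) i x) \<le> 1) at_top"
      by eventually_elim simp
    then show "\<exists>M. eventually (\<lambda>r::real. norm (z (of_real r * d) i x) \<le> M) at_top" by blast
  qed simp
qed

text \<open>Once z vanishes at spectral parameter 0, its equation says that every integral of g from
  1 - x to 1 is zero.\<close>

lemma AE_zero_if_pairing_zero:
  assumes F0: "\<And>\<nu>. pairing (\<phi> \<nu>) g = 0"
  shows "AE x in unit_lebesgue. g i x = 0"
proof (rule AE_eq_0_if_integrals_0)
  show gai: "g i absolutely_integrable_on {0..1}" by (rule square_integrable_imp_absolutely_integrable(1)[OF g])
  have I: "integral {1 - x..1} (g i) = 0" if x: "x \<in> {0..1}" for x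
  proof -
    have sub: "{0..x} \<subseteq> {0..1}" using x by auto
    have "z 0 i x = z 0 i 0 + integral {0..x} (R.rhs 0 (\<lambda>i x. g i (1 - x)) (z 0) i)"
      by (rule R.sol_eq[OF sol_z x])
    then have "integral {0..x} (R.rhs 0 (\<lambda>i x. g i (1 - x)) (z 0) i) = 0"
      using z_zero_if_pairing_zero[OF F0 x, of 0 i] by (simp add: z_0)
    moreover have "integral {0..x} (R.rhs 0 (\<lambda>i x. g i (1 - x)) (z 0) i) = integral {0..x} (\<lambda>t. \<i> * b i * g i (1 - t))"
    proof (rule integral_cong)
      fix t assume "t \<in> {0..x}"
      then have "z 0 j t = 0" for j using sub by (intro z_zero_if_pairing_zero[OF F0]) auto
      then show "R.rhs 0 (\<lambda>i x. g i (1 - x)) (z 0) i t = \<i> * b i * g i (1 - t)"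
        unfolding R.rhs_def by simp
    qed
    moreover have "integral {0..x} (\<lambda>t. \<i> * b i * g i (1 - t)) = \<i> * b i * integral {0..x} (\<lambda>t. g i (1 - t))"
      by (rule integral_mult_right)
    ultimately have "integral {0..x} (\<lambda>t. g i (1 - t)) = 0" using b_nz[of i] by simp
    moreover have "integral {0..x} (\<lambda>t. g i (1 - t)) = integral {1 - x..1} (g i)"
      by (rule integral_reflect_Icc) (rule square_integrable_integrable_on(1)[OF g], use x in auto)
    ultimately show ?thesis by simp
  qed
  show "integral {0..x} (g i) = 0" if x: "x \<in> {0..1}" for x
  proof -
    have "integral {0..1} (g i) - integral {0..x} (g i) = integral {x..1} (g i)"
      by (rule integral_diff_eq[OF gai]) (use x in auto)
    then show ?thesis using I[of 1] I[of "1 - x"] x by simp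
  qed
qed

end

section \<open>Chains of root functions and multiplicities\<close>

lemma Y_pow_sup_bound:
  "\<exists>K\<ge>0. \<forall>u M. (\<forall>i. continuous_on {0..1} (u i)) \<longrightarrow> (\<forall>i. \<forall>t\<in>{0..1}. norm (u i t) \<le> M) \<longrightarrow>
    (\<forall>i. \<forall>x\<in>{0..1}. norm ((Y \<mu> ^^ n) u i x) \<le> K * M)"
proof -
  let ?g = "\<kappa> * (1 + norm \<mu>)"
  have g0: "?g > 0" using \<kappa>_ge1 by (auto intro!: mult_pos_pos add_pos_nonneg)
  define K where "K = (2 * \<beta> / ?g) ^ n * exp ?g"
  have "norm ((Y \<mu> ^^ n) u i x) \<le> K * M"
    if u: "\<And>i. continuous_on {0..1} (u i)" and M: "\<And>i t. t \<in> {0..1} \<Longrightarrow> norm (u i t) \<le> M" and x: "x \<in> {0..1}"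
    for u M i x
  proof -
    have M0: "M \<ge> 0" using order_trans[OF norm_ge_zero M[of 0 1]] by simp
    have "norm ((Y \<mu> ^^ n) u i x) \<le> (2 * \<beta> / ?g) ^ n * M * exp (?g * x)"
    proof (rule Y_pow_bound[OF u order_refl _ x])
      fix i and t :: real assume t: "t \<in> {0..1}"
      have "M * 1 \<le> M * exp (?g * t)" using M0 g0 t by (intro mult_left_mono) auto
      then show "norm (u i t) \<le> M * exp (?g * t)" using M[OF t, of i] by linarith
    qed
    also have "\<dots> \<le> (2 * \<beta> / ?g) ^ n * M * exp ?g"
      using g0 x mult_left_mono[of x 1 ?g] M0 \<beta>_nonneg by (intro mult_left_mono) auto
    finally show ?thesis by (simp only: K_def mult_ac)
  qed
  moreover have "K \<ge> 0" using g0 \<beta>_nonneg by (simp add: K_def)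
  ultimately show ?thesis by blast
qed

lemma pairing_lin:
  fixes y z g :: "2 \<Rightarrow> real \<Rightarrow> complex"
  assumes g: "\<And>i. square_integrable (g i)" and y: "\<And>i. continuous_on {0..1} (y i)"
    and z: "\<And>i. continuous_on {0..1} (z i)"
  shows "pairing (\<lambda>i x. y i x + c * z i x) g = pairing y g + c * pairing z g"
proof -
  have i1: "(\<lambda>x. \<Sum>i\<in>UNIV. y i x * g i x) integrable_on {0..1}"
    and i2: "(\<lambda>x. \<Sum>i\<in>UNIV. z i x * g i x) integrable_on {0..1}"
    by (intro integrable_sum pairing_integrable g y z; simp)+
  have "(\<lambda>x. \<Sum>i\<in>UNIV. (y i x + c * z i x) * g i x)
      = (\<lambda>x. (\<Sum>i\<in>UNIV. y i x * g i x) + c * (\<Sum>i\<in>UNIV. z i x * g i x))"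
    by (simp add: sum_2 algebra_simps)
  then show ?thesis unfolding pairing_def
    using Henstock_Kurzweil_Integration.integral_add[OF i1 integrable_on_mult_right[OF i2, of c]] by simp
qed

lemma pairing_cong:
  fixes y z g :: "2 \<Rightarrow> real \<Rightarrow> complex"
  assumes "\<And>i x. x \<in> {0..1} \<Longrightarrow> y i x = z i x"
  shows "pairing y g = pairing z g"
  unfolding pairing_def by (rule integral_cong) (simp add: assms)

lemma pairing_sum:
  fixes g :: "2 \<Rightarrow> real \<Rightarrow> complex" and y :: "nat \<Rightarrow> 2 \<Rightarrow> real \<Rightarrow> complex" and N :: nat
  assumes g: "\<And>i. square_integrable (g i)" and y: "\<And>n i. continuous_on {0..1} (y n i)"
  shows "pairing (\<lambda>i x. \<Sum>n<N. a n * y n i x) g = (\<Sum>n<N. a n * pairing (y n) g)"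
proof (induction N)
  case 0 then show ?case by (simp add: pairing_def)
next
  case (Suc N)
  have "continuous_on {0..1} (\<lambda>x. \<Sum>n<N. a n * y n i x)" for i
    by (intro continuous_intros y)
  then show ?case using pairing_lin[where y = "\<lambda>i x. \<Sum>n<N. a n * y n i x" and z = "y N" and c = "a N", OF g _ y] Suc
    by simp
qed

lemma \<phi>_expansion:
  assumes "x \<in> {0..1}"
  shows "\<phi> \<nu> i x = (\<Sum>n<N. (\<nu> - \<mu>) ^ n * (Y \<mu> ^^ n) (\<phi> \<mu>) i x) + (\<nu> - \<mu>) ^ N * (Y \<mu> ^^ N) (\<phi> \<nu>) i x"
  by (rule sol_expansion[OF square_integrable_zero sol_\<phi> sol_\<phi> _ assms]) (simp only: \<phi>_0)

lemma remainder_bound: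
  assumes f: "\<And>i. square_integrable (f i)"
    and y: "\<And>\<nu>. sol \<nu> f (y \<nu>)" and 0: "\<And>\<nu> i. y \<nu> i 0 = \<eta> i"
  shows "\<exists>C\<ge>0. \<forall>\<nu>. norm (\<nu> - \<mu>) < 1 \<longrightarrow> (\<forall>i. \<forall>x\<in>{0..1}. norm ((Y \<mu> ^^ N) (y \<nu>) i x) \<le> C)"
proof -
  obtain A where A: "A > 0" "\<And>\<nu> i x. x \<in> {0..1} \<Longrightarrow> norm (y \<nu> i x) \<le> A * exp (A * norm \<nu>)"
    using sol_exponential_type[OF f y 0] by blast
  define M where "M = A * exp (A * (norm \<mu> + 1))"
  obtain K where K: "K \<ge> 0" "\<And>u M i x. (\<forall>i. continuous_on {0..1} (u i)) \<Longrightarrow> (\<forall>i. \<forall>t\<in>{0..1}. norm (u i t) \<le> M) \<Longrightarrow>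
    x \<in> {0..1} \<Longrightarrow> norm ((Y \<mu> ^^ N) u i x) \<le> K * M"
    using Y_pow_sup_bound[where \<mu> = \<mu> and n = N] by blast
  have "norm ((Y \<mu> ^^ N) (y \<nu>) i x) \<le> K * M" if \<nu>: "norm (\<nu> - \<mu>) < 1" and x: "x \<in> {0..1}" for \<nu> i x
  proof (rule K(2)[OF _ _ x])
    show "\<forall>i. continuous_on {0..1} (y \<nu> i)" using sol_continuous[OF y] by blast
    have "norm \<nu> \<le> norm \<mu> + 1" using norm_triangle_sub[of \<nu> \<mu>] \<nu> by linarith
    then have "A * exp (A * norm \<nu>) \<le> M" using A(1) by (simp add: M_def)
    then show "\<forall>i. \<forall>t\<in>{0..1}. norm (y \<nu> i t) \<le> M" using A(2) order_trans by blast
  qed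
  moreover have "K * M \<ge> 0" using K(1) A(1) by (simp add: M_def)
  ultimately show ?thesis by blast
qed

lemma bounded_near:
  assumes "h holomorphic_on UNIV"
  shows "\<exists>C. \<forall>\<nu>. norm (\<nu> - \<mu>) < 1 \<longrightarrow> norm (h \<nu> :: complex) \<le> C"
proof -
  have "continuous_on (cball \<mu> 1) h"
    using holomorphic_on_imp_continuous_on[OF assms] continuous_on_subset by blast
  then have "bounded (h ` cball \<mu> 1)" by (intro compact_imp_bounded compact_continuous_image) auto
  then obtain C where C: "\<And>x. x \<in> h ` cball \<mu> 1 \<Longrightarrow> norm x \<le> C" unfolding bounded_iff by blast
  have "norm (h \<nu>) \<le> C" if "norm (\<nu> - \<mu>) < 1" for \<nu>
    by (rule C, rule imageI) (use that in \<open>simp add: dist_norm norm_minus_commute\<close>)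
  then show ?thesis by blast
qed

text \<open>The left-hand sides, less h1 for n = 0, are the Taylor coefficients of \<Delta> at
  \<mu>. They vanish below the order of the zero, and this is precisely the boundary condition at 1
  for the n-th chain element: its second component is 1 at 0 for n = 0, and 0 for n > 0.\<close>

lemma chain_boundary_values:
  assumes h: "h holomorphic_on UNIV" and \<Delta>: "\<And>\<nu>. \<Delta> \<nu> = (\<nu> - \<mu>) ^ m * h \<nu>" and n: "n < m"
  shows "(Y \<mu> ^^ n) (\<phi> \<mu>) 1 1 = (if n = 0 then h1 else 0)"
proof -
  define a where "a n = (Y \<mu> ^^ n) (\<phi> \<mu>) 1 1 - (if n = 0 then h1 else 0)" for n
  obtain C1 where C1: "\<And>\<nu>. norm (\<nu> - \<mu>) < 1 \<Longrightarrow> norm (h \<nu>) \<le> C1" using bounded_near[OF h] by blast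
  obtain C2 where C2: "\<And>\<nu> i x. norm (\<nu> - \<mu>) < 1 \<Longrightarrow> x \<in> {0..1} \<Longrightarrow> norm ((Y \<mu> ^^ m) (\<phi> \<nu>) i x) \<le> C2"
    using remainder_bound[OF square_integrable_zero sol_\<phi> \<phi>_0] by blast
  have "a n = 0"
  proof (rule coeffs_eq_0_if_small[OF zero_less_one _ n])
    fix t :: complex assume t: "t \<noteq> 0" "norm t < 1"
    define \<nu> where "\<nu> = \<mu> + t"
    have \<nu>: "\<nu> - \<mu> = t" by (simp add: \<nu>_def)
    have "(\<Sum>n<m. (if n = 0 then h1 else 0) * t ^ n) = (\<Sum>n<m. if n = 0 then h1 else 0)"
      by (rule sum.cong) auto
    also have "\<dots> = h1" using n by (subst sum.delta) auto
    finally have s1: "(\<Sum>n<m. (if n = 0 then h1 else 0) * t ^ n) = h1" .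
    have "a n * t ^ n = t ^ n * (Y \<mu> ^^ n) (\<phi> \<mu>) 1 1 - (if n = 0 then h1 else 0) * t ^ n" for n
      unfolding a_def left_diff_distrib by (simp only: mult.commute)
    then have "(\<Sum>n<m. a n * t ^ n) = (\<Sum>n<m. t ^ n * (Y \<mu> ^^ n) (\<phi> \<mu>) 1 1) - h1"
      by (simp only: sum_subtractf s1)
    also have "\<dots> = \<Delta> \<nu> - t ^ m * (Y \<mu> ^^ m) (\<phi> \<nu>) 1 1"
      using \<phi>_expansion[of 1 \<nu> 1 \<mu> m] unfolding \<nu> \<Delta>_def by simp
    also have "\<dots> = t ^ m * (h \<nu> - (Y \<mu> ^^ m) (\<phi> \<nu>) 1 1)"
      unfolding \<Delta> \<nu> by (simp add: right_diff_distrib)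
    finally have "norm (\<Sum>n<m. a n * t ^ n) = norm t ^ m * norm (h \<nu> - (Y \<mu> ^^ m) (\<phi> \<nu>) 1 1)"
      by (simp only: norm_mult norm_power)
    also have "\<dots> \<le> norm t ^ m * (C1 + C2)"
      using norm_triangle_ineq4[of "h \<nu>" "(Y \<mu> ^^ m) (\<phi> \<nu>) 1 1"] C1[of \<nu>] C2[of \<nu> 1 1] t \<nu>
      by (intro mult_left_mono) auto
    finally show "norm (\<Sum>n<m. a n * t ^ n) \<le> (C1 + C2) * norm t ^ m"
      by (simp only: mult.commute)
  qed
  then show ?thesis by (simp add: a_def)
qed

text \<open>The premise of \<open>orth\<close> describes the chains that stay in the domain of the
  operator, without mentioning multiplicities. At a zero of \<Delta> of order m it holds for n < m,
  so the first m Taylor coefficients of the pairing vanish and \<Delta> divides it.\<close>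

lemma AE_zero_if_orthogonal_to_chains:
  assumes g: "\<And>i. square_integrable (g i)"
    and orth: "\<And>\<mu> n. (\<And>k. k \<le> n \<Longrightarrow> (Y \<mu> ^^ k) (\<phi> \<mu>) 1 1 = (if k = 0 then h1 else 0)) \<Longrightarrow>
      pairing ((Y \<mu> ^^ n) (\<phi> \<mu>)) g = 0"
  shows "AE x in unit_lebesgue. g i x = 0"
proof -
  obtain a where a: "\<Delta> a \<noteq> 0" using \<Delta>_nonzero by blast
  have "\<exists>G. G holomorphic_on UNIV \<and> (\<forall>\<nu>. pairing (\<phi> \<nu>) g = \<Delta> \<nu> * G \<nu>)"
  proof (rule entire_quotient[OF pairing_holomorphic[OF g] \<Delta>_holomorphic a])
    fix \<mu> m h assume h: "h holomorphic_on UNIV" "\<And>\<nu>. \<Delta> \<nu> = (\<nu> - \<mu>) ^ m * h \<nu>"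
    have 0: "pairing ((Y \<mu> ^^ n) (\<phi> \<mu>)) g = 0" if "n < m" for n
      by (rule orth, rule chain_boundary_values[OF h]) (use that in simp)
    obtain C where C: "C \<ge> 0" "\<And>\<nu> i x. norm (\<nu> - \<mu>) < 1 \<Longrightarrow> x \<in> {0..1} \<Longrightarrow> norm ((Y \<mu> ^^ m) (\<phi> \<nu>) i x) \<le> C"
      using remainder_bound[OF square_integrable_zero sol_\<phi> \<phi>_0] by blast
    let ?I = "integral {0..1} (\<lambda>x. \<Sum>i\<in>UNIV. norm (g i x))"
    show "\<exists>f. f holomorphic_on UNIV \<and> (\<forall>\<nu>. pairing (\<phi> \<nu>) g = (\<nu> - \<mu>) ^ m * f \<nu>)"
    proof (rule entire_factor_if_small[OF pairing_holomorphic[OF g] zero_less_one])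
      fix \<nu> assume \<nu>: "norm (\<nu> - \<mu>) < 1"
      have c: "continuous_on {0..1} ((Y \<mu> ^^ n) (\<phi> \<mu>) i)" "continuous_on {0..1} ((Y \<mu> ^^ n) (\<phi> \<nu>) i)" for n i
        by (intro continuous_Y_pow \<phi>_continuous)+
      have "pairing (\<phi> \<nu>) g = pairing (\<lambda>i x. (\<Sum>n<m. (\<nu> - \<mu>) ^ n * (Y \<mu> ^^ n) (\<phi> \<mu>) i x) + (\<nu> - \<mu>) ^ m * (Y \<mu> ^^ m) (\<phi> \<nu>) i x) g"
        by (rule pairing_cong) (rule \<phi>_expansion)
      also have "\<dots> = pairing (\<lambda>i x. \<Sum>n<m. (\<nu> - \<mu>) ^ n * (Y \<mu> ^^ n) (\<phi> \<mu>) i x) g + (\<nu> - \<mu>) ^ m * pairing ((Y \<mu> ^^ m) (\<phi> \<nu>)) g"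
        by (rule pairing_lin[OF g _ c(2)]) (intro continuous_intros c)
      also have "pairing (\<lambda>i x. \<Sum>n<m. (\<nu> - \<mu>) ^ n * (Y \<mu> ^^ n) (\<phi> \<mu>) i x) g = 0"
        unfolding pairing_sum[where y = "\<lambda>n. (Y \<mu> ^^ n) (\<phi> \<mu>)", OF g c(1)] by (simp add: 0)
      finally have "norm (pairing (\<phi> \<nu>) g) = norm (\<nu> - \<mu>) ^ m * norm (pairing ((Y \<mu> ^^ m) (\<phi> \<nu>)) g)"
        by (simp add: norm_mult norm_power)
      also have "\<dots> \<le> norm (\<nu> - \<mu>) ^ m * (C * ?I)"
        by (intro mult_left_mono pairing_norm_le[OF g c(2)] C(2)[OF \<nu>]) auto
      finally show "norm (pairing (\<phi> \<nu>) g) \<le> C * ?I * norm (\<nu> - \<mu>) ^ m"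
        by (simp only: mult.commute)
    qed
  qed
  then obtain G where G: "G holomorphic_on UNIV" "\<And>\<nu>. pairing (\<phi> \<nu>) g = \<Delta> \<nu> * G \<nu>" by blast
  show ?thesis
    by (rule AE_zero_if_pairing_zero[OF g pairing_zero_if_divisible[OF g G]])
qed

end

section \<open>Pairs of component functions as elements of L2\<close>

lemma borel_measurable_vec_nth_comp:
  fixes F :: "real \<Rightarrow> ('a::euclidean_space)^'n"
  assumes "F \<in> borel_measurable M"
  shows "(\<lambda>x. F x $ i) \<in> borel_measurable M"
proof -
  have "(\<lambda>v :: 'a^'n. v $ i) \<in> borel_measurable borel"
    by (intro borel_measurable_continuous_onI continuous_intros)
  then show ?thesis using assms by (rule measurable_compose[rotated])
qed

lemma square_integrable_vec_nth:
  fixes F :: "real \<Rightarrow> ('a::euclidean_space)^'n"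
  assumes "square_integrable F"
  shows "square_integrable (\<lambda>x. F x $ i)"
  unfolding square_integrable_def
proof
  have m: "F \<in> borel_measurable unit_lebesgue" and I: "integrable unit_lebesgue (\<lambda>x. (norm (F x))\<^sup>2)"
    using assms by (simp_all add: square_integrable_def)
  show m': "(\<lambda>x. F x $ i) \<in> borel_measurable unit_lebesgue" by (rule borel_measurable_vec_nth_comp[OF m])
  show "integrable unit_lebesgue (\<lambda>x. (norm (F x $ i))\<^sup>2)"
  proof (rule Bochner_Integration.integrable_bound[OF I])
    show "(\<lambda>x. (norm (F x $ i))\<^sup>2) \<in> borel_measurable unit_lebesgue" using m' by measurable
    show "AE x in unit_lebesgue. norm ((norm (F x $ i))\<^sup>2) \<le> norm ((norm (F x))\<^sup>2)"
      by (rule AE_I2) (simp add: power_mono Finite_Cartesian_Product.norm_nth_le)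
  qed
qed

lemma square_integrable_axis:
  fixes f :: "real \<Rightarrow> complex"
  assumes "square_integrable f"
  shows "square_integrable (\<lambda>x. axis i (f x) :: complex^'n)"
proof -
  have n: "norm (axis i c :: complex^'n) = norm c" for c
    by (simp add: norm_vec_def axis_def L2_set_def if_distrib[of norm] if_distrib[of "\<lambda>x. x\<^sup>2"] cong: if_cong)
  have "continuous_on UNIV (\<lambda>c. axis i c :: complex^'n)"
  proof -
    have "continuous_on UNIV (\<lambda>c::complex. if j = i then c else 0)" for j
      by (cases "j = i") simp_all
    then show ?thesis unfolding axis_def by (intro continuous_on_vec_lambda)
  qed
  then have "(\<lambda>c. axis i c :: complex^'n) \<in> borel_measurable borel"
    by (rule borel_measurable_continuous_onI)
  then show ?thesis using assms unfolding square_integrable_def n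
    by (auto intro: measurable_compose[where g = "\<lambda>c. axis i c"])
qed

lemma square_integrable_vec_lambda:
  fixes f :: "2 \<Rightarrow> real \<Rightarrow> complex"
  assumes "\<And>i. square_integrable (f i)"
  shows "square_integrable (\<lambda>x. \<chi> i. f i x)"
proof -
  have "square_integrable (\<lambda>x. axis 1 (f 1 x) + axis 2 (f 2 x) :: complex^2)"
    by (intro square_integrable_add square_integrable_axis assms)
  also have "(\<lambda>x. axis 1 (f 1 x) + axis 2 (f 2 x) :: complex^2) = (\<lambda>x. \<chi> i. f i x)"
    by (simp add: fun_eq_iff vec_eq_iff forall_2 axis_def)
  finally show ?thesis .
qed

definition absv :: "(2 \<Rightarrow> real \<Rightarrow> complex) \<Rightarrow> L2"
  where "absv y = abs_L2 (\<lambda>x. \<chi> i. y i x)"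

definition repv :: "L2 \<Rightarrow> 2 \<Rightarrow> real \<Rightarrow> complex"
  where "repv u i x = rep_L2 u x $ i"

lemma square_integrable_repv: "square_integrable (repv u i)"
  unfolding repv_def[abs_def] by (rule square_integrable_vec_nth[OF square_integrable_rep])

lemma absv_repv: "absv (repv u) = u"
  by (simp add: absv_def repv_def vec_nth_inverse abs_rep_L2)

lemma repv_absv:
  assumes "\<And>i. square_integrable (f i)"
  shows "AE x in unit_lebesgue. repv (absv f) i x = f i x"
  using rep_abs_L2[OF square_integrable_vec_lambda, of f] assms
  unfolding absv_def repv_def by (auto elim!: AE_mp)

lemma absv_cong_AE:
  assumes f: "\<And>i. square_integrable (f i)" and g: "\<And>i. square_integrable (g i)"
    and eq: "\<And>i. AE x in unit_lebesgue. f i x = g i x"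
  shows "absv f = absv g"
  unfolding absv_def
proof (rule abs_L2_eqI[OF square_integrable_vec_lambda[OF f] square_integrable_vec_lambda[OF g]])
  show "AE x in unit_lebesgue. (\<chi> i. f i x) = (\<chi> i. g i x)"
    using eq[of 1] eq[of 2] by eventually_elim (simp add: vec_eq_iff forall_2)
qed

lemma absv_lin:
  assumes f: "\<And>i. square_integrable (f i)" and g: "\<And>i. square_integrable (g i)"
  shows "absv (\<lambda>i x. f i x + c * g i x) = absv f + c *\<^sub>C absv g"
proof -
  have "(\<lambda>x. \<chi> i. f i x + c * g i x) = (\<lambda>x. (\<chi> i. f i x) + c *s (\<chi> i. g i x))"
    by (simp add: fun_eq_iff vec_eq_iff)
  then show ?thesis
    unfolding absv_def abs_L2_scaleC[OF square_integrable_vec_lambda[OF g]]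
    by (simp only: abs_L2_add[OF square_integrable_vec_lambda[OF f] square_integrable_scaleC[OF square_integrable_vec_lambda[OF g]]])
qed

lemma absv_eq_AE:
  assumes f: "\<And>i. square_integrable (f i)" and g: "\<And>i. square_integrable (g i)" and eq: "absv f = absv g"
  shows "AE x in unit_lebesgue. f i x = g i x"
  using repv_absv[of f i, OF f] repv_absv[of g i, OF g] unfolding eq by eventually_elim simp

lemma absv_0: "absv (\<lambda>i x. 0) = 0"
proof -
  have "0 = abs_L2 (\<lambda>x. 0)" by (rule zero_L2.abs_eq)
  then show ?thesis unfolding absv_def by (simp add: zero_vec_def)
qed

lemma inner_absv:
  assumes y: "\<And>i. square_integrable (y i)"
  shows "absv y \<bullet> u = (\<integral>x. (\<Sum>i\<in>UNIV. Re (y i x * cnj (repv u i x))) \<partial>unit_lebesgue)"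
proof -
  have "absv y \<bullet> u = absv y \<bullet> abs_L2 (rep_L2 u)" by (simp only: abs_rep_L2)
  also have "\<dots> = (\<integral>x. (\<chi> i. y i x) \<bullet> rep_L2 u x \<partial>unit_lebesgue)"
    unfolding absv_def by (rule inner_abs_L2[OF square_integrable_vec_lambda[OF y] square_integrable_rep])
  also have "(\<lambda>x. (\<chi> i. y i x) \<bullet> rep_L2 u x) = (\<lambda>x. \<Sum>i\<in>UNIV. Re (y i x * cnj (repv u i x)))"
    by (simp add: inner_vec_def inner_complex_def repv_def)
  finally show ?thesis .
qed

lemma square_integrable_cnj:
  assumes "square_integrable f"
  shows "square_integrable (\<lambda>x. cnj (f x))"
proof -
  have "cnj \<in> borel_measurable borel" by (intro borel_measurable_continuous_onI continuous_intros)
  then have "(\<lambda>x. cnj (f x)) \<in> borel_measurable unit_lebesgue"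
    using assms by (intro measurable_compose[of f _ borel cnj]) (auto simp: square_integrable_def)
  then show ?thesis using assms by (simp add: square_integrable_def)
qed

lemma scaleC_cancel: "x + (- c) *\<^sub>C y + c *\<^sub>C y = (x :: L2)"
  by (simp add: add.assoc flip: cL2.scale_left_distrib)

lemma sum_lessThan_Suc_upd:
  fixes c :: "nat \<Rightarrow> 'a::comm_ring"
  shows "(\<Sum>j<Suc m. (if j = m then r else c j) * x j) = (\<Sum>j<m. c j * x j) + r * x m"
  unfolding sum.lessThan_Suc by (intro arg_cong2[where f = "(+)"] sum.cong) auto

subsection \<open>Functionals on the root subspaces\<close>

text \<open>Finite-dimensional duality without bases: N is embedded by m functionals, and these are
  removed one at a time. If the last one vanishes on V, it either separates y already or all is
  restricted to its kernel K. Otherwise V and y are projected into K along an element of V.\<close>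

lemma separating_functional:
  fixes u :: "nat \<Rightarrow> L2 \<Rightarrow> complex" and V N :: "L2 set"
  assumes lin: "\<And>j x c y. u j (x + c *\<^sub>C y) = u j x + c * u j y"
    and V: "cL2.subspace V" and N: "cL2.subspace N" and VN: "V \<subseteq> N" and y: "y \<in> N" "y \<notin> V"
    and sep: "\<And>x. x \<in> N \<Longrightarrow> (\<And>j. j < m \<Longrightarrow> u j x = 0) \<Longrightarrow> x = 0"
  shows "\<exists>c. (\<forall>x\<in>V. (\<Sum>j<m. c j * u j x) = 0) \<and> (\<Sum>j<m. c j * u j y) \<noteq> 0"
  using V N VN y sep
proof (induction m arbitrary: V N y)
  case 0
  then have "y = 0" by simp
  then show ?case using cL2.subspace_0[OF 0(1)] 0(5) by simp
next
  case (Suc m)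
  have u0: "u j 0 = 0" for j using lin[of j 0 1 0] by simp
  define K where "K = {x. u m x = 0}"
  have K: "cL2.subspace K"
    unfolding cL2.subspace_def K_def using lin[of m 0] lin[of m _ 1] u0 by simp
  have NK: "cL2.subspace (N \<inter> K)" and VK: "cL2.subspace (V \<inter> K)"
    by (intro cL2.subspace_inter Suc.prems K)+
  have sepK: "x = 0" if "x \<in> N \<inter> K" "\<And>j. j < m \<Longrightarrow> u j x = 0" for x
    using Suc.prems(6)[of x] that by (auto simp: K_def less_Suc_eq)
  show ?case
  proof (cases "V \<subseteq> K")
    case True
    show ?thesis
    proof (cases "u m y = 0")
      case False
      have "(\<Sum>j<Suc m. (if j = m then 1 else 0) * u j x) = u m x" for x
        unfolding sum_lessThan_Suc_upd by simp
      then show ?thesis using True False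
        by (intro exI[of _ "\<lambda>j. if j = m then 1 else 0"]) (auto simp: K_def)
    next
      case 0: True
      have "V \<subseteq> N \<inter> K" using True Suc.prems(3) by (rule Int_greatest[rotated])
      moreover have "y \<in> N \<inter> K" using Suc.prems(4) 0 by (simp add: K_def)
      ultimately have "\<exists>c. (\<forall>x\<in>V. (\<Sum>j<m. c j * u j x) = 0) \<and> (\<Sum>j<m. c j * u j y) \<noteq> 0"
        by (rule Suc.IH[OF Suc.prems(1) NK _ _ Suc.prems(5)]) (rule sepK)
      then obtain c where c: "\<forall>x\<in>V. (\<Sum>j<m. c j * u j x) = 0" "(\<Sum>j<m. c j * u j y) \<noteq> 0"
        by (elim exE conjE) (rule that)
      have "(\<Sum>j<Suc m. (if j = m then 0 else c j) * u j x) = (\<Sum>j<m. c j * u j x)" for x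
        unfolding sum_lessThan_Suc_upd by simp
      then show ?thesis using c by (intro exI[of _ "\<lambda>j. if j = m then 0 else c j"]) simp
    qed
  next
    case False
    then obtain v0 where v0: "v0 \<in> V" "u m v0 \<noteq> 0" by (auto simp: K_def)
    define v where "v = (1 / u m v0) *\<^sub>C v0"
    have v: "v \<in> V" "u m v = 1"
      using cL2.subspace_scale[OF Suc.prems(1) v0(1)] lin[of m 0 "1 / u m v0" v0] v0(2) u0 by (auto simp: v_def)
    \<comment> \<open>The projection onto K along v. As v lies in V, it preserves V and N, and keeps
      y outside V.\<close>
    define p where "p x = x + (- u m x) *\<^sub>C v" for x
    have pK: "p x \<in> K" for x unfolding p_def K_def mem_Collect_eq lin v(2) by simp
    have pV: "p x \<in> V" if "x \<in> V" for x
      unfolding p_def by (intro cL2.subspace_add cL2.subspace_scale Suc.prems(1) that v)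
    have pN: "p x \<in> N" if "x \<in> N" for x
      unfolding p_def by (intro cL2.subspace_add cL2.subspace_scale Suc.prems(2) that) (use v Suc.prems(3) in auto)
    have py: "p y \<notin> V \<inter> K"
    proof
      assume "p y \<in> V \<inter> K"
      then have "p y + u m y *\<^sub>C v \<in> V"
        by (intro cL2.subspace_add cL2.subspace_scale Suc.prems(1) v) auto
      then show False using Suc.prems(5) by (simp only: p_def scaleC_cancel)
    qed
    have "V \<inter> K \<subseteq> N \<inter> K" "p y \<in> N \<inter> K" using Suc.prems(3,4) pN pK by auto
    then have "\<exists>c. (\<forall>x\<in>V \<inter> K. (\<Sum>j<m. c j * u j x) = 0) \<and> (\<Sum>j<m. c j * u j (p y)) \<noteq> 0"
      by (rule Suc.IH[OF VK NK _ _ py]) (rule sepK)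
    then obtain c where c: "\<forall>x\<in>V \<inter> K. (\<Sum>j<m. c j * u j x) = 0" "(\<Sum>j<m. c j * u j (p y)) \<noteq> 0"
      by (elim exE conjE) (rule that)
    define G where "G x = (\<Sum>j<m. c j * u j x)" for x
    have Gp: "G (p x) = G x - G v * u m x" for x
    proof -
      have "G (p x) = (\<Sum>j<m. c j * u j x - (c j * u j v) * u m x)"
        unfolding G_def p_def lin by (rule sum.cong) (auto simp: algebra_simps)
      then show ?thesis unfolding G_def sum_subtractf sum_distrib_right .
    qed
    \<comment> \<open>The last coefficient is chosen so that the whole combination becomes G after
      the projection p.\<close>
    have s: "(\<Sum>j<Suc m. (if j = m then - G v else c j) * u j x) = G (p x)" for x
      unfolding Gp sum_lessThan_Suc_upd by (simp add: G_def)
    have "G (p x) = 0" if "x \<in> V" for x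
      unfolding G_def by (rule c(1)[rule_format]) (intro IntI pV pK that)
    moreover have "G (p y) \<noteq> 0" unfolding G_def by (rule c(2))
    ultimately have "(\<forall>x\<in>V. (\<Sum>j<Suc m. (if j = m then - G v else c j) * u j x) = 0)
        \<and> (\<Sum>j<Suc m. (if j = m then - G v else c j) * u j y) \<noteq> 0"
      unfolding s by (intro conjI ballI)
    then show ?thesis by (rule exI[of _ "\<lambda>j. if j = m then - G v else c j"])
  qed
qed

context dirac_bvp
begin

text \<open>By \<open>sol_expansion\<close>, \<open>U \<mu> j x\<close> is the \<open>j\<close>-th Taylor coefficient of \<open>\<nu> \<mapsto> U \<nu> 0 x\<close> at \<open>\<mu>\<close>.\<close>

definition U :: "complex \<Rightarrow> nat \<Rightarrow> L2 \<Rightarrow> complex"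
  where "U \<mu> j x = (Y \<mu> ^^ Suc j) (repv x) 1 1"

lemma continuous_Y: "(\<And>i. square_integrable (f i)) \<Longrightarrow> continuous_on {0..1} (Y \<mu> f i)"
  by (rule sol_continuous[OF sol_Y])

lemma repv_lin: "AE t in unit_lebesgue. repv (x + c *\<^sub>C y) i t = repv x i t + c * repv y i t"
proof -
  have s: "square_integrable (\<lambda>t. repv x i t + c * repv y i t)" for i
    by (intro square_integrable_add square_integrable_cmult square_integrable_repv)
  have "absv (\<lambda>i t. repv x i t + c * repv y i t) = x + c *\<^sub>C y"
    using absv_lin[of "repv x" "repv y" c, OF square_integrable_repv square_integrable_repv]
    by (simp only: absv_repv)
  then show ?thesis using repv_absv[of "\<lambda>i t. repv x i t + c * repv y i t" i, OF s] by (simp only:)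
qed

lemma U_lin: "U \<mu> j (x + c *\<^sub>C y) = U \<mu> j x + c * U \<mu> j y"
proof -
  have "(Y \<mu> ^^ j) (Y \<mu> (repv (x + c *\<^sub>C y))) 1 1 = (Y \<mu> ^^ j) (Y \<mu> (repv x)) 1 1 + c * (Y \<mu> ^^ j) (Y \<mu> (repv y)) 1 1"
  proof (rule Y_pow_lin)
    show "Y \<mu> (repv (x + c *\<^sub>C y)) i t = Y \<mu> (repv x) i t + c * Y \<mu> (repv y) i t" if "t \<in> {0..1}" for i t
      by (rule Y_lin[OF square_integrable_repv square_integrable_repv square_integrable_repv repv_lin that])
  qed (intro continuous_Y square_integrable_repv | simp)+
  then show ?thesis unfolding U_def funpow_Suc_right o_apply .
qed

lemma U_bound: "\<exists>C\<ge>0. \<forall>x. norm (U \<mu> j x) \<le> C * norm x"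
proof -
  obtain C where C: "C \<ge> 0" "\<And>f i x. x \<in> {0..1} \<Longrightarrow> (\<forall>i. square_integrable (f i)) \<Longrightarrow>
    norm ((Y \<mu> ^^ Suc j) f i x) \<le> C * (\<Sum>j\<in>UNIV. integral {0..1} (\<lambda>t. norm (f j t)))"
    using Y_L1_bound[where \<mu> = \<mu> and n = j] by blast
  have "norm (U \<mu> j x) \<le> 2 * C * norm x" for x
  proof -
    have le: "integral {0..1} (\<lambda>t. norm (repv x i t)) \<le> norm x" for i
    proof -
      have ai: "(\<lambda>t. norm (repv x i t)) absolutely_integrable_on {0..1}"
        using absolutely_integrable_norm[OF square_integrable_imp_absolutely_integrable(1)[OF square_integrable_repv]]
        by (simp only: o_def)
      have ai2: "(\<lambda>t. norm (rep_L2 x t)) absolutely_integrable_on {0..1}"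
        using absolutely_integrable_norm[OF square_integrable_imp_absolutely_integrable(1)[OF square_integrable_rep]]
        by (simp only: o_def)
      have "integral {0..1} (\<lambda>t. norm (repv x i t)) = (\<integral>t. norm (repv x i t) \<partial>unit_lebesgue)"
        by (rule integral_unit_lebesgue_eq[OF ai, symmetric])
      also have "\<dots> \<le> (\<integral>t. norm (rep_L2 x t) \<partial>unit_lebesgue)"
        by (rule integral_mono) (use ai ai2 in \<open>simp_all only: integrable_unit_lebesgue_iff repv_def Finite_Cartesian_Product.norm_nth_le\<close>)
      also have "\<dots> \<le> norm (abs_L2 (rep_L2 x))" by (rule integral_norm_le_norm_L2[OF square_integrable_rep])
      finally show ?thesis by (simp only: abs_rep_L2)
    qed
    have "norm (U \<mu> j x) \<le> C * (\<Sum>i\<in>UNIV. integral {0..1} (\<lambda>t. norm (repv x i t)))"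
      unfolding U_def by (rule C(2)) (simp_all add: square_integrable_repv)
    also have "\<dots> \<le> C * (\<Sum>i\<in>(UNIV :: 2 set). norm x)"
      by (intro mult_left_mono sum_mono le C(1))
    finally show ?thesis by (simp add: sum_2)
  qed
  then show ?thesis using C(1) by (intro exI[of _ "2 * C"]) auto
qed

subsection \<open>Root functions\<close>

definition L :: "(L2 \<times> L2) set"
  where "L = dirac_operator (vector [vector [inverse (b 1), 0], vector [0, inverse (b 2)]])
    (\<lambda>x. vector [vector [0, q 1 x], vector [q 2 x, 0]]) h0 h1"

definition bc :: "(2 \<Rightarrow> real \<Rightarrow> complex) \<Rightarrow> bool"
  where "bc y \<longleftrightarrow> y 1 0 = h0 * y 2 0 \<and> y 1 1 = h1 * y 2 0"

lemma dirac_expression: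
  "- (\<i> *s ((vector [vector [inverse (b 1), 0], vector [0, inverse (b 2)]] :: complex^2^2) *v v))
      + (vector [vector [0, q 1 x], vector [q 2 x, 0]] :: complex^2^2) *v w
    = (\<chi> i. - \<i> / b i * v $ i + q i x * w $ (i + 1))"
proof -
  have 3: "(3::2) = 1" by simp
  show ?thesis by (simp add: 3 vec_eq_iff forall_2 matrix_vector_mult_def sum_2 divide_inverse)
qed

lemma integrable_lebesgue_on_Icc_iff:
  fixes f :: "real \<Rightarrow> 'a::euclidean_space"
  shows "integrable (lebesgue_on {a..c}) f \<longleftrightarrow> f absolutely_integrable_on {a..c}"
  by (simp add: set_integrable_def integrable_restrict_space)

lemma vec_integral_nth:
  fixes w :: "real \<Rightarrow> complex^2"
  assumes w: "square_integrable w" and x: "x \<in> {0..1}"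
  shows "(\<integral>t. w t \<partial>lebesgue_on {0..x}) $ i = integral {0..x} (\<lambda>t. w t $ i)"
proof -
  have sub: "{0..x} \<subseteq> {0..1}" using x by auto
  have i: "integrable (lebesgue_on {0..x}) w"
    unfolding integrable_lebesgue_on_Icc_iff
    by (rule absolutely_integrable_on_subinterval[OF square_integrable_imp_absolutely_integrable(1)[OF w] sub])
  have i': "integrable (lebesgue_on {0..x}) (\<lambda>t. w t $ i)"
    unfolding integrable_lebesgue_on_Icc_iff
    by (rule absolutely_integrable_on_subinterval[OF square_integrable_imp_absolutely_integrable(1)[OF square_integrable_vec_nth[OF w]] sub])
  have "(\<integral>t. w t \<partial>lebesgue_on {0..x}) $ i = (\<integral>t. w t $ i \<partial>lebesgue_on {0..x})"
    by (rule integral_bounded_linear[OF bounded_linear_vec_nth i, symmetric])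
  also have "\<dots> = integral {0..x} (\<lambda>t. w t $ i)"
    by (rule lebesgue_integral_eq_integral[OF i']) simp
  finally show ?thesis .
qed

text \<open>As \<open>b i\<close> is nonzero, the derivative of y and the image of y under the
  operator determine each other, so the graph is given by the integrated equation at spectral
  parameter 0.\<close>

lemma L_iff: "(V, W) \<in> L \<longleftrightarrow>
  (\<exists>y f. (\<forall>i. square_integrable (f i)) \<and> sol 0 f y \<and> bc y \<and> V = absv y \<and> W = absv f)"
proof
  assume "(V, W) \<in> L"
  then obtain w w' :: "real \<Rightarrow> complex^2" where w: "W12_deriv w w'" "w 0 $ 1 - h0 * w 0 $ 2 = 0" "w 1 $ 1 - h1 * w 0 $ 2 = 0"
    and V: "V = abs_L2 w" and W: "W = abs_L2 (\<lambda>x. \<chi> i. - \<i> / b i * w' x $ i + q i x * w x $ (i + 1))"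
    unfolding L_def dirac_operator_def dirac_expression
    by (elim CollectE exE conjE Pair_inject) (rule that; assumption)
  define y where "y i x = w x $ i" for i x
  define f where "f i x = - \<i> / b i * w' x $ i + q i x * y (i + 1) x" for i x
  have w's: "square_integrable w'" using w(1) by (simp add: W12_deriv_def)
  have eq: "y i x = y i 0 + integral {0..x} (\<lambda>t. w' t $ i)" if x: "x \<in> {0..1}" for i x
  proof -
    have "w x = w 0 + (\<integral>t. w' t \<partial>lebesgue_on {0..x})" 
      by (rule bspec[OF conjunct2[OF w(1)[unfolded W12_deriv_def]] x])
    then have "w x $ i = w 0 $ i + (\<integral>t. w' t \<partial>lebesgue_on {0..x}) $ i" by (simp only: vector_add_component)
    then show ?thesis unfolding y_def vec_integral_nth[OF w's x] .
  qed
  have yc: "continuous_on {0..1} (y i)" for i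
  proof -
    have "continuous_on {0..1} (\<lambda>x. y i 0 + integral {0..x} (\<lambda>t. w' t $ i))"
      by (intro continuous_intros indefinite_integral_continuous_1
          square_integrable_integrable_on(1)[OF square_integrable_vec_nth[OF w's]] order_refl)
    then show ?thesis by (rule continuous_on_eq) (rule eq[symmetric])
  qed
  have f: "square_integrable (f i)" for i
    unfolding f_def[abs_def]
    by (intro square_integrable_add square_integrable_cmult square_integrable_vec_nth w's
        square_integrable_mult_continuous sq yc)
  have r: "rhs 0 f y i = (\<lambda>t. w' t $ i)" for i
  proof
    fix t
    have "\<i> * b i * (0 * u + (- \<i> / b i * v + c) - c) = v" for u v c :: complex
      using b_nz[of i] by simp
    then show "rhs 0 f y i t = w' t $ i" unfolding rhs_def f_def .
  qed
  have y: "sol 0 f y" by (rule solI[OF yc]) (unfold r, rule eq)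
  have bc: "bc y" using w(2,3) by (simp add: bc_def y_def)
  have V': "V = absv y" unfolding V absv_def y_def by (simp add: vec_nth_inverse)
  have W': "W = absv f" unfolding W absv_def f_def y_def ..
  show "\<exists>y f. (\<forall>i. square_integrable (f i)) \<and> sol 0 f y \<and> bc y \<and> V = absv y \<and> W = absv f"
    by (intro exI[of _ y] exI[of _ f] conjI allI f y bc V' W')
next
  assume "\<exists>y f. (\<forall>i. square_integrable (f i)) \<and> sol 0 f y \<and> bc y \<and> V = absv y \<and> W = absv f"
  then obtain y f where f: "\<And>i. square_integrable (f i)" and y: "sol 0 f y" and bc: "bc y"
    and V: "V = absv y" and W: "W = absv f" by blast
  define w :: "real \<Rightarrow> complex^2" where "w x = (\<chi> i. y i x)" for x
  define w' :: "real \<Rightarrow> complex^2" where "w' x = (\<chi> i. rhs 0 f y i x)" for x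
  have w's: "square_integrable w'" unfolding w'_def[abs_def]
    by (intro square_integrable_vec_lambda square_integrable_rhs f sol_continuous[OF y])
  have W12: "W12_deriv w w'" unfolding W12_deriv_def
  proof (intro conjI ballI w's)
    fix x :: real assume x: "x \<in> {0..1}"
    show "w x = w 0 + (\<integral>t. w' t \<partial>lebesgue_on {0..x})"
      unfolding vec_eq_iff
    proof
      fix i
      have "integral {0..x} (\<lambda>t. w' t $ i) = integral {0..x} (rhs 0 f y i)"
        by (simp add: w'_def)
      then show "w x $ i = (w 0 + (\<integral>t. w' t \<partial>lebesgue_on {0..x})) $ i"
        unfolding vector_add_component vec_integral_nth[OF w's x]
        using sol_eq[OF y x, of i] by (simp only: w_def vec_lambda_beta)
    qed
  qed
  have bc': "w 0 $ 1 - h0 * w 0 $ 2 = 0" "w 1 $ 1 - h1 * w 0 $ 2 = 0"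
    using bc by (simp_all add: bc_def w_def)
  have V': "V = abs_L2 w" by (simp add: V absv_def w_def[abs_def])
  have "(\<lambda>x. \<chi> i. - \<i> / b i * w' x $ i + q i x * w x $ (i + 1)) = (\<lambda>x. \<chi> i. f i x)"
  proof -
    have "- \<i> / b i * (\<i> * b i * (0 * u + v - c)) + c = v" for i and u v c :: complex
      using b_nz[of i] by (simp add: field_simps)
    then show ?thesis by (simp only: w'_def w_def vec_lambda_beta rhs_def)
  qed
  then have W': "W = abs_L2 (\<lambda>x. \<chi> i. - \<i> / b i * w' x $ i + q i x * w x $ (i + 1))"
    by (simp only: W absv_def)
  have "(V, W) = (abs_L2 w, abs_L2 (\<lambda>x. \<chi> i. - \<i> / b i * w' x $ i + q i x * w x $ (i + 1)))"
    using V' W' by (rule arg_cong2)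
  then show "(V, W) \<in> L" unfolding L_def dirac_operator_def dirac_expression
    by (intro CollectI exI[of _ w] exI[of _ w'] conjI W12 bc')
qed

lemma shifted_iff: "(V, W) \<in> shifted L \<mu> \<longleftrightarrow>
  (\<exists>y f. (\<forall>i. square_integrable (f i)) \<and> sol \<mu> f y \<and> bc y \<and> V = absv y \<and> W = absv f)"
proof
  assume "(V, W) \<in> shifted L \<mu>"
  then obtain W' where W': "(V, W') \<in> L" "W = W' - \<mu> *\<^sub>C V" by (auto simp: shifted_def)
  then obtain y f where f: "\<And>i. square_integrable (f i)" and y: "sol 0 f y" and bc: "bc y"
    and V: "V = absv y" and f': "W' = absv f" unfolding L_iff by blast
  have ys: "\<And>i. square_integrable (y i)" by (rule square_integrable_continuous[OF sol_continuous[OF y]])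
  have s: "sol \<mu> (\<lambda>i t. f i t + (0 - \<mu>) * y i t) y" by (rule sol_shift[OF y])
  have W: "W = absv (\<lambda>i t. f i t + (0 - \<mu>) * y i t)"
    unfolding absv_lin[of f y, OF f ys] W'(2) V f' by simp
  show "\<exists>y f. (\<forall>i. square_integrable (f i)) \<and> sol \<mu> f y \<and> bc y \<and> V = absv y \<and> W = absv f"
    by (intro exI[of _ y] exI[of _ "\<lambda>i t. f i t + (0 - \<mu>) * y i t"] conjI allI s bc V W
        square_integrable_add square_integrable_cmult f ys)
next
  assume "\<exists>y f. (\<forall>i. square_integrable (f i)) \<and> sol \<mu> f y \<and> bc y \<and> V = absv y \<and> W = absv f"
  then obtain y f where f: "\<And>i. square_integrable (f i)" and y: "sol \<mu> f y" and bc: "bc y"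
    and V: "V = absv y" and W: "W = absv f" by blast
  have ys: "\<And>i. square_integrable (y i)" by (rule square_integrable_continuous[OF sol_continuous[OF y]])
  have s: "sol 0 (\<lambda>i t. f i t + (\<mu> - 0) * y i t) y" by (rule sol_shift[OF y])
  have "(V, absv (\<lambda>i t. f i t + (\<mu> - 0) * y i t)) \<in> L" unfolding L_iff
    by (intro exI[of _ y] exI[of _ "\<lambda>i t. f i t + (\<mu> - 0) * y i t"] conjI allI s bc V refl
        square_integrable_add square_integrable_cmult f ys)
  moreover have "absv (\<lambda>i t. f i t + (\<mu> - 0) * y i t) = W + \<mu> *\<^sub>C V"
    unfolding absv_lin[of f y, OF f ys] V W by simp
  ultimately show "(V, W) \<in> shifted L \<mu>" unfolding shifted_def by force
qed

lemma shiftedI: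
  assumes "\<And>i. square_integrable (f i)" "sol \<mu> f y" "bc y"
  shows "(absv y, absv f) \<in> shifted L \<mu>"
  unfolding shifted_iff by (intro exI[of _ y] exI[of _ f] conjI allI assms refl)

lemma shifted_lin:
  assumes "(x, p) \<in> shifted L \<mu>" "(x', p') \<in> shifted L \<mu>"
  shows "(x + c *\<^sub>C x', p + c *\<^sub>C p') \<in> shifted L \<mu>"
proof -
  obtain y f where 1: "\<And>i. square_integrable (f i)" "sol \<mu> f y" "bc y" "x = absv y" "p = absv f"
    using assms(1) unfolding shifted_iff by blast
  obtain y' f' where 2: "\<And>i. square_integrable (f' i)" "sol \<mu> f' y'" "bc y'" "x' = absv y'" "p' = absv f'"
    using assms(2) unfolding shifted_iff by blast
  have ys: "\<And>i. square_integrable (y i)" "\<And>i. square_integrable (y' i)"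
    by (rule square_integrable_continuous[OF sol_continuous[OF 1(2)]], rule square_integrable_continuous[OF sol_continuous[OF 2(2)]])
  have s: "sol \<mu> (\<lambda>i t. f i t + c * f' i t) (\<lambda>i t. y i t + c * y' i t)"
    using sol_lin[where f = f and g = f' and c = c, OF 1(1) 2(1) 1(2) 2(2)] .
  have bc: "bc (\<lambda>i t. y i t + c * y' i t)" using 1(3) 2(3) by (simp add: bc_def algebra_simps)
  have "(absv (\<lambda>i t. y i t + c * y' i t), absv (\<lambda>i t. f i t + c * f' i t)) \<in> shifted L \<mu>"
    by (intro shiftedI s bc square_integrable_add square_integrable_cmult 1(1) 2(1))
  then show ?thesis
    unfolding absv_lin[of y y', OF ys] absv_lin[of f f', OF 1(1) 2(1)] 1(4,5) 2(4,5) .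
qed

lemma shifted_0: "(0, 0) \<in> shifted L \<mu>"
proof -
  have "(absv (\<lambda>i t. 0), absv (\<lambda>i t. 0)) \<in> shifted L \<mu>"
    by (intro shiftedI square_integrable_zero solI) (simp_all add: rhs_def[abs_def] bc_def)
  then show ?thesis by (simp only: absv_0)
qed

lemma shifted_pow_lin:
  assumes "(x, p) \<in> shifted L \<mu> ^^ k" "(x', p') \<in> shifted L \<mu> ^^ k"
  shows "(x + c *\<^sub>C x', p + c *\<^sub>C p') \<in> shifted L \<mu> ^^ k"
  using assms
proof (induction k arbitrary: p p')
  case (Suc k)
  then obtain w w' where "(x, w) \<in> shifted L \<mu> ^^ k" "(w, p) \<in> shifted L \<mu>"
    "(x', w') \<in> shifted L \<mu> ^^ k" "(w', p') \<in> shifted L \<mu>" by auto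
  then have "(x + c *\<^sub>C x', w + c *\<^sub>C w') \<in> shifted L \<mu> ^^ k" "(w + c *\<^sub>C w', p + c *\<^sub>C p') \<in> shifted L \<mu>"
    using Suc.IH shifted_lin by blast+
  then show ?case by auto
qed simp

lemma shifted_pow_0: "(0, 0) \<in> shifted L \<mu> ^^ k"
  by (induction k) (auto intro: shifted_0)

lemma kernel_pow_mono: "k \<le> n \<Longrightarrow> kernel (shifted L \<mu> ^^ k) \<subseteq> kernel (shifted L \<mu> ^^ n)"
proof
  fix v assume "k \<le> n" "v \<in> kernel (shifted L \<mu> ^^ k)"
  then have "(v, 0) \<in> shifted L \<mu> ^^ (k + (n - k))"
    unfolding relpow_add using shifted_pow_0 by (auto simp: kernel_def)
  then show "v \<in> kernel (shifted L \<mu> ^^ n)" using \<open>k \<le> n\<close> by (simp add: kernel_def)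
qed

text \<open>The kernels of the powers increase, so any two elements lie in a common one and their
  union is already a subspace.\<close>

lemma root_subspace_eq: "root_subspace L \<mu> = (\<Union>k. kernel (shifted L \<mu> ^^ k))"
proof -
  have lin: "x + c *\<^sub>C y \<in> (\<Union>k. kernel (shifted L \<mu> ^^ k))"
    if "x \<in> (\<Union>k. kernel (shifted L \<mu> ^^ k))" "y \<in> (\<Union>k. kernel (shifted L \<mu> ^^ k))" for x y c
  proof -
    note xy = that
    obtain k where "x \<in> kernel (shifted L \<mu> ^^ k)" using xy(1) by blast
    moreover obtain l where "y \<in> kernel (shifted L \<mu> ^^ l)" using xy(2) by blast
    ultimately have "x \<in> kernel (shifted L \<mu> ^^ max k l)" "y \<in> kernel (shifted L \<mu> ^^ max k l)"
      using kernel_pow_mono[of k "max k l"] kernel_pow_mono[of l "max k l"] by auto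
    then have "(x + c *\<^sub>C y, 0 + c *\<^sub>C 0) \<in> shifted L \<mu> ^^ max k l"
      unfolding kernel_def mem_Collect_eq by (rule shifted_pow_lin)
    then show ?thesis by (auto simp: kernel_def)
  qed
  have z: "0 \<in> (\<Union>k. kernel (shifted L \<mu> ^^ k))" using shifted_pow_0 by (auto simp: kernel_def)
  have "cL2.subspace (\<Union>k. kernel (shifted L \<mu> ^^ k))"
    unfolding cL2.subspace_def
  proof (intro conjI allI ballI z)
    show "x + y \<in> (\<Union>k. kernel (shifted L \<mu> ^^ k))"
      if "x \<in> (\<Union>k. kernel (shifted L \<mu> ^^ k))" "y \<in> (\<Union>k. kernel (shifted L \<mu> ^^ k))" for x y
      using lin[OF that, of 1] by simp
    show "c *\<^sub>C x \<in> (\<Union>k. kernel (shifted L \<mu> ^^ k))"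
      if "x \<in> (\<Union>k. kernel (shifted L \<mu> ^^ k))" for c x
      using lin[OF z that, of c] by simp
  qed
  then show ?thesis unfolding root_subspace_def by (simp only: cL2.span_eq_iff)
qed

section \<open>Root subspaces and the Taylor coefficients of the resolvent\<close>

text \<open>Subtracting y_2(0) times \<open>\<phi> \<nu>\<close> from y gives zero initial values,
  by the boundary condition at 0. The difference is therefore \<open>Y \<nu>\<close> applied to the
  shifted source, and by the condition at 1 its first component there is -\<Delta> \<nu>
  y_2(0).\<close>

lemma U_shifted:
  assumes f: "\<And>i. square_integrable (f i)" and y: "sol \<mu> f y" and bc: "bc y"
  shows "U \<nu> 0 (absv f) + (\<mu> - \<nu>) * U \<nu> 0 (absv y) = - \<Delta> \<nu> * y 2 0"
proof -
  have ys: "\<And>i. square_integrable (y i)" by (rule square_integrable_continuous[OF sol_continuous[OF y]])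
  define F where "F i t = f i t + (\<mu> - \<nu>) * y i t" for i t
  have F: "square_integrable (F i)" for i unfolding F_def[abs_def]
    by (intro square_integrable_add square_integrable_cmult f ys)
  have sF: "sol \<nu> F y" unfolding F_def[abs_def] by (rule sol_shift[OF y])
  have "sol \<nu> (\<lambda>i t. F i t + (- y 2 0) * 0) (\<lambda>i t. y i t + (- y 2 0) * \<phi> \<nu> i t)"
    using sol_lin[where f = F and g = "\<lambda>i t. 0" and c = "- y 2 0", OF F square_integrable_zero sF sol_\<phi>] .
  then have s: "sol \<nu> F (\<lambda>i t. y i t + (- y 2 0) * \<phi> \<nu> i t)" by simp
  have i0: "y i 0 + (- y 2 0) * \<phi> \<nu> i 0 = 0" for i
    using exhaust_2[of i] bc by (auto simp: \<phi>_0 e_simps bc_def)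
  have "Y \<nu> F 1 1 = y 1 1 + (- y 2 0) * \<phi> \<nu> 1 1"
    by (rule sol_unique[where f = F, OF F sol_Y[OF F] s]) (simp_all only: i0 Y_0[OF F], simp)
  also have "\<dots> = - \<Delta> \<nu> * y 2 0" using bc by (simp add: bc_def \<Delta>_def algebra_simps)
  finally have YF: "Y \<nu> F 1 1 = - \<Delta> \<nu> * y 2 0" .
  have "AE t in unit_lebesgue. F i t = repv (absv f) i t + (\<mu> - \<nu>) * repv (absv y) i t" for i
    using repv_absv[of f i, OF f] repv_absv[of y i, OF ys] by eventually_elim (simp add: F_def)
  then have "Y \<nu> F 1 1 = Y \<nu> (repv (absv f)) 1 1 + (\<mu> - \<nu>) * Y \<nu> (repv (absv y)) 1 1"
    by (intro Y_lin[OF square_integrable_repv square_integrable_repv F]) simp_all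
  then show ?thesis using YF by (simp add: U_def)
qed

text \<open>On a root vector the resolvent functional is \<Delta> times a rational function whose
  only pole is \<mu>, of order at most k. The numbers a j are the values y_2(0) along its chain. If
  all are zero, every chain element has zero initial values and a zero source, and so
  vanishes.\<close>

lemma kernel_pow_U:
  assumes "v \<in> kernel (shifted L \<mu> ^^ k)"
  shows "\<exists>a. (\<forall>\<nu>. (\<nu> - \<mu>) ^ k * U \<nu> 0 v = \<Delta> \<nu> * (\<Sum>j<k. a j * (\<nu> - \<mu>) ^ j)) \<and> ((\<forall>j<k. a j = 0) \<longrightarrow> v = 0)"
  using assms
proof (induction k arbitrary: v)
  case 0
  then have "v = 0" by (simp add: kernel_def)
  moreover have "U \<nu> 0 0 = 0" for \<nu> using U_lin[of \<nu> 0 0 1 0] by simp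
  ultimately show ?case by simp
next
  case (Suc k)
  then obtain w where vw: "(v, w) \<in> shifted L \<mu>" and w: "w \<in> kernel (shifted L \<mu> ^^ k)"
    unfolding kernel_def by (blast elim: relpow_Suc_E2)
  obtain a where a: "\<And>\<nu>. (\<nu> - \<mu>) ^ k * U \<nu> 0 w = \<Delta> \<nu> * (\<Sum>j<k. a j * (\<nu> - \<mu>) ^ j)" "(\<forall>j<k. a j = 0) \<Longrightarrow> w = 0"
    using Suc.IH[OF w] by blast
  obtain y f where f: "\<And>i. square_integrable (f i)" and y: "sol \<mu> f y" and bc: "bc y"
    and v: "v = absv y" and w': "w = absv f" using vw unfolding shifted_iff by blast
  have ys: "\<And>i. square_integrable (y i)" by (rule square_integrable_continuous[OF sol_continuous[OF y]])
  \<comment> \<open>The newest chain element contributes the top coefficient; the others are those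
    of its image w.\<close>
  define a' where "a' j = (if j = k then y 2 0 else a j)" for j
  have "(\<nu> - \<mu>) ^ Suc k * U \<nu> 0 v = \<Delta> \<nu> * (\<Sum>j<Suc k. a' j * (\<nu> - \<mu>) ^ j)" for \<nu>
  proof -
    have "U \<nu> 0 w + (\<mu> - \<nu>) * U \<nu> 0 v = - \<Delta> \<nu> * y 2 0"
      unfolding v w' by (rule U_shifted[OF f y bc])
    then have "(\<nu> - \<mu>) * U \<nu> 0 v = U \<nu> 0 w + \<Delta> \<nu> * y 2 0"
      by (simp add: algebra_simps)
    then have "(\<nu> - \<mu>) ^ Suc k * U \<nu> 0 v = (\<nu> - \<mu>) ^ k * (U \<nu> 0 w + \<Delta> \<nu> * y 2 0)"
      by (simp only: power_Suc2 mult.assoc)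
    also have "\<dots> = \<Delta> \<nu> * ((\<Sum>j<k. a j * (\<nu> - \<mu>) ^ j) + y 2 0 * (\<nu> - \<mu>) ^ k)"
      unfolding distrib_left a(1) by (simp only: mult_ac)
    also have "(\<Sum>j<k. a j * (\<nu> - \<mu>) ^ j) = (\<Sum>j<k. a' j * (\<nu> - \<mu>) ^ j)"
      by (rule sum.cong) (auto simp: a'_def)
    finally show ?thesis by (simp add: a'_def)
  qed
  moreover have "v = 0" if 0: "\<forall>j<Suc k. a' j = 0"
  proof -
    have "\<forall>j<k. a j = 0"
    proof (intro allI impI)
      fix j assume "j < k"
      then show "a j = 0" using 0[rule_format, of j] by (simp add: a'_def)
    qed
    then have "absv f = absv (\<lambda>i t. 0)" using a(2) by (simp add: w' absv_0)
    then have "AE t in unit_lebesgue. f i t = 0" for i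
      by (intro absv_eq_AE[of f "\<lambda>i t. 0"] f square_integrable_zero)
    then have s: "sol \<mu> (\<lambda>i t. 0) y" by (rule sol_cong_AE[OF _ y])
    have "y 2 0 = 0" using 0[rule_format, of k] by (simp add: a'_def)
    then have y0: "y i 0 = 0" for i using bc exhaust_2[of i] by (auto simp: bc_def)
    have s0: "sol \<mu> (\<lambda>i t. 0) (\<lambda>i t. 0)" by (rule solI) (simp_all add: rhs_def[abs_def])
    have "y i x = 0" if "x \<in> {0..1}" for i x
      by (rule sol_unique[where f = "\<lambda>i t. 0" and z = "\<lambda>i t. 0", OF square_integrable_zero s s0 y0 that])
    then have "absv y = absv (\<lambda>i t. 0)"
      by (intro absv_cong_AE ys square_integrable_zero AE_I2) simp
    then show ?thesis by (simp add: v absv_0)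
  qed
  ultimately show ?case by blast
qed

lemma U_expansion:
  "\<exists>C\<ge>0. \<forall>\<nu>. norm (\<nu> - \<mu>) < 1 \<longrightarrow> norm (U \<nu> 0 v - (\<Sum>n<m. U \<mu> n v * (\<nu> - \<mu>) ^ n)) \<le> C * norm (\<nu> - \<mu>) ^ m"
proof -
  note f = square_integrable_repv[of v]
  obtain C where C: "C \<ge> 0" "\<And>\<nu> i x. norm (\<nu> - \<mu>) < 1 \<Longrightarrow> x \<in> {0..1} \<Longrightarrow> norm ((Y \<mu> ^^ m) (Y \<nu> (repv v)) i x) \<le> C"
    using remainder_bound[where y = "\<lambda>\<nu>. Y \<nu> (repv v)" and \<mu> = \<mu> and N = m, OF f sol_Y[OF f] Y_0[OF f]] by blast
  have "norm (U \<nu> 0 v - (\<Sum>n<m. U \<mu> n v * (\<nu> - \<mu>) ^ n)) \<le> C * norm (\<nu> - \<mu>) ^ m" if \<nu>: "norm (\<nu> - \<mu>) < 1" for \<nu>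
  proof -
    have "Y \<nu> (repv v) 1 1 = (\<Sum>n<m. (\<nu> - \<mu>) ^ n * (Y \<mu> ^^ n) (Y \<mu> (repv v)) 1 1) + (\<nu> - \<mu>) ^ m * (Y \<mu> ^^ m) (Y \<nu> (repv v)) 1 1"
      by (rule sol_expansion[OF f sol_Y[OF f] sol_Y[OF f]]) (simp_all add: Y_0 f)
    moreover have "(\<nu> - \<mu>) ^ n * (Y \<mu> ^^ n) (Y \<mu> (repv v)) 1 1 = U \<mu> n v * (\<nu> - \<mu>) ^ n" for n
      unfolding U_def funpow_Suc_right o_apply by (rule mult.commute)
    ultimately have "U \<nu> 0 v - (\<Sum>n<m. U \<mu> n v * (\<nu> - \<mu>) ^ n) = (\<nu> - \<mu>) ^ m * (Y \<mu> ^^ m) (Y \<nu> (repv v)) 1 1"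
      by (simp add: U_def)
    also have "norm \<dots> \<le> norm (\<nu> - \<mu>) ^ m * C"
      unfolding norm_mult norm_power by (intro mult_left_mono C(2) \<nu>) auto
    finally show ?thesis by (simp only: mult.commute)
  qed
  then show ?thesis using C(1) by blast
qed

text \<open>Near \<mu>0 the factor (\<nu> - \<mu>)^k in \<open>kernel_pow_U\<close> is bounded away
  from 0, so the functional inherits the zero of \<Delta> of order m and its first m Taylor
  coefficients vanish.\<close>

lemma U_eq_0_on_other_root_subspaces:
  assumes v: "v \<in> kernel (shifted L \<mu> ^^ k)" and ne: "\<mu> \<noteq> \<mu>0"
    and h: "h holomorphic_on UNIV" and \<Delta>: "\<And>\<nu>. \<Delta> \<nu> = (\<nu> - \<mu>0) ^ m * h \<nu>" and n: "n < m"
  shows "U \<mu>0 n v = 0"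
proof -
  obtain a where a: "\<And>\<nu>. (\<nu> - \<mu>) ^ k * U \<nu> 0 v = \<Delta> \<nu> * (\<Sum>j<k. a j * (\<nu> - \<mu>) ^ j)"
    using kernel_pow_U[OF v] by blast
  define p where "p \<nu> = h \<nu> * (\<Sum>j<k. a j * (\<nu> - \<mu>) ^ j)" for \<nu>
  have "p holomorphic_on UNIV" unfolding p_def by (intro holomorphic_intros h)
  then obtain C1 where C1: "\<And>\<nu>. norm (\<nu> - \<mu>0) < 1 \<Longrightarrow> norm (p \<nu>) \<le> C1" using bounded_near by blast
  obtain C2 where C2: "\<And>\<nu>. norm (\<nu> - \<mu>0) < 1 \<Longrightarrow> norm (U \<nu> 0 v - (\<Sum>n<m. U \<mu>0 n v * (\<nu> - \<mu>0) ^ n)) \<le> C2 * norm (\<nu> - \<mu>0) ^ m"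
    using U_expansion by blast
  \<comment> \<open>Within half the distance between the two points, |\<nu> - \<mu>| stays at least
    d.\<close>
  define d where "d = norm (\<mu> - \<mu>0) / 2"
  have d: "d > 0" using ne by (simp add: d_def)
  have "min 1 d > 0" using d by simp
  then show ?thesis
  proof (rule coeffs_eq_0_if_small[OF _ _ n])
    fix t :: complex assume t: "norm t < min 1 d"
    define \<nu> where "\<nu> = \<mu>0 + t"
    have \<nu>: "\<nu> - \<mu>0 = t" by (simp add: \<nu>_def)
    have "norm (\<mu> - \<mu>0) \<le> norm (\<nu> - \<mu>) + norm t"
      using norm_triangle_ineq4[of t "\<nu> - \<mu>"] unfolding \<nu>_def by (simp add: algebra_simps)
    then have dle: "d \<le> norm (\<nu> - \<mu>)" using t by (simp add: d_def)
    have "norm (\<nu> - \<mu>) ^ k * norm (U \<nu> 0 v) = norm t ^ m * norm (p \<nu>)"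
      using arg_cong[OF a[of \<nu>], of norm] by (simp add: \<Delta> \<nu> p_def norm_mult norm_power mult.assoc)
    moreover have "d ^ k * norm (U \<nu> 0 v) \<le> norm (\<nu> - \<mu>) ^ k * norm (U \<nu> 0 v)"
      using dle d by (intro mult_right_mono power_mono) auto
    moreover have "norm t ^ m * norm (p \<nu>) \<le> norm t ^ m * C1"
      using C1[of \<nu>] t \<nu> by (intro mult_left_mono) auto
    ultimately have "d ^ k * norm (U \<nu> 0 v) \<le> norm t ^ m * C1" by linarith
    then have Ule: "norm (U \<nu> 0 v) \<le> C1 / d ^ k * norm t ^ m" using d by (simp add: field_simps)
    have "norm (\<Sum>n<m. U \<mu>0 n v * t ^ n) \<le> norm (U \<nu> 0 v) + norm (U \<nu> 0 v - (\<Sum>n<m. U \<mu>0 n v * t ^ n))"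
      using norm_triangle_ineq4[of "U \<nu> 0 v" "U \<nu> 0 v - (\<Sum>n<m. U \<mu>0 n v * t ^ n)"] by simp
    then show "norm (\<Sum>n<m. U \<mu>0 n v * t ^ n) \<le> (C1 / d ^ k + C2) * norm t ^ m"
      using Ule C2[of \<nu>] t unfolding \<nu> distrib_right by simp
  qed
qed

text \<open>If the first m coefficients vanish, the functional is O(t^m). In the identity of
  \<open>kernel_pow_U\<close> the power t^m then cancels, since h is nonzero at \<mu>, and the
  polynomial in the a j, of degree below k, is O(t^k). So all a j are zero.\<close>

lemma U_separates_root_subspace:
  assumes v: "v \<in> kernel (shifted L \<mu> ^^ k)"
    and h: "h holomorphic_on UNIV" "h \<mu> \<noteq> 0" and \<Delta>: "\<And>\<nu>. \<Delta> \<nu> = (\<nu> - \<mu>) ^ m * h \<nu>"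
    and 0: "\<And>n. n < m \<Longrightarrow> U \<mu> n v = 0"
  shows "v = 0"
proof -
  obtain a where a: "\<And>\<nu>. (\<nu> - \<mu>) ^ k * U \<nu> 0 v = \<Delta> \<nu> * (\<Sum>j<k. a j * (\<nu> - \<mu>) ^ j)" "(\<forall>j<k. a j = 0) \<Longrightarrow> v = 0"
    using kernel_pow_U[OF v] by blast
  obtain C where "\<And>\<nu>. norm (\<nu> - \<mu>) < 1 \<Longrightarrow> norm (U \<nu> 0 v - (\<Sum>n<m. U \<mu> n v * (\<nu> - \<mu>) ^ n)) \<le> C * norm (\<nu> - \<mu>) ^ m"
    using U_expansion by blast
  then have C: "norm (U \<nu> 0 v) \<le> C * norm (\<nu> - \<mu>) ^ m" if "norm (\<nu> - \<mu>) < 1" for \<nu>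
    using that by (simp add: 0)
  define c where "c = norm (h \<mu>) / 2"
  have c: "c > 0" using h(2) by (simp add: c_def)
  have "isCont h \<mu>" using holomorphic_on_imp_continuous_on[OF h(1)] by (simp add: continuous_on_eq_continuous_at)
  then obtain \<delta> where \<delta>: "\<delta> > 0" "\<And>\<nu>. dist \<nu> \<mu> < \<delta> \<Longrightarrow> dist (h \<nu>) (h \<mu>) < c"
    using c unfolding continuous_at_eps_delta by blast
  have hc: "norm (h \<nu>) \<ge> c" if "norm (\<nu> - \<mu>) < \<delta>" for \<nu>
    using \<delta>(2)[of \<nu>] that norm_triangle_sub[of "h \<mu>" "h \<nu>"]
    by (simp add: dist_norm c_def norm_minus_commute)
  have "a j = 0" if j: "j < k" for j
  proof (rule coeffs_eq_0_if_small[OF _ _ j])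
    show "min 1 \<delta> > 0" using \<delta> by simp
    fix t :: complex assume t: "t \<noteq> 0" "norm t < min 1 \<delta>"
    define \<nu> where "\<nu> = \<mu> + t"
    have \<nu>: "\<nu> - \<mu> = t" by (simp add: \<nu>_def)
    let ?p = "\<Sum>j<k. a j * t ^ j"
    have "norm t ^ k * norm (U \<nu> 0 v) = norm t ^ m * (norm (h \<nu>) * norm ?p)"
      using arg_cong[OF a(1)[of \<nu>], of norm] by (simp add: \<Delta> \<nu> norm_mult norm_power mult.assoc)
    moreover have "norm t ^ k * norm (U \<nu> 0 v) \<le> norm t ^ k * (C * norm t ^ m)"
      using C[of \<nu>] t \<nu> by (intro mult_left_mono) auto
    ultimately have "norm t ^ m * (norm (h \<nu>) * norm ?p) \<le> norm t ^ m * (C * norm t ^ k)"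
      by (simp only: mult_ac)
    moreover have "norm t ^ m > 0" using t by simp
    ultimately have "norm (h \<nu>) * norm ?p \<le> C * norm t ^ k" by (simp only: mult_le_cancel_left_pos)
    moreover have "c * norm ?p \<le> norm (h \<nu>) * norm ?p"
      using hc[of \<nu>] t \<nu> by (intro mult_right_mono) auto
    ultimately have "c * norm ?p \<le> C * norm t ^ k" by linarith
    then show "norm ?p \<le> C / c * norm t ^ k" using c by (simp add: field_simps)
  qed
  then show ?thesis using a(2) by blast
qed

text \<open>Each further chain element is \<open>Y \<mu>\<close> of its predecessor and so is mapped
  to it by the shifted operator. The assumed boundary values are what puts the elements into the
  domain.\<close>

lemma chain_in_kernel:
  assumes bv: "\<And>k. k \<le> n \<Longrightarrow> (Y \<mu> ^^ k) (\<phi> \<mu>) 1 1 = (if k = 0 then h1 else 0)"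
  shows "absv ((Y \<mu> ^^ n) (\<phi> \<mu>)) \<in> kernel (shifted L \<mu> ^^ Suc n)"
  using bv
proof (induction n)
  case 0
  have bc: "bc (\<phi> \<mu>)" using 0[of 0] by (simp add: bc_def \<phi>_0 e_simps)
  have "(absv (\<phi> \<mu>), 0) \<in> shifted L \<mu>"
    using shiftedI[OF square_integrable_zero sol_\<phi> bc] unfolding absv_0 .
  then show ?case by (simp add: kernel_def)
next
  case (Suc n)
  let ?c = "(Y \<mu> ^^ n) (\<phi> \<mu>)"
  have cs: "square_integrable (?c i)" for i
    by (intro square_integrable_continuous continuous_Y_pow \<phi>_continuous)
  have "bc (Y \<mu> ?c)" using Suc.prems[of "Suc n"] by (simp add: bc_def Y_0[OF cs])
  then have "(absv (Y \<mu> ?c), absv ?c) \<in> shifted L \<mu>"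
    by (rule shiftedI[OF cs sol_Y[OF cs]])
  moreover have "(absv ?c, 0) \<in> shifted L \<mu> ^^ Suc n" using Suc by (simp add: kernel_def)
  ultimately have "(absv (Y \<mu> ?c), 0) \<in> shifted L \<mu> ^^ Suc (Suc n)" by (rule relpow_Suc_I2)
  then show ?case by (simp add: kernel_def)
qed

lemma eigenvalueI:
  assumes "\<phi> \<mu> 1 1 = h1"
  shows "\<mu> \<in> eigenvalues L"
proof -
  have bc: "bc (\<phi> \<mu>)" using assms by (simp add: bc_def \<phi>_0 e_simps)
  have "(absv (\<phi> \<mu>), 0) \<in> shifted L \<mu>"
    using shiftedI[OF square_integrable_zero sol_\<phi> bc] unfolding absv_0 .
  then have "(absv (\<phi> \<mu>), \<mu> *\<^sub>C absv (\<phi> \<mu>)) \<in> L" unfolding shifted_def by auto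
  moreover have "absv (\<phi> \<mu>) \<noteq> 0"
  proof
    assume 0: "absv (\<phi> \<mu>) = 0"
    \<comment> \<open>If \<phi> \<mu> were the zero element, \<open>U_shifted\<close> would read 0 =
      -\<Delta> \<nu> for every \<nu>.\<close>
    have U0: "U \<nu> 0 0 = 0" for \<nu> using U_lin[of \<nu> 0 0 1 0] by simp
    have "\<Delta> \<nu> = 0" for \<nu>
      using U_shifted[OF square_integrable_zero sol_\<phi> bc, of \<nu>] unfolding absv_0 0 U0 by (simp add: \<phi>_0 e_simps)
    then show False using \<Delta>_nonzero by blast
  qed
  ultimately show ?thesis unfolding eigenvalues_def by blast
qed

lemma inner_absv_pairing:
  assumes y: "\<And>i. continuous_on {0..1} (y i)"
  shows "absv y \<bullet> w = Re (pairing y (\<lambda>i x. cnj (repv w i x)))"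
proof -
  note g = square_integrable_cnj[OF square_integrable_repv]
  have s: "square_integrable (\<lambda>x. cnj (repv w 1 x) * y 1 x + cnj (repv w 2 x) * y 2 x)"
    by (intro square_integrable_add square_integrable_mult_continuous g y)
  have eq: "(\<lambda>x. \<Sum>i\<in>UNIV. y i x * cnj (repv w i x)) = (\<lambda>x. cnj (repv w 1 x) * y 1 x + cnj (repv w 2 x) * y 2 x)"
    by (simp only: sum_2 mult.commute)
  have ai: "(\<lambda>x. \<Sum>i\<in>UNIV. y i x * cnj (repv w i x)) absolutely_integrable_on {0..1}"
    unfolding eq by (rule square_integrable_imp_absolutely_integrable(1)[OF s])
  have "absv y \<bullet> w = (\<integral>x. Re (\<Sum>i\<in>UNIV. y i x * cnj (repv w i x)) \<partial>unit_lebesgue)"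
    unfolding Re_sum by (rule inner_absv[OF square_integrable_continuous[OF y]])
  also have "\<dots> = Re (\<integral>x. (\<Sum>i\<in>UNIV. y i x * cnj (repv w i x)) \<partial>unit_lebesgue)"
    using ai by (intro integral_bounded_linear bounded_linear_Re) (simp only: integrable_unit_lebesgue_iff)
  also have "\<dots> = Re (pairing y (\<lambda>i x. cnj (repv w i x)))"
    unfolding pairing_def integral_unit_lebesgue_eq[OF ai] ..
  finally show ?thesis .
qed

lemma complete_system_root_functions:
  assumes S: "\<And>\<mu>. \<mu> \<in> eigenvalues L \<Longrightarrow> root_subspace L \<mu> \<subseteq> cL2.span S"
  shows "complete_system S"
proof (rule ccontr)
  assume "\<not> complete_system S"
  then have ne: "closure (cL2.span S) \<noteq> UNIV" by (simp add: complete_system_def)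
  have "subspace (cL2.span S)"
    unfolding subspace_def scaleR_eq_scaleC
    by (auto intro: cL2.span_zero cL2.span_add cL2.span_scale)
  then obtain w where w: "w \<noteq> 0" "\<And>v. v \<in> cL2.span S \<Longrightarrow> v \<bullet> w = 0"
    using exists_orthogonal[OF _ ne] by blast
  define g where "g i x = cnj (repv w i x)" for i x
  have g: "square_integrable (g i)" for i
    unfolding g_def[abs_def] by (intro square_integrable_cnj square_integrable_repv)
  have "AE x in unit_lebesgue. g i x = 0" for i
  proof (rule AE_zero_if_orthogonal_to_chains[OF g])
    fix \<mu> n assume bv: "\<And>k. k \<le> n \<Longrightarrow> (Y \<mu> ^^ k) (\<phi> \<mu>) 1 1 = (if k = 0 then h1 else 0)"
    let ?c = "(Y \<mu> ^^ n) (\<phi> \<mu>)"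
    have c: "continuous_on {0..1} (?c i)" for i by (intro continuous_Y_pow \<phi>_continuous)
    have "\<phi> \<mu> 1 1 = h1" using bv[of 0] by simp
    then have "\<mu> \<in> eigenvalues L" by (rule eigenvalueI)
    moreover have "absv ?c \<in> root_subspace L \<mu>"
    proof -
      have "absv ?c \<in> kernel (shifted L \<mu> ^^ Suc n)" by (rule chain_in_kernel) (rule bv)
      then show ?thesis unfolding root_subspace_eq by blast
    qed
    ultimately have m: "absv ?c \<in> cL2.span S" using S by blast
    have "Re (pairing ?c g) = 0" using w(2)[OF m] unfolding inner_absv_pairing[of ?c, OF c] g_def .
    \<comment> \<open>The inner product is real and sees only the real part of the pairing. The
      imaginary part comes from testing with \<i> times the chain element, which also lies in the
      complex span.\<close>
    moreover have "Re (pairing (\<lambda>i x. 0 + \<i> * ?c i x) g) = 0"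
    proof -
      have "absv (\<lambda>i x. 0 + \<i> * ?c i x) = \<i> *\<^sub>C absv ?c"
        using absv_lin[of "\<lambda>i x. 0" ?c \<i>, OF square_integrable_zero square_integrable_continuous[OF c]]
        by (simp add: absv_0)
      then have "absv (\<lambda>i x. 0 + \<i> * ?c i x) \<bullet> w = 0" using w(2)[OF cL2.span_scale[OF m, of \<i>]] by (simp only:)
      moreover have "continuous_on {0..1} (\<lambda>x. 0 + \<i> * ?c i x)" for i by (intro continuous_intros c)
      ultimately show ?thesis using inner_absv_pairing[of "\<lambda>i x. 0 + \<i> * ?c i x" w] unfolding g_def by simp
    qed
    moreover have "pairing (\<lambda>i x. 0 + \<i> * ?c i x) g = \<i> * pairing ?c g"
      using pairing_lin[of g "\<lambda>i x. 0" ?c \<i>, OF g _ c] by (simp add: pairing_def)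
    ultimately show "pairing ?c g = 0" by (simp add: complex_eq_iff)
  qed
  then have "AE x in unit_lebesgue. repv w i x = 0" for i by (simp add: g_def)
  then have "absv (repv w) = absv (\<lambda>i x. 0)"
    by (intro absv_cong_AE square_integrable_repv square_integrable_zero)
  then show False using w(1) by (simp add: absv_repv absv_0)
qed

text \<open>Independence inside the basis of one root subspace becomes, by
  \<open>separating_functional\<close>, a combination G of finitely many Taylor functionals that
  kills the other basis vectors but not y. It also kills all other root subspaces, and being bounded
  it vanishes on the closed span of S - {y}.\<close>

lemma minimal_system_root_functions:
  assumes B: "\<And>\<mu>. \<mu> \<in> eigenvalues L \<Longrightarrow> cL2.independent (B \<mu>)"
    "\<And>\<mu>. \<mu> \<in> eigenvalues L \<Longrightarrow> cL2.span (B \<mu>) = root_subspace L \<mu>"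
    and S: "S = (\<Union>\<mu>\<in>eigenvalues L. B \<mu>)"
  shows "minimal_system S"
  unfolding minimal_system_def
proof (intro ballI notI)
  fix y assume "y \<in> S" and ycl: "y \<in> closure (cL2.span (S - {y}))"
  then obtain \<mu> where \<mu>: "\<mu> \<in> eigenvalues L" "y \<in> B \<mu>" using S by blast
  obtain a where a: "\<Delta> a \<noteq> 0" using \<Delta>_nonzero by blast
  obtain m h where h: "h holomorphic_on UNIV" "h \<mu> \<noteq> 0" "\<And>\<nu>. \<Delta> \<nu> = (\<nu> - \<mu>) ^ m * h \<nu>"
    by (rule entire_factor_zero[OF \<Delta>_holomorphic a, where w = \<mu>]) (rule that; assumption)
  let ?V = "cL2.span (B \<mu> - {y})"
  have VN: "?V \<subseteq> root_subspace L \<mu>" unfolding B(2)[OF \<mu>(1), symmetric] by (rule cL2.span_mono) auto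
  have yN: "y \<in> root_subspace L \<mu>" unfolding B(2)[OF \<mu>(1), symmetric] by (rule cL2.span_base[OF \<mu>(2)])
  have yV: "y \<notin> ?V" using B(1)[OF \<mu>(1)] \<mu>(2) unfolding cL2.dependent_def by blast
  have sN: "cL2.subspace (root_subspace L \<mu>)" unfolding root_subspace_def by (rule cL2.subspace_span)
  have sep: "x = 0" if "x \<in> root_subspace L \<mu>" "\<And>j. j < m \<Longrightarrow> U \<mu> j x = 0" for x
    using that(1) U_separates_root_subspace[OF _ h that(2)] unfolding root_subspace_eq by blast
  obtain c where c: "\<forall>x\<in>?V. (\<Sum>j<m. c j * U \<mu> j x) = 0" "(\<Sum>j<m. c j * U \<mu> j y) \<noteq> 0"
    using separating_functional[of "U \<mu>", OF U_lin cL2.subspace_span sN VN yN yV sep] by blast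
  define G where "G x = (\<Sum>j<m. c j * U \<mu> j x)" for x
  have Glin: "G (x + r *\<^sub>C z) = G x + r * G z" for x z r
    unfolding G_def U_lin by (simp add: distrib_left sum.distrib sum_distrib_left mult_ac)
  have G0: "G 0 = 0" using Glin[of 0 1 0] by simp
  have "\<exists>C. \<forall>x. norm (U \<mu> j x) \<le> C * norm x" for j using U_bound by blast
  then obtain C where C: "\<And>j x. norm (U \<mu> j x) \<le> C j * norm x" by metis
  define D where "D = (\<Sum>j<m. norm (c j) * C j)"
  have Gb: "norm (G x) \<le> D * norm x" for x
  proof -
    have "norm (G x) \<le> (\<Sum>j<m. norm (c j) * (C j * norm x))"
      unfolding G_def by (rule sum_norm_le) (simp add: norm_mult mult_left_mono C)
    then show ?thesis by (simp add: D_def sum_distrib_right mult.assoc)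
  qed
  have GS: "G x = 0" if "x \<in> S - {y}" for x
  proof (cases "x \<in> B \<mu>")
    case True
    then show ?thesis using c(1) that unfolding G_def by (intro c(1)[rule_format] cL2.span_base) auto
  next
    case False
    obtain \<mu>' where \<mu>': "\<mu>' \<in> eigenvalues L" "x \<in> B \<mu>'" using \<open>x \<in> S - {y}\<close> S by blast
    then have "x \<in> root_subspace L \<mu>'" unfolding B(2)[OF \<mu>'(1), symmetric] by (intro cL2.span_base)
    then obtain k where "x \<in> kernel (shifted L \<mu>' ^^ k)" unfolding root_subspace_eq by blast
    moreover have "\<mu>' \<noteq> \<mu>" using False \<mu>'(2) by blast
    ultimately have "U \<mu> j x = 0" if "j < m" for j
      using U_eq_0_on_other_root_subspaces[OF _ _ h(1,3) that] by blast
    then show ?thesis by (simp add: G_def)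
  qed
  have "cL2.subspace {x. G x = 0}"
    unfolding cL2.subspace_def using G0 Glin[of _ 1] Glin[of 0] by simp
  then have Gspan: "G x = 0" if "x \<in> cL2.span (S - {y})" for x
    using cL2.span_minimal[of "S - {y}" "{x. G x = 0}"] GS that by blast
  obtain X where X: "\<And>n. X n \<in> cL2.span (S - {y})" "X \<longlonglongrightarrow> y"
    using ycl unfolding closure_sequential by blast
  have le: "norm (G y) \<le> D * norm (X n - y)" for n
  proof -
    have "X n - y = X n + (- 1) *\<^sub>C y" using scaleR_eq_scaleC[of "- 1" y] by simp
    then have "G (X n - y) = - G y" using Glin[of "X n" "- 1" y] Gspan[OF X(1)] by simp
    then show ?thesis using Gb[of "X n - y"] by simp
  qed
  have "(\<lambda>n. D * norm (X n - y)) \<longlonglongrightarrow> D * norm (y - y)"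
    by (intro tendsto_intros X(2))
  then have "norm (G y) \<le> D * norm (y - y)"
    by (rule LIMSEQ_le_const) (use le in blast)
  then show False using c(2) by (simp add: G_def)
qed

end

theorem theorem6p1:
  fixes b1 b2 h0 h1 :: complex
    and Q12 Q21 :: "real \<Rightarrow> complex"
    and B :: "complex^2^2"
    and Q :: "real \<Rightarrow> complex^2^2"
    and S :: "L2 set"
  assumes "b1 \<noteq> 0" and "b2 \<noteq> 0"
    and "b1 * inverse b2 \<notin> \<real>"
    and "B = vector [vector [inverse b1, 0], vector [0, inverse b2]]"
    and "Q = (\<lambda>x. vector [vector [0, Q12 x], vector [Q21 x, 0]])"
    and "square_integrable Q"
    and "h0 * h1 \<noteq> 0"
    and "root_function_system (dirac_operator B Q h0 h1) S"
  shows "complete_system S \<and> minimal_system S"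
proof -
  define b where "b i = (if i = 1 then b1 else b2)" for i :: 2
  define q where "q i = (if i = 1 then Q12 else Q21)" for i :: 2
  have q12: "Q12 = (\<lambda>x. Q x $ 1 $ 2)" "Q21 = (\<lambda>x. Q x $ 2 $ 1)" by (simp_all add: assms(5))
  have Q12: "square_integrable Q12"
    unfolding q12(1) by (rule square_integrable_vec_nth[OF square_integrable_vec_nth[OF assms(6)]])
  have Q21: "square_integrable Q21"
    unfolding q12(2) by (rule square_integrable_vec_nth[OF square_integrable_vec_nth[OF assms(6)]])
  have D: "dirac_bvp b q h0 h1"
  proof (intro dirac_bvp.intro dirac.intro dirac_bvp_axioms.intro)
    show "square_integrable (q i)" for i using Q12 Q21 by (simp add: q_def)
    show "b i \<noteq> 0" for i using assms(1,2) by (simp add: b_def)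
    show "b 1 / b 2 \<notin> \<real>" using assms(3) by (simp add: b_def divide_inverse)
    show "h0 \<noteq> 0" "h1 \<noteq> 0" using assms(7) by simp_all
  qed
  define L where "L = dirac_operator B Q h0 h1"
  have L: "L = dirac_bvp.L b q h0 h1"
    unfolding L_def dirac_bvp.L_def[OF D] assms(4,5) by (simp add: b_def q_def)
  obtain bs where bs: "\<And>\<mu>. \<mu> \<in> eigenvalues L \<Longrightarrow> cL2.independent (bs \<mu>)"
      "\<And>\<mu>. \<mu> \<in> eigenvalues L \<Longrightarrow> cL2.span (bs \<mu>) = root_subspace L \<mu>"
    and S: "S = (\<Union>\<mu>\<in>eigenvalues L. bs \<mu>)"
    using assms(8) unfolding root_function_system_def L_def[symmetric] by blast
  have "complete_system S"
  proof (rule dirac_bvp.complete_system_root_functions[OF D, folded L])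
    fix \<mu> assume \<mu>: "\<mu> \<in> eigenvalues L"
    have "cL2.span (bs \<mu>) \<subseteq> cL2.span S" by (rule cL2.span_mono) (use S \<mu> in blast)
    then show "root_subspace L \<mu> \<subseteq> cL2.span S" by (simp only: bs(2)[OF \<mu>])
  qed
  moreover have "minimal_system S" by (rule dirac_bvp.minimal_system_root_functions[OF D, folded L, OF bs S])
  ultimately show ?thesis ..
qed

end
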